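(* Let $\Gamma$ be an abelian group, $\mathsf{k}$ a commutative $\Gamma$-graded ring concentrated in degree zero, and $R$ a strongly $\Gamma$-graded $\mathsf{k}$-algebra. Suppose that $M$ is a $\Gamma$-graded $R$-module and $P$ a graded finitely generated projective $R$-module. Then there is an isomorphism of $\Gamma$-graded $\mathsf{k}$-algebras $$R\ast_{R_0}R_0\langle f_0:\overline{M_0}\to\overline{P_0}\rangle\ \cong\ R\langle f:\overline M\to\overline P\rangle.$$
   Context: Rings are unital, modules are left modules, graded homomorphisms preserve degrees. A $\Gamma$-graded $\mathsf{k}$-algebra is a $\Gamma$-graded ring $R=\bigoplus_\gamma R_\gamma$ with a graded ring homomorphism from $\mathsf{k}$ into its centre; it is strongly graded if $R_\alpha R_\beta=R_{\alpha+\beta}$ for all $\alpha,\beta\in\Gamma$. $R_0,M_0,P_0$ denote the degree-zero components; since $R$ is strongly graded, $P_0$ is a finitely generated projective $R_0$-module. A graded $R$-ring$_{\mathsf{k}}$ is a $\Gamma$-graded $\mathsf{k}$-algebra with a graded $\mathsf{k}$-algebra homomorphism from $R$. For a graded $R$-module $M$ and a graded finitely generated projective $R$-module $P$, $R\langle f:\overline M\to\overline P\rangle$ denotes the graded $R$-ring$_{\mathsf{k}}$ $S$ with universal graded $S$-module homomorphism $f:S\otimes_RM\to S\otimes_RP$: for every graded $R$-ring$_{\mathsf{k}}$ $T$ and graded $T$-module homomorphism $g:T\otimes_RM\to T\otimes_RP$ there is a unique graded homomorphism $S\to T$ of $R$-rings$_{\mathsf{k}}$ with $g=T\otimes_Sf$.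 $R_0\langle f_0:\overline{M_0}\to\overline{P_0}\rangle$ is the analogous universal (ungraded) $R_0$-ring$_{\mathsf{k}}$ for the $R_0$-modules $M_0,P_0$, regarded as concentrated in degree zero. $\ast_{R_0}$ denotes the coproduct (pushout) of $\mathsf{k}$-algebras over $R_0$, with its natural $\Gamma$-grading induced from the gradings of the factors. *)

theory Defs
  imports
    "HOL-Algebra.Module" "HOL-Algebra.QuotRing" "HOL-Algebra.Generated_Groups"
    "HOL-Algebra.Free_Abelian_Groups"
begin

section \<open>Graded rings and algebras\<close>

text \<open>
  Rings are unital but not necessarily commutative, and are given by explicit carriers.
  The grading group is a type of class \<^class>\<open>ab_group_add\<close>.  A grading of \<open>A\<close> is a family
  of additive subgroups of which \<open>A\<close> is the internal direct sum.
\<close>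

definition is_grading :: "('a, 'x) ring_scheme \<Rightarrow> ('g \<Rightarrow> 'a set) \<Rightarrow> bool" where
  "is_grading A Ag \<longleftrightarrow>
     (\<forall>\<gamma>. additive_subgroup (Ag \<gamma>) A) \<and>
     (\<forall>x\<in>carrier A. \<exists>!c. (\<forall>\<gamma>. c \<gamma> \<in> Ag \<gamma>) \<and> finite {\<gamma>. c \<gamma> \<noteq> \<zero>\<^bsub>A\<^esub>} \<and>
        x = finsum A c {\<gamma>. c \<gamma> \<noteq> \<zero>\<^bsub>A\<^esub>})"

definition concentrated :: "('a, 'x) ring_scheme \<Rightarrow> 'g::ab_group_add \<Rightarrow> 'a set" where
  "concentrated A \<gamma> = (if \<gamma> = 0 then carrier A else {\<zero>\<^bsub>A\<^esub>})"

locale graded_ring = ring R for R :: "('a, 'x) ring_scheme" (structure) +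
  fixes Rg :: "'g::ab_group_add \<Rightarrow> 'a set"
  assumes grading: "is_grading R Rg"
    and graded_mult: "\<lbrakk>a \<in> Rg \<alpha>; b \<in> Rg \<beta>\<rbrakk> \<Longrightarrow> a \<otimes> b \<in> Rg (\<alpha> + \<beta>)"

text \<open>The product of two sets of ring elements is the additive subgroup spanned by all products.\<close>

locale strongly_graded_ring = graded_ring +
  assumes strongly_graded:
    "generate (add_monoid R) {a \<otimes> b | a b. a \<in> Rg \<alpha> \<and> b \<in> Rg \<beta>} = Rg (\<alpha> + \<beta>)"

locale k_algebra = k: cring k + ring A
    for k :: "('k, 'x) ring_scheme" (structure) and A :: "('a, 'y) ring_scheme" (structure) +
  fixes \<eta> :: "'k \<Rightarrow> 'a"
  assumes structure_hom: "\<eta> \<in> ring_hom k A"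
    and central: "\<lbrakk>c \<in> carrier k; a \<in> carrier A\<rbrakk> \<Longrightarrow> \<eta> c \<otimes>\<^bsub>A\<^esub> a = a \<otimes>\<^bsub>A\<^esub> \<eta> c"

definition alg_hom ::
  "('k, 'x) ring_scheme \<Rightarrow> ('a, 'y) ring_scheme \<Rightarrow> ('k \<Rightarrow> 'a) \<Rightarrow>
   ('b, 'z) ring_scheme \<Rightarrow> ('k \<Rightarrow> 'b) \<Rightarrow> ('a \<Rightarrow> 'b) set" where
  "alg_hom k A \<eta>A B \<eta>B = {h \<in> ring_hom A B. \<forall>c\<in>carrier k. h (\<eta>A c) = \<eta>B c}"

definition graded_algebra ::
  "('k, 'x) ring_scheme \<Rightarrow> ('g::ab_group_add \<Rightarrow> 'k set) \<Rightarrow>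
   ('a, 'y) ring_scheme \<Rightarrow> ('k \<Rightarrow> 'a) \<Rightarrow> ('g \<Rightarrow> 'a set) \<Rightarrow> bool" where
  "graded_algebra k kg A \<eta> Ag \<longleftrightarrow>
     graded_ring k kg \<and> graded_ring A Ag \<and> k_algebra k A \<eta> \<and> (\<forall>\<gamma>. \<eta> ` kg \<gamma> \<subseteq> Ag \<gamma>)"

definition graded_alg_hom ::
  "('k, 'x) ring_scheme \<Rightarrow> ('a, 'y) ring_scheme \<Rightarrow> ('k \<Rightarrow> 'a) \<Rightarrow> ('g \<Rightarrow> 'a set) \<Rightarrow>
   ('b, 'z) ring_scheme \<Rightarrow> ('k \<Rightarrow> 'b) \<Rightarrow> ('g \<Rightarrow> 'b set) \<Rightarrow> ('a \<Rightarrow> 'b) set" where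
  "graded_alg_hom k A \<eta>A Ag B \<eta>B Bg =
     {h \<in> alg_hom k A \<eta>A B \<eta>B. \<forall>\<gamma>. h ` Ag \<gamma> \<subseteq> Bg \<gamma>}"

definition graded_algebras_isomorphic ::
  "('k, 'x) ring_scheme \<Rightarrow> ('g::ab_group_add \<Rightarrow> 'k set) \<Rightarrow>
   ('a, 'y) ring_scheme \<Rightarrow> ('k \<Rightarrow> 'a) \<Rightarrow> ('g \<Rightarrow> 'a set) \<Rightarrow>
   ('b, 'z) ring_scheme \<Rightarrow> ('k \<Rightarrow> 'b) \<Rightarrow> ('g \<Rightarrow> 'b set) \<Rightarrow> bool" where
  "graded_algebras_isomorphic k kg A \<eta>A Ag B \<eta>B Bg \<longleftrightarrow>
     graded_algebra k kg A \<eta>A Ag \<and> graded_algebra k kg B \<eta>B Bg \<and>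
     (\<exists>\<phi>\<in>alg_hom k A \<eta>A B \<eta>B.
        bij_betw \<phi> (carrier A) (carrier B) \<and> (\<forall>\<gamma>. \<phi> ` Ag \<gamma> = Bg \<gamma>))"

section \<open>Graded left modules\<close>

text \<open>
  The locale \<^locale>\<open>module\<close> of the library requires a commutative ring of scalars.
  We use its record type; the \<open>mult\<close> and \<open>one\<close> fields of a module are irrelevant.
\<close>

locale left_module = R?: ring R + M?: abelian_group M
    for R :: "('r, 'x) ring_scheme" (structure) and M :: "('r, 'm, 'y) module_scheme" (structure) +
  assumes smult_closed: "\<lbrakk>a \<in> carrier R; x \<in> carrier M\<rbrakk> \<Longrightarrow> a \<odot>\<^bsub>M\<^esub> x \<in> carrier M"
    and smult_l_distr: "\<lbrakk>a \<in> carrier R; b \<in> carrier R; x \<in> carrier M\<rbrakk> \<Longrightarrow>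
      (a \<oplus>\<^bsub>R\<^esub> b) \<odot>\<^bsub>M\<^esub> x = a \<odot>\<^bsub>M\<^esub> x \<oplus>\<^bsub>M\<^esub> b \<odot>\<^bsub>M\<^esub> x"
    and smult_r_distr: "\<lbrakk>a \<in> carrier R; x \<in> carrier M; y \<in> carrier M\<rbrakk> \<Longrightarrow>
      a \<odot>\<^bsub>M\<^esub> (x \<oplus>\<^bsub>M\<^esub> y) = a \<odot>\<^bsub>M\<^esub> x \<oplus>\<^bsub>M\<^esub> a \<odot>\<^bsub>M\<^esub> y"
    and smult_assoc: "\<lbrakk>a \<in> carrier R; b \<in> carrier R; x \<in> carrier M\<rbrakk> \<Longrightarrow>
      (a \<otimes>\<^bsub>R\<^esub> b) \<odot>\<^bsub>M\<^esub> x = a \<odot>\<^bsub>M\<^esub> (b \<odot>\<^bsub>M\<^esub> x)"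
    and smult_one: "x \<in> carrier M \<Longrightarrow> \<one>\<^bsub>R\<^esub> \<odot>\<^bsub>M\<^esub> x = x"

definition graded_module ::
  "('r, 'x) ring_scheme \<Rightarrow> ('g::ab_group_add \<Rightarrow> 'r set) \<Rightarrow>
   ('r, 'm, 'y) module_scheme \<Rightarrow> ('g \<Rightarrow> 'm set) \<Rightarrow> bool" where
  "graded_module R Rg M Mg \<longleftrightarrow>
     graded_ring R Rg \<and> left_module R M \<and> is_grading M Mg \<and>
     (\<forall>\<alpha> \<beta>. \<forall>r\<in>Rg \<alpha>. \<forall>m\<in>Mg \<beta>. r \<odot>\<^bsub>M\<^esub> m \<in> Mg (\<alpha> + \<beta>))"

definition module_hom ::
  "('r, 'x) ring_scheme \<Rightarrow> ('r, 'm, 'y) module_scheme \<Rightarrow> ('r, 'n, 'z) module_scheme \<Rightarrow>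
   ('m \<Rightarrow> 'n) set" where
  "module_hom R M N = {f \<in> carrier M \<rightarrow> carrier N.
     (\<forall>x\<in>carrier M. \<forall>y\<in>carrier M. f (x \<oplus>\<^bsub>M\<^esub> y) = f x \<oplus>\<^bsub>N\<^esub> f y) \<and>
     (\<forall>r\<in>carrier R. \<forall>x\<in>carrier M. f (r \<odot>\<^bsub>M\<^esub> x) = r \<odot>\<^bsub>N\<^esub> f x)}"

definition graded_module_hom ::
  "('r, 'x) ring_scheme \<Rightarrow> ('r, 'm, 'y) module_scheme \<Rightarrow> ('g \<Rightarrow> 'm set) \<Rightarrow>
   ('r, 'n, 'z) module_scheme \<Rightarrow> ('g \<Rightarrow> 'n set) \<Rightarrow> ('m \<Rightarrow> 'n) set" where
  "graded_module_hom R M Mg N Ng = {f \<in> module_hom R M N. \<forall>\<gamma>. f ` Mg \<gamma> \<subseteq> Ng \<gamma>}"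

text \<open>
  The graded free module \<open>R(d 0) \<oplus> \<dots> \<oplus> R(d (n - 1))\<close>, where \<open>R(\<delta>)\<close> is the shift of \<open>R\<close>
  with homogeneous components \<open>R(\<delta>)\<^sub>\<gamma> = R\<^sub>\<gamma>\<^sub>+\<^sub>\<delta>\<close>.
\<close>

definition free_module :: "('r, 'x) ring_scheme \<Rightarrow> nat \<Rightarrow> ('r, nat \<Rightarrow> 'r) module" where
  "free_module R n =
     \<lparr>carrier = {..<n} \<rightarrow>\<^sub>E carrier R, mult = undefined, one = undefined,
      ring.zero = (\<lambda>i\<in>{..<n}. \<zero>\<^bsub>R\<^esub>), ring.add = (\<lambda>x y. \<lambda>i\<in>{..<n}. x i \<oplus>\<^bsub>R\<^esub> y i),
      smult = (\<lambda>r x. \<lambda>i\<in>{..<n}. r \<otimes>\<^bsub>R\<^esub> x i)\<rparr>"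

definition free_module_grading ::
  "('g::ab_group_add \<Rightarrow> 'r set) \<Rightarrow> nat \<Rightarrow> (nat \<Rightarrow> 'g) \<Rightarrow> 'g \<Rightarrow> (nat \<Rightarrow> 'r) set" where
  "free_module_grading Rg n d \<gamma> = (\<Pi>\<^sub>E i\<in>{..<n}. Rg (\<gamma> + d i))"

text \<open>
  Graded finitely generated projective: a direct summand, in the category of graded modules,
  of a graded free module of finite rank.
\<close>

definition graded_fg_projective ::
  "('r, 'x) ring_scheme \<Rightarrow> ('g::ab_group_add \<Rightarrow> 'r set) \<Rightarrow>
   ('r, 'p, 'y) module_scheme \<Rightarrow> ('g \<Rightarrow> 'p set) \<Rightarrow> bool" where
  "graded_fg_projective R Rg P Pg \<longleftrightarrow>
     graded_module R Rg P Pg \<and>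
     (\<exists>n d. \<exists>\<iota>\<in>graded_module_hom R P Pg (free_module R n) (free_module_grading Rg n d).
        \<exists>\<pi>\<in>graded_module_hom R (free_module R n) (free_module_grading Rg n d) P Pg.
          \<forall>p\<in>carrier P. \<pi> (\<iota> p) = p)"

section \<open>Extension of scalars\<close>

text \<open>
  For a ring homomorphism \<open>h : R \<rightarrow> T\<close>, the left \<open>T\<close>-module \<open>T \<otimes>\<^sub>R N\<close> is the quotient of the free
  abelian group on \<open>T \<times> N\<close> by the usual relations, \<open>T\<close> being a right \<open>R\<close>-module by \<open>t r = t h(r)\<close>.
  Its elements are cosets, and \<open>coset_map K \<Phi>\<close> is the map between such quotients (with \<open>K\<close> the
  subgroup of relations of the target) induced by a map \<open>\<Phi>\<close> on the generators.
\<close>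

definition tensor_free ::
  "('t, 'x) ring_scheme \<Rightarrow> ('r, 'n, 'y) module_scheme \<Rightarrow> ('t \<times> 'n \<Rightarrow>\<^sub>0 int) monoid" where
  "tensor_free T N = free_Abelian_group (carrier T \<times> carrier N)"

definition tensor_rels ::
  "('r, 'x) ring_scheme \<Rightarrow> ('t, 'y) ring_scheme \<Rightarrow> ('r \<Rightarrow> 't) \<Rightarrow>
   ('r, 'n, 'z) module_scheme \<Rightarrow> ('t \<times> 'n \<Rightarrow>\<^sub>0 int) set" where
  "tensor_rels R T h N = generate (tensor_free T N)
     ({frag_of (s \<oplus>\<^bsub>T\<^esub> t, n) - frag_of (s, n) - frag_of (t, n) | s t n.
         s \<in> carrier T \<and> t \<in> carrier T \<and> n \<in> carrier N} \<union>
      {frag_of (t, m \<oplus>\<^bsub>N\<^esub> n) - frag_of (t, m) - frag_of (t, n) | t m n.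
         t \<in> carrier T \<and> m \<in> carrier N \<and> n \<in> carrier N} \<union>
      {frag_of (t \<otimes>\<^bsub>T\<^esub> h r, n) - frag_of (t, r \<odot>\<^bsub>N\<^esub> n) | t r n.
         t \<in> carrier T \<and> r \<in> carrier R \<and> n \<in> carrier N})"

definition coset_map ::
  "('b \<Rightarrow>\<^sub>0 int) set \<Rightarrow> ('a \<Rightarrow> 'b \<Rightarrow>\<^sub>0 int) \<Rightarrow> ('a \<Rightarrow>\<^sub>0 int) set \<Rightarrow> ('b \<Rightarrow>\<^sub>0 int) set" where
  "coset_map K \<Phi> X = (\<Union>u\<in>X. (\<lambda>v. v + frag_extend \<Phi> u) ` K)"

definition tensor ::
  "('r, 'x) ring_scheme \<Rightarrow> ('t, 'y) ring_scheme \<Rightarrow> ('r \<Rightarrow> 't) \<Rightarrow>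
   ('r, 'n, 'z) module_scheme \<Rightarrow> ('t, ('t \<times> 'n \<Rightarrow>\<^sub>0 int) set) module" where
  "tensor R T h N =
     (let Q = tensor_free T N Mod tensor_rels R T h N in
      \<lparr>carrier = carrier Q, mult = undefined, one = undefined,
       ring.zero = \<one>\<^bsub>Q\<^esub>, ring.add = mult Q,
       smult = (\<lambda>t. coset_map (tensor_rels R T h N) (\<lambda>(s, n). frag_of (t \<otimes>\<^bsub>T\<^esub> s, n)))\<rparr>)"

definition pure_tensor ::
  "('r, 'x) ring_scheme \<Rightarrow> ('t, 'y) ring_scheme \<Rightarrow> ('r \<Rightarrow> 't) \<Rightarrow>
   ('r, 'n, 'z) module_scheme \<Rightarrow> 't \<Rightarrow> 'n \<Rightarrow> ('t \<times> 'n \<Rightarrow>\<^sub>0 int) set" where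
  "pure_tensor R T h N t n = tensor_rels R T h N #>\<^bsub>tensor_free T N\<^esub> frag_of (t, n)"

definition tensor_grading ::
  "('r, 'x) ring_scheme \<Rightarrow> ('t, 'y) ring_scheme \<Rightarrow> ('g::ab_group_add \<Rightarrow> 't set) \<Rightarrow> ('r \<Rightarrow> 't) \<Rightarrow>
   ('r, 'n, 'z) module_scheme \<Rightarrow> ('g \<Rightarrow> 'n set) \<Rightarrow> 'g \<Rightarrow> ('t \<times> 'n \<Rightarrow>\<^sub>0 int) set set" where
  "tensor_grading R T Tg h N Ng \<gamma> = generate (add_monoid (tensor R T h N))
     {pure_tensor R T h N t n | t n. \<exists>\<alpha> \<beta>. t \<in> Tg \<alpha> \<and> n \<in> Ng \<beta> \<and> \<alpha> + \<beta> = \<gamma>}"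

text \<open>The \<open>T\<close>-linear map \<open>T \<otimes>\<^sub>S f : T \<otimes>\<^sub>S N \<rightarrow> T \<otimes>\<^sub>S N'\<close> induced by \<open>f : N \<rightarrow> N'\<close>.\<close>

definition tensor_map ::
  "('s, 'x) ring_scheme \<Rightarrow> ('t, 'y) ring_scheme \<Rightarrow> ('s \<Rightarrow> 't) \<Rightarrow>
   ('s, 'm, 'z) module_scheme \<Rightarrow> ('n \<Rightarrow> 'm) \<Rightarrow>
   ('t \<times> 'n \<Rightarrow>\<^sub>0 int) set \<Rightarrow> ('t \<times> 'm \<Rightarrow>\<^sub>0 int) set" where
  "tensor_map S T h N' f = coset_map (tensor_rels S T h N') (\<lambda>(t, n). frag_of (t, f n))"

text \<open>
  For ring homomorphisms \<open>\<sigma> : R \<rightarrow> S\<close> and \<open>h : S \<rightarrow> T\<close>, the canonical isomorphism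
  \<open>T \<otimes>\<^sub>R N \<rightarrow> T \<otimes>\<^sub>S (S \<otimes>\<^sub>R N)\<close> sending \<open>t \<otimes> n\<close> to \<open>t \<otimes> (1 \<otimes> n)\<close>.
\<close>

definition tensor_trans ::
  "('r, 'w) ring_scheme \<Rightarrow> ('s, 'x) ring_scheme \<Rightarrow> ('r \<Rightarrow> 's) \<Rightarrow>
   ('t, 'y) ring_scheme \<Rightarrow> ('s \<Rightarrow> 't) \<Rightarrow> ('r, 'n, 'z) module_scheme \<Rightarrow>
   ('t \<times> 'n \<Rightarrow>\<^sub>0 int) set \<Rightarrow> ('t \<times> ('s \<times> 'n \<Rightarrow>\<^sub>0 int) set \<Rightarrow>\<^sub>0 int) set" where
  "tensor_trans R S \<sigma> T h N =
     coset_map (tensor_rels S T h (tensor R S \<sigma> N))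
       (\<lambda>(t, n). frag_of (t, pure_tensor R S \<sigma> N \<one>\<^bsub>S\<^esub> n))"

text \<open>
  \<open>g = T \<otimes>\<^sub>S f\<close> for \<open>f : S \<otimes>\<^sub>R M \<rightarrow> S \<otimes>\<^sub>R P\<close> and \<open>g : T \<otimes>\<^sub>R M \<rightarrow> T \<otimes>\<^sub>R P\<close>, with
  \<open>T \<otimes>\<^sub>S (S \<otimes>\<^sub>R _)\<close> identified with \<open>T \<otimes>\<^sub>R _\<close> along the canonical isomorphism.
\<close>

definition is_base_change ::
  "('r, 'w) ring_scheme \<Rightarrow> ('r, 'm, 'y) module_scheme \<Rightarrow> ('r, 'p, 'z) module_scheme \<Rightarrow>
   ('s, 'v) ring_scheme \<Rightarrow> ('r \<Rightarrow> 's) \<Rightarrow>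
   (('s \<times> 'm \<Rightarrow>\<^sub>0 int) set \<Rightarrow> ('s \<times> 'p \<Rightarrow>\<^sub>0 int) set) \<Rightarrow>
   ('t, 'x) ring_scheme \<Rightarrow> ('r \<Rightarrow> 't) \<Rightarrow>
   (('t \<times> 'm \<Rightarrow>\<^sub>0 int) set \<Rightarrow> ('t \<times> 'p \<Rightarrow>\<^sub>0 int) set) \<Rightarrow> ('s \<Rightarrow> 't) \<Rightarrow> bool" where
  "is_base_change R M P S \<sigma> f T \<tau> g h \<longleftrightarrow>
     (\<forall>x\<in>carrier (tensor R T \<tau> M).
        tensor_trans R S \<sigma> T h P (g x) =
        tensor_map S T h (tensor R S \<sigma> P) f (tensor_trans R S \<sigma> T h M x))"

section \<open>Universal homomorphisms and coproducts\<close>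

text \<open>
  Universal properties are quantified over rings with carrier in a type \<open>'t\<close>, given by an
  argument of type \<open>'t itself\<close>, since a formula of HOL cannot quantify over types.  The unique
  homomorphism is made unique as a function by requiring it to be \<^const>\<open>extensional\<close>.
  In the algebra \<open>R\<close> the structure map is \<open>\<eta>\<close>; an \<open>R\<close>-ring over \<open>k\<close> is an algebra \<open>S\<close>
  together with an algebra homomorphism \<open>\<sigma>\<close> from \<open>R\<close>.
\<close>

definition R_ring ::
  "('k, 'x) ring_scheme \<Rightarrow> ('r, 'y) ring_scheme \<Rightarrow> ('k \<Rightarrow> 'r) \<Rightarrow>
   ('s, 'z) ring_scheme \<Rightarrow> ('k \<Rightarrow> 's) \<Rightarrow> ('r \<Rightarrow> 's) \<Rightarrow> bool" where
  "R_ring k R \<eta> S \<eta>S \<sigma> \<longleftrightarrow>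
     k_algebra k R \<eta> \<and> k_algebra k S \<eta>S \<and> \<sigma> \<in> alg_hom k R \<eta> S \<eta>S"

definition graded_R_ring ::
  "('k, 'x) ring_scheme \<Rightarrow> ('g::ab_group_add \<Rightarrow> 'k set) \<Rightarrow>
   ('r, 'y) ring_scheme \<Rightarrow> ('k \<Rightarrow> 'r) \<Rightarrow> ('g \<Rightarrow> 'r set) \<Rightarrow>
   ('s, 'z) ring_scheme \<Rightarrow> ('k \<Rightarrow> 's) \<Rightarrow> ('g \<Rightarrow> 's set) \<Rightarrow> ('r \<Rightarrow> 's) \<Rightarrow> bool" where
  "graded_R_ring k kg R \<eta> Rg S \<eta>S Sg \<sigma> \<longleftrightarrow>
     graded_algebra k kg R \<eta> Rg \<and> graded_algebra k kg S \<eta>S Sg \<and>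
     \<sigma> \<in> graded_alg_hom k R \<eta> Rg S \<eta>S Sg"

text \<open>\<open>(S, f)\<close> is the ungraded \<open>R\<langle>f : M \<rightarrow> P\<rangle>\<close>.\<close>

definition is_universal_hom_ring ::
  "'t itself \<Rightarrow> ('k, 'x) ring_scheme \<Rightarrow> ('r, 'y) ring_scheme \<Rightarrow> ('k \<Rightarrow> 'r) \<Rightarrow>
   ('r, 'm, 'z) module_scheme \<Rightarrow> ('r, 'p, 'w) module_scheme \<Rightarrow>
   ('s, 'v) ring_scheme \<Rightarrow> ('k \<Rightarrow> 's) \<Rightarrow> ('r \<Rightarrow> 's) \<Rightarrow>
   (('s \<times> 'm \<Rightarrow>\<^sub>0 int) set \<Rightarrow> ('s \<times> 'p \<Rightarrow>\<^sub>0 int) set) \<Rightarrow> bool" where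
  "is_universal_hom_ring \<T> k R \<eta> M P S \<eta>S \<sigma> f \<longleftrightarrow>
     R_ring k R \<eta> S \<eta>S \<sigma> \<and>
     f \<in> module_hom S (tensor R S \<sigma> M) (tensor R S \<sigma> P) \<and>
     (\<forall>(T :: 't ring) \<eta>T \<tau> g.
        R_ring k R \<eta> T \<eta>T \<tau> \<longrightarrow>
        g \<in> module_hom T (tensor R T \<tau> M) (tensor R T \<tau> P) \<longrightarrow>
        (\<exists>!h. h \<in> extensional (carrier S) \<and> h \<in> alg_hom k S \<eta>S T \<eta>T \<and>
              (\<forall>r\<in>carrier R. h (\<sigma> r) = \<tau> r) \<and> is_base_change R M P S \<sigma> f T \<tau> g h))"

text \<open>\<open>(S, f)\<close> is the graded \<open>R\<langle>f : M \<rightarrow> P\<rangle>\<close>.\<close>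

definition is_universal_graded_hom_ring ::
  "'t itself \<Rightarrow> ('k, 'x) ring_scheme \<Rightarrow> ('g::ab_group_add \<Rightarrow> 'k set) \<Rightarrow>
   ('r, 'y) ring_scheme \<Rightarrow> ('k \<Rightarrow> 'r) \<Rightarrow> ('g \<Rightarrow> 'r set) \<Rightarrow>
   ('r, 'm, 'z) module_scheme \<Rightarrow> ('g \<Rightarrow> 'm set) \<Rightarrow>
   ('r, 'p, 'w) module_scheme \<Rightarrow> ('g \<Rightarrow> 'p set) \<Rightarrow>
   ('s, 'v) ring_scheme \<Rightarrow> ('k \<Rightarrow> 's) \<Rightarrow> ('g \<Rightarrow> 's set) \<Rightarrow> ('r \<Rightarrow> 's) \<Rightarrow>
   (('s \<times> 'm \<Rightarrow>\<^sub>0 int) set \<Rightarrow> ('s \<times> 'p \<Rightarrow>\<^sub>0 int) set) \<Rightarrow> bool" where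
  "is_universal_graded_hom_ring \<T> k kg R \<eta> Rg M Mg P Pg S \<eta>S Sg \<sigma> f \<longleftrightarrow>
     graded_R_ring k kg R \<eta> Rg S \<eta>S Sg \<sigma> \<and>
     f \<in> graded_module_hom S (tensor R S \<sigma> M) (tensor_grading R S Sg \<sigma> M Mg)
                             (tensor R S \<sigma> P) (tensor_grading R S Sg \<sigma> P Pg) \<and>
     (\<forall>(T :: 't ring) \<eta>T Tg \<tau> g.
        graded_R_ring k kg R \<eta> Rg T \<eta>T Tg \<tau> \<longrightarrow>
        g \<in> graded_module_hom T (tensor R T \<tau> M) (tensor_grading R T Tg \<tau> M Mg)
                                (tensor R T \<tau> P) (tensor_grading R T Tg \<tau> P Pg) \<longrightarrow>
        (\<exists>!h. h \<in> extensional (carrier S) \<and> h \<in> graded_alg_hom k S \<eta>S Sg T \<eta>T Tg \<and>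
              (\<forall>r\<in>carrier R. h (\<sigma> r) = \<tau> r) \<and> is_base_change R M P S \<sigma> f T \<tau> g h))"

text \<open>
  \<open>C\<close> with \<open>i : A \<rightarrow> C\<close> and \<open>j : B \<rightarrow> C\<close> is the coproduct \<open>A *\<^sub>D B\<close> of (ungraded) \<open>k\<close>-algebras
  over \<open>D\<close>, that is, the pushout of \<open>a : D \<rightarrow> A\<close> and \<open>b : D \<rightarrow> B\<close>.
\<close>

definition is_coproduct ::
  "'t itself \<Rightarrow> ('k, 'v) ring_scheme \<Rightarrow> ('d, 'w) ring_scheme \<Rightarrow> ('k \<Rightarrow> 'd) \<Rightarrow>
   ('a, 'x) ring_scheme \<Rightarrow> ('k \<Rightarrow> 'a) \<Rightarrow> ('d \<Rightarrow> 'a) \<Rightarrow>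
   ('b, 'y) ring_scheme \<Rightarrow> ('k \<Rightarrow> 'b) \<Rightarrow> ('d \<Rightarrow> 'b) \<Rightarrow>
   ('c, 'z) ring_scheme \<Rightarrow> ('k \<Rightarrow> 'c) \<Rightarrow> ('a \<Rightarrow> 'c) \<Rightarrow> ('b \<Rightarrow> 'c) \<Rightarrow> bool" where
  "is_coproduct \<T> k D \<eta>D A \<eta>A a B \<eta>B b C \<eta>C i j \<longleftrightarrow>
     R_ring k D \<eta>D A \<eta>A a \<and> R_ring k D \<eta>D B \<eta>B b \<and> k_algebra k C \<eta>C \<and>
     i \<in> alg_hom k A \<eta>A C \<eta>C \<and> j \<in> alg_hom k B \<eta>B C \<eta>C \<and>
     (\<forall>d\<in>carrier D. i (a d) = j (b d)) \<and>
     (\<forall>(T :: 't ring) \<eta>T u v.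
        k_algebra k T \<eta>T \<longrightarrow> u \<in> alg_hom k A \<eta>A T \<eta>T \<longrightarrow> v \<in> alg_hom k B \<eta>B T \<eta>T \<longrightarrow>
        (\<forall>d\<in>carrier D. u (a d) = v (b d)) \<longrightarrow>
        (\<exists>!h. h \<in> extensional (carrier C) \<and> h \<in> alg_hom k C \<eta>C T \<eta>T \<and>
              (\<forall>x\<in>carrier A. h (i x) = u x) \<and> (\<forall>y\<in>carrier B. h (j y) = v y)))"

text \<open>
  The grading of the coproduct induced by gradings of the factors: the component of degree \<open>\<gamma>\<close>
  is spanned by the products \<open>c\<^sub>1 \<cdots> c\<^sub>n\<close> of images of homogeneous elements of the two factors
  whose degrees add up to \<open>\<gamma>\<close>.
\<close>

inductive_set coproduct_monomials ::
  "('c, 'z) ring_scheme \<Rightarrow> ('a \<Rightarrow> 'c) \<Rightarrow> ('g::ab_group_add \<Rightarrow> 'a set) \<Rightarrow>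
   ('b \<Rightarrow> 'c) \<Rightarrow> ('g \<Rightarrow> 'b set) \<Rightarrow> ('g \<times> 'c) set"
  for C i Ag j Bg where
  one: "(0, \<one>\<^bsub>C\<^esub>) \<in> coproduct_monomials C i Ag j Bg"
| left: "\<lbrakk>a \<in> Ag \<alpha>; (\<beta>, c) \<in> coproduct_monomials C i Ag j Bg\<rbrakk> \<Longrightarrow>
    (\<alpha> + \<beta>, i a \<otimes>\<^bsub>C\<^esub> c) \<in> coproduct_monomials C i Ag j Bg"
| right: "\<lbrakk>b \<in> Bg \<alpha>; (\<beta>, c) \<in> coproduct_monomials C i Ag j Bg\<rbrakk> \<Longrightarrow>
    (\<alpha> + \<beta>, j b \<otimes>\<^bsub>C\<^esub> c) \<in> coproduct_monomials C i Ag j Bg"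

definition coproduct_grading ::
  "('c, 'z) ring_scheme \<Rightarrow> ('a \<Rightarrow> 'c) \<Rightarrow> ('g::ab_group_add \<Rightarrow> 'a set) \<Rightarrow>
   ('b \<Rightarrow> 'c) \<Rightarrow> ('g \<Rightarrow> 'b set) \<Rightarrow> 'g \<Rightarrow> 'c set" where
  "coproduct_grading C i Ag j Bg \<gamma> =
     generate (add_monoid C) {c. (\<gamma>, c) \<in> coproduct_monomials C i Ag j Bg}"

end

theory Submission
  imports Defs
begin

text \<open>
  Since \<open>R\<close> is strongly graded, \<open>P\<close> has a finite dual basis of degree zero, \<open>p l \<in> P\<^sub>0\<close> with graded
  functionals \<open>\<mu> l : P \<rightarrow> R\<close>, which is at the same time a dual basis of \<open>P\<^sub>0\<close> over \<open>R\<^sub>0\<close>.  It identifies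
  \<open>T \<otimes> P\<close> with the image of an idempotent matrix over \<open>T\<close> with entries from \<open>R\<^sub>0\<close>, so that
  \<open>T\<close>-linear maps \<open>T \<otimes> M \<rightarrow> T \<otimes> P\<close> become families of \<open>R\<close>-linear maps \<open>G l : M \<rightarrow> T\<close>, base change
  becomes composition, and graded maps become graded families.  An \<open>R\<^sub>0\<close>-linear map \<open>M\<^sub>0 \<rightarrow> T\<close> extends
  uniquely to an \<open>R\<close>-linear map \<open>M \<rightarrow> T\<close>: on \<open>M\<^sub>\<gamma>\<close> it is \<open>m \<mapsto> \<Sum> a\<^sub>s H(b\<^sub>s m)\<close> for a partition of unity
  \<open>1 = \<Sum> a\<^sub>s b\<^sub>s\<close> with \<open>a\<^sub>s \<in> R\<^sub>\<gamma>\<close> and \<open>b\<^sub>s \<in> R\<^sub>-\<^sub>\<gamma>\<close>.  Hence the universal family over \<open>B\<close> extends to one over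
  \<open>C\<close>, which gives \<open>S \<rightarrow> C\<close>, and the universal family over \<open>S\<close> restricts to a family with values in
  \<open>S\<^sub>0\<close>, which gives \<open>B \<rightarrow> S\<^sub>0\<close> and then \<open>C \<rightarrow> S\<close>.  Uniqueness makes the two maps mutually inverse.
\<close>

section \<open>Additive maps and gradings\<close>

text \<open>Homomorphisms of tensor products over different rings live in different types of cosets,
  and base change compares them only through a canonical isomorphism. In coordinates they are plain
  maps from M into the ring, on which a ring homomorphism acts by composition. One dual basis serves
  R and R_0 alike, because the matrix entries \<open>\<mu> l (p k)\<close> have degree zero. The
  overview is silent on why the components of C form a grading: a priori, monomials of different
  degrees could be related. They span C by the universal property tested on their span, and they are
  independent thanks to a ring homomorphism from C to the group algebra C[\<Gamma>] that marks each
  monomial with its degree. Both factors have such a map by their gradings, and the two agree on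
  R_0, which sits in degree zero. The carrier of C[\<Gamma>] consists of functions on \<Gamma>,
  hence the second test type for C. The remaining test rings are C, S and subrings of these with the
  same operations on a smaller carrier, so they stay in type \<open>'u\<close>.\<close>

abbreviation add_hom :: "('a, 'x) ring_scheme \<Rightarrow> ('b, 'y) ring_scheme \<Rightarrow> ('a \<Rightarrow> 'b) set" where
  "add_hom A B \<equiv> hom (add_monoid A) (add_monoid B)"

lemma add_homI:
  assumes "\<And>x. x \<in> carrier A \<Longrightarrow> f x \<in> carrier B"
    and "\<And>x y. x \<in> carrier A \<Longrightarrow> y \<in> carrier A \<Longrightarrow> f (x \<oplus>\<^bsub>A\<^esub> y) = f x \<oplus>\<^bsub>B\<^esub> f y"
  shows "f \<in> add_hom A B"
  using assms by (auto simp: hom_def)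

lemma add_hom_closed: "f \<in> add_hom A B \<Longrightarrow> x \<in> carrier A \<Longrightarrow> f x \<in> carrier B"
  by (auto simp: hom_def)

lemma add_hom_add:
  "f \<in> add_hom A B \<Longrightarrow> x \<in> carrier A \<Longrightarrow> y \<in> carrier A \<Longrightarrow> f (x \<oplus>\<^bsub>A\<^esub> y) = f x \<oplus>\<^bsub>B\<^esub> f y"
  by (auto simp: hom_def)

lemma add_hom_comp: "f \<in> add_hom A B \<Longrightarrow> g \<in> add_hom B C \<Longrightarrow> (\<lambda>x. g (f x)) \<in> add_hom A C"
  by (rule add_homI) (simp_all add: add_hom_closed add_hom_add)

lemma add_hom_zero:
  assumes "abelian_group A" "abelian_group B" "f \<in> add_hom A B"
  shows "f \<zero>\<^bsub>A\<^esub> = \<zero>\<^bsub>B\<^esub>"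
  using group_hom.hom_one[of "add_monoid A" "add_monoid B" f] assms
  by (simp add: group_hom_def group_hom_axioms_def abelian_group.a_group)

lemma add_hom_minus:
  assumes "abelian_group A" "abelian_group B" "f \<in> add_hom A B" "x \<in> carrier A"
  shows "f (\<ominus>\<^bsub>A\<^esub> x) = \<ominus>\<^bsub>B\<^esub> f x"
  using group_hom.hom_inv[of "add_monoid A" "add_monoid B" f x] assms
  by (simp add: group_hom_def group_hom_axioms_def abelian_group.a_group a_inv_def)

lemma add_hom_finsum:
  assumes AB: "abelian_group A" "abelian_group B" and f: "f \<in> add_hom A B"
    and g: "\<And>i. i \<in> I \<Longrightarrow> g i \<in> carrier A"
  shows "f (finsum A g I) = finsum B (\<lambda>i. f (g i)) I"
proof -
  interpret A: abelian_group A by fact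
  interpret B: abelian_group B by fact
  show ?thesis
    using g
  proof (induction I rule: infinite_finite_induct)
    case (insert i I)
    then have "f (finsum A g (insert i I)) = f (g i) \<oplus>\<^bsub>B\<^esub> f (finsum A g I)"
      using f by (subst A.finsum_insert) (auto simp: add_hom_add)
    also have "\<dots> = finsum B (\<lambda>i. f (g i)) (insert i I)"
      using insert f by (subst B.finsum_insert) (auto simp: add_hom_closed)
    finally show ?case .
  qed (auto simp: add_hom_zero[OF AB f])
qed

lemma ring_hom_add_hom: "f \<in> ring_hom A B \<Longrightarrow> f \<in> add_hom A B"
  by (auto simp: ring_hom_def hom_def)

text \<open>\<open>generate\<close> inverts only generators, so the minus case is asked on
  \<open>H\<close> alone. Carrier membership rides along in the induction because the add case
  supplies it.\<close>

lemma (in abelian_group) generate_add_induct [consumes 2, case_names zero incl minus add]: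
  assumes "x \<in> generate (add_monoid G) H" "H \<subseteq> carrier G"
    and "Q \<zero>" "\<And>h. h \<in> H \<Longrightarrow> Q h" "\<And>h. h \<in> H \<Longrightarrow> Q h \<Longrightarrow> Q (\<ominus> h)"
    and "\<And>x y. x \<in> carrier G \<Longrightarrow> y \<in> carrier G \<Longrightarrow> Q x \<Longrightarrow> Q y \<Longrightarrow> Q (x \<oplus> y)"
  shows "Q x"
proof -
  have "x \<in> carrier G \<and> Q x"
    using assms(1)
  proof induction
    case (inv h)
    then have "inv\<^bsub>add_monoid G\<^esub> h = \<ominus> h" "h \<in> carrier G"
      using assms(2) by (auto simp: a_inv_def)
    then show ?case using inv assms by auto
  qed (use assms in auto)
  then show ?thesis by simp
qed

lemma (in abelian_group) finsum_subset:
  assumes "finite F" "E \<subseteq> F" "\<And>i. i \<in> E \<Longrightarrow> c i \<in> carrier G" "\<And>i. i \<in> F - E \<Longrightarrow> c i = \<zero>"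
  shows "finsum G c F = finsum G c E"
proof -
  have "c i \<in> carrier G" if "i \<in> F" for i using that assms(3,4)[of i] by (cases "i \<in> E") auto
  then show ?thesis
    using assms by (intro add.finprod_mono_neutral_cong_left[symmetric]) auto
qed

lemma (in abelian_group) finsum_single_term:
  assumes "finite F" "i \<in> F" "x \<in> carrier G"
  shows "(\<Oplus>j\<in>F. if j = i then x else \<zero>) = x"
proof -
  have "(\<Oplus>j\<in>F. if j = i then x else \<zero>) = (\<Oplus>j\<in>{i}. if j = i then x else \<zero>)"
    using assms by (intro finsum_subset) auto
  also have "\<dots> = x"
    using assms by (subst finsum_insert) auto
  finally show ?thesis .
qed

lemma (in abelian_group) add_minus_cancel:
  assumes "x \<in> carrier G" "y \<in> carrier G"
  shows "x \<oplus> y \<oplus> (\<ominus> x) \<oplus> (\<ominus> y) = \<zero>"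
proof -
  have "x \<oplus> y \<oplus> (\<ominus> x) \<oplus> (\<ominus> y) = (x \<oplus> (\<ominus> x)) \<oplus> (y \<oplus> (\<ominus> y))"
    using assms by (simp add: a_ac)
  then show ?thesis using assms by (simp add: r_neg)
qed

lemma (in abelian_group) finsum_swap:
  assumes "finite I" "finite J" "\<And>i j. i \<in> I \<Longrightarrow> j \<in> J \<Longrightarrow> c i j \<in> carrier G"
  shows "(\<Oplus>i\<in>I. \<Oplus>j\<in>J. c i j) = (\<Oplus>j\<in>J. \<Oplus>i\<in>I. c i j)"
  using assms(1,3)
proof (induction I)
  case empty
  then show ?case by simp
next
  case (insert i I)
  then have "(\<Oplus>i\<in>insert i I. \<Oplus>j\<in>J. c i j) = (\<Oplus>j\<in>J. c i j) \<oplus> (\<Oplus>j\<in>J. \<Oplus>i\<in>I. c i j)"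
    by (subst finsum_insert) (auto intro!: finsum_closed)
  also have "\<dots> = (\<Oplus>j\<in>J. c i j \<oplus> (\<Oplus>i\<in>I. c i j))"
    using insert by (subst finsum_addf) (auto intro!: finsum_closed)
  also have "\<dots> = (\<Oplus>j\<in>J. \<Oplus>i\<in>insert i I. c i j)"
    using insert by (intro finsum_cong' refl) (auto simp: finsum_insert intro!: finsum_closed)
  finally show ?case .
qed

lemma (in abelian_group) finsum_Sigma:
  assumes "finite I" "\<And>i. i \<in> I \<Longrightarrow> finite (J i)"
    "\<And>i j. i \<in> I \<Longrightarrow> j \<in> J i \<Longrightarrow> c (i, j) \<in> carrier G"
  shows "finsum G c (Sigma I J) = (\<Oplus>i\<in>I. \<Oplus>j\<in>J i. c (i, j))"
  using assms
proof (induction I)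
  case empty
  then show ?case by simp
next
  case (insert i I)
  have "Sigma (insert i I) J = Pair i ` J i \<union> Sigma I J" by auto
  then have "finsum G c (Sigma (insert i I) J) = finsum G c (Pair i ` J i) \<oplus> finsum G c (Sigma I J)"
    using insert by (simp only:) (subst finsum_Un_disjoint; auto)
  also have "finsum G c (Pair i ` J i) = (\<Oplus>j\<in>J i. c (i, j))"
    using insert by (subst finsum_reindex) (auto simp: inj_on_def)
  finally show ?case
    using insert by (subst finsum_insert) (auto intro!: finsum_closed)
qed

text \<open>Rings and modules share the additive part of the ring record, so one theory of
  homogeneous components serves both. Degrees form a bare index type here.\<close>

locale graded_group = abelian_group A for A :: "('a, 'x) ring_scheme" (structure) +
  fixes Ag :: "'g \<Rightarrow> 'a set"
  assumes A_grading: "is_grading A Ag"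
begin

definition component :: "'a \<Rightarrow> 'g \<Rightarrow> 'a" where
  "component x = (THE c. (\<forall>\<gamma>. c \<gamma> \<in> Ag \<gamma>) \<and> finite {\<gamma>. c \<gamma> \<noteq> \<zero>} \<and> x = finsum A c {\<gamma>. c \<gamma> \<noteq> \<zero>})"

lemma component_subgroup: "additive_subgroup (Ag \<gamma>) A"
  using A_grading by (simp add: is_grading_def)

lemma component_closed [simp]: "x \<in> Ag \<gamma> \<Longrightarrow> x \<in> carrier A"
  using additive_subgroup.a_Hcarr[OF component_subgroup] .

lemma component_zero [simp]: "\<zero> \<in> Ag \<gamma>"
  using additive_subgroup.zero_closed[OF component_subgroup] .

lemma component_add_closed: "x \<in> Ag \<gamma> \<Longrightarrow> y \<in> Ag \<gamma> \<Longrightarrow> x \<oplus> y \<in> Ag \<gamma>"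
  using additive_subgroup.a_closed[OF component_subgroup] .

lemma component_minus_closed: "x \<in> Ag \<gamma> \<Longrightarrow> \<ominus> x \<in> Ag \<gamma>"
  using subgroup.m_inv_closed[OF additive_subgroup.a_subgroup[OF component_subgroup]]
  by (simp add: a_inv_def)

lemma component_finsum_closed: "(\<And>i. i \<in> I \<Longrightarrow> c i \<in> Ag \<gamma>) \<Longrightarrow> finsum A c I \<in> Ag \<gamma>"
proof (induction I rule: infinite_finite_induct)
  case (insert i I)
  then have "c i \<in> Ag \<gamma>" "c i \<in> carrier A" "\<And>i. i \<in> I \<Longrightarrow> c i \<in> carrier A"
    by (auto intro: component_closed[of _ \<gamma>])
  with insert show ?case by (subst finsum_insert) (auto simp: Pi_def component_add_closed)
qed auto

lemma component_unique:
  assumes "x \<in> carrier A"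
  shows "\<exists>!c. (\<forall>\<gamma>. c \<gamma> \<in> Ag \<gamma>) \<and> finite {\<gamma>. c \<gamma> \<noteq> \<zero>} \<and> x = finsum A c {\<gamma>. c \<gamma> \<noteq> \<zero>}"
  using A_grading assms unfolding is_grading_def by blast

lemma
  assumes "x \<in> carrier A"
  shows component_mem: "component x \<gamma> \<in> Ag \<gamma>"
    and finite_support: "finite {\<gamma>. component x \<gamma> \<noteq> \<zero>}"
    and component_sum: "finsum A (component x) {\<gamma>. component x \<gamma> \<noteq> \<zero>} = x"
  using theI'[OF component_unique[OF assms]] by (auto simp: component_def[symmetric])

text \<open>\<open>is_grading\<close> speaks of sums over the exact support. A sum over a larger
  finite set is cut down to the support, and then uniqueness of the decomposition applies.\<close>

lemma component_eqI:
  assumes "finite F" "\<And>\<gamma>. c \<gamma> \<in> Ag \<gamma>" "\<And>\<gamma>. \<gamma> \<notin> F \<Longrightarrow> c \<gamma> = \<zero>"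
  shows "component (finsum A c F) = c"
proof -
  have sub: "{\<gamma>. c \<gamma> \<noteq> \<zero>} \<subseteq> F" using assms(3) by auto
  have "finsum A c F = finsum A c {\<gamma>. c \<gamma> \<noteq> \<zero>}"
    using assms(1,2) sub by (intro finsum_subset) (auto intro: component_closed)
  moreover have "finsum A c F \<in> carrier A"
    using component_closed[OF assms(2)] by (auto intro!: finsum_closed)
  moreover have "finite {\<gamma>. c \<gamma> \<noteq> \<zero>}" using finite_subset[OF sub assms(1)] .
  ultimately show ?thesis
    unfolding component_def using assms(2) by (intro the1_equality component_unique) auto
qed

lemma component_add:
  assumes "x \<in> carrier A" "y \<in> carrier A"
  shows "component (x \<oplus> y) \<gamma> = component x \<gamma> \<oplus> component y \<gamma>"
proof -
  let ?F = "{\<gamma>. component x \<gamma> \<noteq> \<zero>} \<union> {\<gamma>. component y \<gamma> \<noteq> \<zero>}"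
  have F: "finite ?F" using assms finite_support by blast
  have "finsum A (component x) ?F = x" "finsum A (component y) ?F = y"
    using assms F component_mem
    by (subst finsum_subset[OF F, of "{\<gamma>. component x \<gamma> \<noteq> \<zero>}"] finsum_subset[OF F, of "{\<gamma>. component y \<gamma> \<noteq> \<zero>}"];
        auto simp: component_sum intro: component_closed)+
  then have "x \<oplus> y = (\<Oplus>\<gamma>\<in>?F. component x \<gamma> \<oplus> component y \<gamma>)"
    using assms component_mem by (subst finsum_addf) (auto intro: component_closed)
  moreover have "component (\<Oplus>\<gamma>\<in>?F. component x \<gamma> \<oplus> component y \<gamma>) = (\<lambda>\<gamma>. component x \<gamma> \<oplus> component y \<gamma>)"
    using F assms by (intro component_eqI) (auto intro: component_add_closed component_mem)
  ultimately show ?thesis by simp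
qed

lemma component_homogeneous:
  assumes "x \<in> Ag \<gamma>"
  shows "component x = (\<lambda>\<delta>. if \<delta> = \<gamma> then x else \<zero>)"
proof -
  have "component (\<Oplus>\<delta>\<in>{\<gamma>}. if \<delta> = \<gamma> then x else \<zero>) = (\<lambda>\<delta>. if \<delta> = \<gamma> then x else \<zero>)"
    using assms by (intro component_eqI) auto
  moreover have "(\<Oplus>\<delta>\<in>{\<gamma>}. if \<delta> = \<gamma> then x else \<zero>) = x"
    using assms by (intro finsum_single_term) auto
  ultimately show ?thesis by simp
qed

text \<open>An element is the finite sum of its components. Zero, the empty sum, needs no case of
  its own since it is homogeneous.\<close>

lemma graded_induct [consumes 1, case_names homogeneous add]:
  assumes "x \<in> carrier A"
    and hom: "\<And>\<gamma> x. x \<in> Ag \<gamma> \<Longrightarrow> Q x"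
    and add: "\<And>x y. x \<in> carrier A \<Longrightarrow> y \<in> carrier A \<Longrightarrow> Q x \<Longrightarrow> Q y \<Longrightarrow> Q (x \<oplus> y)"
  shows "Q x"
proof -
  have "finsum A (component x) F \<in> carrier A \<and> Q (finsum A (component x) F)" if "finite F" for F
    using that
  proof induction
    case empty
    then show ?case using hom[OF component_zero] by simp
  next
    case (insert \<gamma> F)
    then show ?case
      using component_mem[OF assms(1)]
      by (subst (1 2) finsum_insert) (auto simp: Pi_def intro: component_closed add hom)
  qed
  from this[OF finite_support[OF assms(1)]] show ?thesis
    by (simp add: component_sum assms(1))
qed

lemma add_hom_eqI:
  assumes "f \<in> add_hom A B" "g \<in> add_hom A B" "\<And>\<gamma> x. x \<in> Ag \<gamma> \<Longrightarrow> f x = g x" "x \<in> carrier A"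
  shows "f x = g x"
  using assms(4) by (induction rule: graded_induct) (use assms in \<open>auto simp: add_hom_add\<close>)

text \<open>Universal property of the direct sum. The degree is an argument of \<open>f\<close>
  because the prescribed value may depend on it, as in \<open>single C \<gamma> (i x)\<close>
  later.\<close>

lemma ex_add_hom:
  assumes B: "abelian_group B"
    and closed: "\<And>\<gamma> x. x \<in> Ag \<gamma> \<Longrightarrow> f \<gamma> x \<in> carrier B"
    and add: "\<And>\<gamma> x y. x \<in> Ag \<gamma> \<Longrightarrow> y \<in> Ag \<gamma> \<Longrightarrow> f \<gamma> (x \<oplus> y) = f \<gamma> x \<oplus>\<^bsub>B\<^esub> f \<gamma> y"
  obtains h where "h \<in> add_hom A B" "\<And>\<gamma> x. x \<in> Ag \<gamma> \<Longrightarrow> h x = f \<gamma> x"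
proof
  interpret B: abelian_group B by fact
  \<comment> \<open>Additivity forces this. It lets the defining sum range over any finite set
    containing the support, so that x, y and their sum can be treated over one common set.\<close>
  have f0: "f \<gamma> \<zero> = \<zero>\<^bsub>B\<^esub>" for \<gamma>
    using add[of \<zero> \<gamma> \<zero>] closed[of \<zero> \<gamma>] B.add.l_cancel_one[of "f \<gamma> \<zero>" "f \<gamma> \<zero>"] by simp
  define supp where "supp x = {\<gamma>. component x \<gamma> \<noteq> \<zero>}" for x
  define h where "h x = finsum B (\<lambda>\<gamma>. f \<gamma> (component x \<gamma>)) (supp x)" for x
  have h_eq: "h x = finsum B (\<lambda>\<gamma>. f \<gamma> (component x \<gamma>)) F"
    if "finite F" "supp x \<subseteq> F" "x \<in> carrier A" for x F
    unfolding h_def using that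
    by (intro B.finsum_subset[symmetric]) (auto simp: f0 supp_def intro!: closed component_mem)
  show "h \<in> add_hom A B"
  proof (rule add_homI)
    fix x y assume xy: "x \<in> carrier A" "y \<in> carrier A"
    let ?F = "supp x \<union> supp y"
    have fin: "finite ?F" using finite_support xy by (auto simp: supp_def)
    have sub: "supp (x \<oplus> y) \<subseteq> ?F"
      using xy by (auto simp: supp_def component_add)
    have "h (x \<oplus> y) = (\<Oplus>\<^bsub>B\<^esub>\<gamma>\<in>?F. f \<gamma> (component x \<gamma>) \<oplus>\<^bsub>B\<^esub> f \<gamma> (component y \<gamma>))"
      using xy by (subst h_eq[OF fin sub]) (auto simp: component_add add component_mem)
    also have "\<dots> = h x \<oplus>\<^bsub>B\<^esub> h y"
      using xy fin by (subst B.finsum_addf) (auto simp: h_eq[of ?F] intro!: closed component_mem)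
    finally show "h (x \<oplus> y) = h x \<oplus>\<^bsub>B\<^esub> h y" .
  qed (auto simp: h_def intro!: B.finsum_closed closed component_mem)
  fix \<gamma> x assume x: "x \<in> Ag \<gamma>"
  have "h x = finsum B (\<lambda>\<delta>. f \<delta> (component x \<delta>)) {\<gamma>}"
    using x by (intro h_eq) (auto simp: supp_def component_homogeneous)
  also have "\<dots> = f \<gamma> x"
    using x by (subst B.finsum_insert) (auto simp: component_homogeneous B.finsum_empty closed)
  finally show "h x = f \<gamma> x" .
qed

end

section \<open>Extension of scalars\<close>

text \<open>\<open>coset_map\<close> takes the union over all representatives of a coset. If
  \<open>\<Phi>\<close> carries \<open>K'\<close> into \<open>K\<close>, the union collapses to the
  coset of one image; \<open>0 \<in> K'\<close> ensures that nothing of that coset is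
  missed.\<close>

lemma coset_map_r_coset:
  assumes K: "subgroup K (free_Abelian_group Z)" and 0: "0 \<in> K'"
    and \<Phi>: "\<And>v. v \<in> K' \<Longrightarrow> frag_extend \<Phi> v \<in> K"
  shows "coset_map K \<Phi> (K' #>\<^bsub>free_Abelian_group Z'\<^esub> u) = K #>\<^bsub>free_Abelian_group Z\<^esub> frag_extend \<Phi> u"
proof -
  have add: "a + b \<in> K" if "a \<in> K" "b \<in> K" for a b
    using subgroup.m_closed[OF K that] by simp
  have "coset_map K \<Phi> (K' #>\<^bsub>free_Abelian_group Z'\<^esub> u) =
      {w + frag_extend \<Phi> (v + u) | v w. v \<in> K' \<and> w \<in> K}"
    by (auto simp: coset_map_def r_coset_def)
  also have "\<dots> = {w + frag_extend \<Phi> u | w. w \<in> K}"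
  proof (intro equalityI subsetI)
    fix x assume "x \<in> {w + frag_extend \<Phi> (v + u) | v w. v \<in> K' \<and> w \<in> K}"
    then obtain v w where "x = (w + frag_extend \<Phi> v) + frag_extend \<Phi> u" "v \<in> K'" "w \<in> K"
      by (auto simp: frag_extend_add algebra_simps)
    then show "x \<in> {w + frag_extend \<Phi> u | w. w \<in> K}"
      using add[OF _ \<Phi>] by blast
  next
    fix x assume "x \<in> {w + frag_extend \<Phi> u | w. w \<in> K}"
    then show "x \<in> {w + frag_extend \<Phi> (v + u) | v w. v \<in> K' \<and> w \<in> K}"
      using 0 by force
  qed
  finally show ?thesis by (auto simp: r_coset_def)
qed

lemma frag_extend_closed:
  assumes "\<And>z. z \<in> Z' \<Longrightarrow> \<Phi> z \<in> carrier (free_Abelian_group Z)" "u \<in> carrier (free_Abelian_group Z')"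
  shows "frag_extend \<Phi> u \<in> carrier (free_Abelian_group Z)"
proof -
  have "Poly_Mapping.keys (\<Phi> z) \<subseteq> Z" if "z \<in> Poly_Mapping.keys u" for z
    using assms(1)[of z] assms(2) that by auto
  then have "(\<Union>z\<in>Poly_Mapping.keys u. Poly_Mapping.keys (\<Phi> z)) \<subseteq> Z" by blast
  then show ?thesis using subset_trans[OF keys_frag_extend] by simp
qed

lemma coset_map_hom:
  assumes K: "subgroup K (free_Abelian_group Z)" and K': "subgroup K' (free_Abelian_group Z')"
    and \<Phi>: "\<And>v. v \<in> K' \<Longrightarrow> frag_extend \<Phi> v \<in> K"
    and Z: "\<And>z. z \<in> Z' \<Longrightarrow> \<Phi> z \<in> carrier (free_Abelian_group Z)"
  shows "coset_map K \<Phi> \<in> hom (free_Abelian_group Z' Mod K') (free_Abelian_group Z Mod K)"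
proof -
  let ?F = "free_Abelian_group Z" and ?F' = "free_Abelian_group Z'"
  have N: "K \<lhd> ?F" "K' \<lhd> ?F'"
    using K K' comm_group.normal_iff_subgroup[OF abelian_free_Abelian_group] by blast+
  have 0: "0 \<in> K'" using subgroup.one_closed[OF K'] by simp
  have closed: "frag_extend \<Phi> u \<in> carrier ?F" if "u \<in> carrier ?F'" for u
    using frag_extend_closed[OF Z that] .
  show ?thesis
  proof (rule homI)
    fix x assume "x \<in> carrier (?F' Mod K')"
    then obtain u where "u \<in> carrier ?F'" "x = K' #>\<^bsub>?F'\<^esub> u"
      by (auto simp: FactGroup_def RCOSETS_def)
    then show "coset_map K \<Phi> x \<in> carrier (?F Mod K)"
      using coset_map_r_coset[OF K 0 \<Phi>] closed[of u] by (auto simp: FactGroup_def RCOSETS_def)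
  next
    fix x y assume "x \<in> carrier (?F' Mod K')" "y \<in> carrier (?F' Mod K')"
    then obtain u v where u: "u \<in> carrier ?F'" "x = K' #>\<^bsub>?F'\<^esub> u"
      and v: "v \<in> carrier ?F'" "y = K' #>\<^bsub>?F'\<^esub> v"
      by (auto simp: FactGroup_def RCOSETS_def)
    have "x <#>\<^bsub>?F'\<^esub> y = K' #>\<^bsub>?F'\<^esub> (u + v)"
      using normal.rcos_sum[OF N(2) u(1) v(1)] u v by simp
    moreover have "(K #>\<^bsub>?F\<^esub> frag_extend \<Phi> u) <#>\<^bsub>?F\<^esub> (K #>\<^bsub>?F\<^esub> frag_extend \<Phi> v)
        = K #>\<^bsub>?F\<^esub> frag_extend \<Phi> (u + v)"
      using normal.rcos_sum[OF N(1) closed[OF u(1)] closed[OF v(1)]] by (simp add: frag_extend_add)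
    ultimately show "coset_map K \<Phi> (x \<otimes>\<^bsub>?F' Mod K'\<^esub> y) =
        coset_map K \<Phi> x \<otimes>\<^bsub>?F Mod K\<^esub> coset_map K \<Phi> y"
      using u(2) v(2) by (simp add: coset_map_r_coset[OF K 0 \<Phi>])
  qed
qed

text \<open>\<open>hom\<close> looks only at carrier and multiplication, where the additive monoid
  of the tensor record and the factor group agree. Facts about \<open>Mod\<close> transfer in this
  way although the two records have different types.\<close>

lemma hom_from_tensor:
  "hom (add_monoid (tensor R T \<tau> N)) G = hom (tensor_free T N Mod tensor_rels R T \<tau> N) G"
  by (simp add: tensor_def Let_def hom_def)

lemma hom_to_tensor:
  "hom G (add_monoid (tensor R T \<tau> N)) = hom G (tensor_free T N Mod tensor_rels R T \<tau> N)"
  by (simp add: tensor_def Let_def hom_def)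

lemma comm_group_cong:
  assumes "comm_group G" "carrier H = carrier G" "monoid.mult H = monoid.mult G" "one H = one G"
  shows "comm_group H"
proof -
  interpret G: comm_group G by fact
  show ?thesis
    by (rule comm_groupI) (use assms in \<open>auto simp: G.m_ac intro: G.l_inv_ex\<close>)
qed

locale scalar_extension = R: ring R + T: ring T + N: left_module R N
  for R :: "('r, 'x) ring_scheme" and T :: "('t, 'y) ring_scheme"
    and N :: "('r, 'n, 'z) module_scheme" +
  fixes \<tau> :: "'r \<Rightarrow> 't"
  assumes \<tau>_hom: "\<tau> \<in> ring_hom R T"
begin

abbreviation "K \<equiv> tensor_rels R T \<tau> N"
abbreviation "X \<equiv> tensor R T \<tau> N"
abbreviation "F \<equiv> tensor_free T N"
abbreviation "pt \<equiv> pure_tensor R T \<tau> N"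

lemma \<tau>_closed [simp]: "r \<in> carrier R \<Longrightarrow> \<tau> r \<in> carrier T"
  using ring_hom_closed[OF \<tau>_hom] .

lemma rels_subgroup: "subgroup K (free_Abelian_group (carrier T \<times> carrier N))"
  unfolding tensor_rels_def tensor_free_def
  by (rule group.generate_is_subgroup)
    (auto dest!: subsetD[OF keys_diff] simp: N.smult_closed)

lemma rels_normal: "K \<lhd> F"
  using rels_subgroup comm_group.normal_iff_subgroup[OF abelian_free_Abelian_group]
  by (auto simp: tensor_free_def)

lemma zero_in_rels: "0 \<in> K"
  using subgroup.one_closed[OF rels_subgroup] by simp

lemma
  shows rel_add_left: "s \<in> carrier T \<Longrightarrow> t \<in> carrier T \<Longrightarrow> n \<in> carrier N \<Longrightarrow>
      frag_of (s \<oplus>\<^bsub>T\<^esub> t, n) - frag_of (s, n) - frag_of (t, n) \<in> K"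
    and rel_add_right: "t \<in> carrier T \<Longrightarrow> m \<in> carrier N \<Longrightarrow> n \<in> carrier N \<Longrightarrow>
      frag_of (t, m \<oplus>\<^bsub>N\<^esub> n) - frag_of (t, m) - frag_of (t, n) \<in> K"
    and rel_balanced: "t \<in> carrier T \<Longrightarrow> r \<in> carrier R \<Longrightarrow> n \<in> carrier N \<Longrightarrow>
      frag_of (t \<otimes>\<^bsub>T\<^esub> \<tau> r, n) - frag_of (t, r \<odot>\<^bsub>N\<^esub> n) \<in> K"
  unfolding tensor_rels_def by (rule generate.incl, blast)+

text \<open>The preimage of \<open>L\<close> is a subgroup, so testing the three kinds of relators
  suffices. The target subgroup is arbitrary to cover both uses: the trivial subgroup for the
  universal property, and the relations of another tensor product for induced maps.\<close>

lemma hom_rels: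
  assumes B: "group B" and L: "subgroup L B" and h: "h \<in> hom F B"
    and "\<And>s t n. s \<in> carrier T \<Longrightarrow> t \<in> carrier T \<Longrightarrow> n \<in> carrier N \<Longrightarrow>
      h (frag_of (s \<oplus>\<^bsub>T\<^esub> t, n) - frag_of (s, n) - frag_of (t, n)) \<in> L"
    and "\<And>t m n. t \<in> carrier T \<Longrightarrow> m \<in> carrier N \<Longrightarrow> n \<in> carrier N \<Longrightarrow>
      h (frag_of (t, m \<oplus>\<^bsub>N\<^esub> n) - frag_of (t, m) - frag_of (t, n)) \<in> L"
    and "\<And>t r n. t \<in> carrier T \<Longrightarrow> r \<in> carrier R \<Longrightarrow> n \<in> carrier N \<Longrightarrow>
      h (frag_of (t \<otimes>\<^bsub>T\<^esub> \<tau> r, n) - frag_of (t, r \<odot>\<^bsub>N\<^esub> n)) \<in> L"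
    and "u \<in> K"
  shows "h u \<in> L"
proof -
  interpret h: group_hom F B h
    using B h by (simp add: group_hom_def group_hom_axioms_def tensor_free_def)
  have "subgroup {u \<in> carrier F. h u \<in> L} F"
    using subgroup.m_closed[OF L] subgroup.one_closed[OF L] subgroup.m_inv_closed[OF L]
    by (intro subgroup.intro) auto
  then have "K \<subseteq> {u \<in> carrier F. h u \<in> L}"
    unfolding tensor_rels_def
  proof (intro group.generate_subgroup_incl Un_least subsetI)
    show "group F" by (simp add: tensor_free_def)
  next
    fix x assume "x \<in> {frag_of (s \<oplus>\<^bsub>T\<^esub> t, n) - frag_of (s, n) - frag_of (t, n) | s t n.
      s \<in> carrier T \<and> t \<in> carrier T \<and> n \<in> carrier N}"
    then show "x \<in> {u \<in> carrier F. h u \<in> L}"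
      using assms(4) subgroup.mem_carrier[OF rels_subgroup rel_add_left] unfolding tensor_free_def by blast
  next
    fix x assume "x \<in> {frag_of (t, m \<oplus>\<^bsub>N\<^esub> n) - frag_of (t, m) - frag_of (t, n) | t m n.
      t \<in> carrier T \<and> m \<in> carrier N \<and> n \<in> carrier N}"
    then show "x \<in> {u \<in> carrier F. h u \<in> L}"
      using assms(5) subgroup.mem_carrier[OF rels_subgroup rel_add_right] unfolding tensor_free_def by blast
  next
    fix x assume "x \<in> {frag_of (t \<otimes>\<^bsub>T\<^esub> \<tau> r, n) - frag_of (t, r \<odot>\<^bsub>N\<^esub> n) | t r n.
      t \<in> carrier T \<and> r \<in> carrier R \<and> n \<in> carrier N}"
    then show "x \<in> {u \<in> carrier F. h u \<in> L}"
      using assms(6) subgroup.mem_carrier[OF rels_subgroup rel_balanced] unfolding tensor_free_def by blast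
  qed
  then show ?thesis using assms(7) by auto
qed

lemma carrier_tensor: "carrier X = {K #>\<^bsub>F\<^esub> u | u. u \<in> carrier F}"
  by (auto simp: tensor_def FactGroup_def RCOSETS_def Let_def)

lemma r_coset_add:
  "u \<in> carrier F \<Longrightarrow> v \<in> carrier F \<Longrightarrow> (K #>\<^bsub>F\<^esub> u) \<oplus>\<^bsub>X\<^esub> (K #>\<^bsub>F\<^esub> v) = K #>\<^bsub>F\<^esub> (u + v)"
  using normal.rcos_sum[OF rels_normal, of u v] by (simp add: tensor_def Let_def tensor_free_def)

lemma r_coset_eq:
  assumes "u \<in> carrier F" "v \<in> carrier F" "u - v \<in> K"
  shows "K #>\<^bsub>F\<^esub> u = K #>\<^bsub>F\<^esub> v"
proof -
  have "u \<in> K #>\<^bsub>F\<^esub> v" using assms(3) by (force simp: r_coset_def tensor_free_def)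
  moreover have "group F" by (simp add: tensor_free_def)
  ultimately show ?thesis
    using group.repr_independence[of F u K v] rels_subgroup assms(2) by (simp add: tensor_free_def)
qed

sublocale X: abelian_group X
proof -
  have "comm_group (add_monoid X)"
    by (rule comm_group_cong[OF comm_group.abelian_FactGroup[OF abelian_free_Abelian_group rels_subgroup]])
      (simp_all add: tensor_def tensor_free_def Let_def)
  then show "abelian_group X"
    by (simp add: abelian_group_def abelian_monoid_def abelian_group_axioms_def comm_group.axioms)
qed

lemma frag_of_closed: "t \<in> carrier T \<Longrightarrow> n \<in> carrier N \<Longrightarrow> frag_of (t, n) \<in> carrier F"
  by (simp add: tensor_free_def)

lemma pt_closed [simp]: "t \<in> carrier T \<Longrightarrow> n \<in> carrier N \<Longrightarrow> pt t n \<in> carrier X"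
  unfolding carrier_tensor pure_tensor_def using frag_of_closed by blast

lemma pt_add_left:
  assumes "s \<in> carrier T" "t \<in> carrier T" "n \<in> carrier N"
  shows "pt (s \<oplus>\<^bsub>T\<^esub> t) n = pt s n \<oplus>\<^bsub>X\<^esub> pt t n"
proof -
  have "frag_of (s \<oplus>\<^bsub>T\<^esub> t, n) - (frag_of (s, n) + frag_of (t, n)) \<in> K"
    unfolding diff_diff_add[symmetric] using assms by (intro rel_add_left rel_add_right)
  with assms show ?thesis
    unfolding pure_tensor_def
    by - (subst r_coset_add, simp_all only: frag_of_closed, rule r_coset_eq,
      auto simp: tensor_free_def dest!: subsetD[OF keys_add])
qed

lemma pt_add_right:
  assumes "t \<in> carrier T" "m \<in> carrier N" "n \<in> carrier N"
  shows "pt t (m \<oplus>\<^bsub>N\<^esub> n) = pt t m \<oplus>\<^bsub>X\<^esub> pt t n"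
proof -
  have "frag_of (t, m \<oplus>\<^bsub>N\<^esub> n) - (frag_of (t, m) + frag_of (t, n)) \<in> K"
    unfolding diff_diff_add[symmetric] using assms by (intro rel_add_left rel_add_right)
  with assms show ?thesis
    unfolding pure_tensor_def
    by - (subst r_coset_add, simp_all only: frag_of_closed, rule r_coset_eq,
      auto simp: tensor_free_def dest!: subsetD[OF keys_add])
qed

lemma pt_balanced:
  assumes "t \<in> carrier T" "r \<in> carrier R" "n \<in> carrier N"
  shows "pt (t \<otimes>\<^bsub>T\<^esub> \<tau> r) n = pt t (r \<odot>\<^bsub>N\<^esub> n)"
proof -
  have "frag_of (t \<otimes>\<^bsub>T\<^esub> \<tau> r, n) - frag_of (t, r \<odot>\<^bsub>N\<^esub> n) \<in> K"
    using assms by (rule rel_balanced)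
  then show ?thesis
    unfolding pure_tensor_def using assms
    by (intro r_coset_eq) (auto simp: tensor_free_def N.smult_closed)
qed

lemma pt_add_hom: "n \<in> carrier N \<Longrightarrow> (\<lambda>t. pt t n) \<in> add_hom T X"
  "t \<in> carrier T \<Longrightarrow> pt t \<in> add_hom N X"
  by (auto intro!: add_homI simp: pt_add_left pt_add_right)

text \<open>Every element is a sum, without signs, of pure tensors, because a sign is absorbed into
  the left factor: the negative of t \<otimes> n is (- t) \<otimes> n.\<close>

lemma tensor_induct [consumes 1, case_names pure add]:
  assumes "x \<in> carrier X"
    and pure: "\<And>t n. t \<in> carrier T \<Longrightarrow> n \<in> carrier N \<Longrightarrow> Q (pt t n)"
    and add: "\<And>x y. x \<in> carrier X \<Longrightarrow> y \<in> carrier X \<Longrightarrow> Q x \<Longrightarrow> Q y \<Longrightarrow> Q (x \<oplus>\<^bsub>X\<^esub> y)"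
  shows "Q x"
proof -
  let ?q = "\<lambda>u. K #>\<^bsub>F\<^esub> u"
  have F: "F = free_Abelian_group (carrier T \<times> carrier N)" by (simp add: tensor_free_def)
  have q_closed: "?q u \<in> carrier X" if "u \<in> carrier F" for u
    using that by (auto simp: carrier_tensor)
  have q_zero: "?q 0 = \<zero>\<^bsub>X\<^esub>"
  proof -
    have 0: "(0 :: 't \<times> 'n \<Rightarrow>\<^sub>0 int) \<in> carrier F" by (simp add: tensor_free_def)
    then have "?q 0 \<oplus>\<^bsub>X\<^esub> ?q 0 = ?q 0" by (subst r_coset_add) auto
    then show ?thesis using X.add.l_cancel_one[of "?q 0" "?q 0"] q_closed[OF 0] by simp
  qed
  have Q_zero: "Q \<zero>\<^bsub>X\<^esub>"
    using pure[OF T.zero_closed N.zero_closed]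
      add_hom_zero[OF T.is_abelian_group X.abelian_group_axioms pt_add_hom(1)[OF N.zero_closed]]
    by simp
  obtain u where u: "u \<in> carrier F" "x = ?q u" using assms(1) by (auto simp: carrier_tensor)
  then have "Poly_Mapping.keys u \<subseteq> carrier T \<times> carrier N" by (simp add: tensor_free_def)
  \<comment> \<open>Both signs are carried together: the induction for free abelian groups has a
    difference step, and the class of a - b is the sum of those of a and - b.\<close>
  then have "Q (?q u) \<and> Q (?q (- u))"
  proof (induction rule: free_Abelian_group_induct[consumes 1, case_names zero diff frag])
    case zero
    then show ?case using Q_zero q_zero by simp
  next
    case (diff a b)
    then have c: "a \<in> carrier F" "b \<in> carrier F" "- a \<in> carrier F" "- b \<in> carrier F"
      by (auto simp: tensor_free_def)
    have "?q (a - b) = ?q a \<oplus>\<^bsub>X\<^esub> ?q (- b)" "?q (- (a - b)) = ?q (- a) \<oplus>\<^bsub>X\<^esub> ?q b"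
      using c by (auto simp: r_coset_add)
    then show ?case using diff c by (auto intro!: add q_closed)
  next
    case (frag z)
    then obtain t n where z: "z = (t, n)" "t \<in> carrier T" "n \<in> carrier N" by auto
    have "pt (\<ominus>\<^bsub>T\<^esub> t) n \<oplus>\<^bsub>X\<^esub> ?q (frag_of z) = \<zero>\<^bsub>X\<^esub>"
      using z pt_add_left[of "\<ominus>\<^bsub>T\<^esub> t" t n]
        add_hom_zero[OF T.is_abelian_group X.abelian_group_axioms pt_add_hom(1)[OF z(3)]]
      by (simp add: pure_tensor_def T.l_neg)
    moreover have "?q (- frag_of z) \<oplus>\<^bsub>X\<^esub> ?q (frag_of z) = \<zero>\<^bsub>X\<^esub>"
      using frag q_zero by (subst r_coset_add) (auto simp: tensor_free_def)
    moreover have "?q (- frag_of z) \<in> carrier X" "?q (frag_of z) \<in> carrier X"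
      using frag by (intro q_closed; simp add: tensor_free_def)+
    \<comment> \<open>Both are additive inverses of the class of \<open>frag_of z\<close>.\<close>
    ultimately have "?q (- frag_of z) = pt (\<ominus>\<^bsub>T\<^esub> t) n"
      using z by (metis X.add.right_cancel pt_closed T.a_inv_closed)
    then show ?case using pure z by (auto simp: pure_tensor_def[symmetric])
  qed
  then show ?thesis using u by simp
qed

lemma tensor_hom_eqI:
  assumes "f \<in> add_hom X B" "g \<in> add_hom X B"
    "\<And>t n. t \<in> carrier T \<Longrightarrow> n \<in> carrier N \<Longrightarrow> f (pt t n) = g (pt t n)" "x \<in> carrier X"
  shows "f x = g x"
  using assms(4) by (induction rule: tensor_induct) (use assms in \<open>auto simp: add_hom_add\<close>)

text \<open>Universal property of the tensor product. Extend \<open>b\<close> from the generators to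
  the free abelian group; biadditivity and balancedness say that the three kinds of relators are
  killed, so the map factors through the quotient.\<close>

lemma ex_tensor_hom:
  assumes B: "abelian_group B"
    and left: "\<And>n. n \<in> carrier N \<Longrightarrow> (\<lambda>t. b t n) \<in> add_hom T B"
    and right: "\<And>t. t \<in> carrier T \<Longrightarrow> b t \<in> add_hom N B"
    and balanced: "\<And>t r n. t \<in> carrier T \<Longrightarrow> r \<in> carrier R \<Longrightarrow> n \<in> carrier N \<Longrightarrow>
      b (t \<otimes>\<^bsub>T\<^esub> \<tau> r) n = b t (r \<odot>\<^bsub>N\<^esub> n)"
  obtains h where "h \<in> add_hom X B" "\<And>t n. t \<in> carrier T \<Longrightarrow> n \<in> carrier N \<Longrightarrow> h (pt t n) = b t n"
proof -
  interpret B: abelian_group B by fact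
  let ?F = "free_Abelian_group (carrier T \<times> carrier N)"
  have F: "F = ?F" by (simp add: tensor_free_def)
  have closed: "b t n \<in> carrier B" if "t \<in> carrier T" "n \<in> carrier N" for t n
    using add_hom_closed[OF right] that .
  have "comm_group (add_monoid B)" by (rule B.a_comm_group)
  then obtain h0 where h0: "h0 \<in> hom ?F (add_monoid B)"
    "\<And>z. z \<in> carrier T \<times> carrier N \<Longrightarrow> h0 (frag_of z) = case_prod b z"
    by (rule comm_group.free_Abelian_group_universal[of _ "case_prod b" "carrier T \<times> carrier N"])
      (auto simp: closed)
  interpret h0: group_hom ?F "add_monoid B" h0
    using h0 by (simp add: group_hom_def group_hom_axioms_def B.a_group)
  have diff: "h0 (u - v) = h0 u \<oplus>\<^bsub>B\<^esub> (\<ominus>\<^bsub>B\<^esub> h0 v)" if "u \<in> carrier ?F" "v \<in> carrier ?F" for u v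
    using h0.hom_mult[of u "- v"] h0.hom_inv[of v] that by (simp add: a_inv_def)
  have carr: "Poly_Mapping.keys (u - v) \<subseteq> Z" if "Poly_Mapping.keys u \<subseteq> Z" "Poly_Mapping.keys v \<subseteq> Z"
    for u v :: "'t \<times> 'n \<Rightarrow>\<^sub>0 int" and Z
    using that keys_diff[of u v] by auto
  have "h0 u \<in> {\<zero>\<^bsub>B\<^esub>}" if "u \<in> K" for u
  proof (rule hom_rels[OF B.a_group _ _ _ _ _ that])
    show "subgroup {\<zero>\<^bsub>B\<^esub>} (add_monoid B)"
      using group.triv_subgroup[OF B.a_group] by simp
  qed (use h0 in \<open>simp_all add: F diff carr closed balanced add_hom_add[OF left] add_hom_add[OF right]
      N.smult_closed B.r_neg B.add_minus_cancel\<close>)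
  then have h0K: "h0 u = \<zero>\<^bsub>B\<^esub>" if "u \<in> K" for u using that by blast
  have h0_eq: "h0 x = h0 y" if "x \<in> carrier F" "y \<in> carrier F" "K #>\<^bsub>F\<^esub> x = K #>\<^bsub>F\<^esub> y" for x y
  proof -
    have "x \<in> K #>\<^bsub>F\<^esub> y"
    proof -
      have "x = 0 + x" by simp
      then have "x \<in> K #>\<^bsub>F\<^esub> x"
        using zero_in_rels unfolding r_coset_def tensor_free_def by auto
      then show ?thesis using that(3) by simp
    qed
    then obtain v where v: "v \<in> K" "x = v + y" by (auto simp: r_coset_def tensor_free_def)
    then show ?thesis
      using that h0.hom_mult[of v y] h0K[of v] h0.hom_closed[of y] subgroup.mem_carrier[OF rels_subgroup v(1)]
      by (simp add: F)
  qed
  obtain h where h: "h \<in> hom (F Mod K) (add_monoid B)"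
    "\<And>x. x \<in> carrier F \<Longrightarrow> h (K #>\<^bsub>F\<^esub> x) = h0 x"
    using FactGroup_universal[OF h0(1)[folded F] rels_normal h0_eq] by blast
  show thesis
  proof
    show "h \<in> add_hom X B" using h(1) by (simp add: hom_from_tensor)
    show "h (pt t n) = b t n" if "t \<in> carrier T" "n \<in> carrier N" for t n
      using h(2)[OF frag_of_closed[OF that]] h0(2)[of "(t, n)"] that by (simp add: pure_tensor_def)
  qed
qed

text \<open>A common functoriality statement for \<open>smult\<close>, \<open>tensor_map\<close> and
  \<open>tensor_trans\<close>, each of which is a \<open>coset_map\<close>. Balancedness is asked as
  membership in the target relations, since source and target may be tensor products over different
  rings.\<close>

lemma coset_map_tensor:
  assumes ext: "scalar_extension R' T' N' \<tau>'"
    and \<Phi>: "\<And>t n. t \<in> carrier T \<Longrightarrow> n \<in> carrier N \<Longrightarrow>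
      \<Phi> (t, n) = frag_of (\<phi> t, \<psi> n) \<and> \<phi> t \<in> carrier T' \<and> \<psi> n \<in> carrier N'"
    and \<phi>: "\<phi> \<in> add_hom T T'" and \<psi>: "\<psi> \<in> add_hom N N'"
    and balanced: "\<And>t r n. t \<in> carrier T \<Longrightarrow> r \<in> carrier R \<Longrightarrow> n \<in> carrier N \<Longrightarrow>
      frag_of (\<phi> (t \<otimes>\<^bsub>T\<^esub> \<tau> r), \<psi> n) - frag_of (\<phi> t, \<psi> (r \<odot>\<^bsub>N\<^esub> n)) \<in> tensor_rels R' T' \<tau>' N'"
  shows "coset_map (tensor_rels R' T' \<tau>' N') \<Phi> \<in> add_hom X (tensor R' T' \<tau>' N')"
    and "\<And>t n. t \<in> carrier T \<Longrightarrow> n \<in> carrier N \<Longrightarrow>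
      coset_map (tensor_rels R' T' \<tau>' N') \<Phi> (pt t n) = pure_tensor R' T' \<tau>' N' (\<phi> t) (\<psi> n)"
proof -
  interpret E: scalar_extension R' T' N' \<tau>' by fact
  have F: "F = free_Abelian_group (carrier T \<times> carrier N)"
    "E.F = free_Abelian_group (carrier T' \<times> carrier N')" by (simp_all add: tensor_free_def)
  have closed: "frag_extend \<Phi> u \<in> carrier E.F" if "u \<in> carrier F" for u
    using that unfolding F by (rule frag_extend_closed[rotated]) (use \<Phi> in auto)
  have h: "frag_extend \<Phi> \<in> hom F E.F"
    by (rule homI) (use closed in \<open>auto simp: frag_extend_add F\<close>)
  have *: "frag_extend \<Phi> v \<in> E.K" if "v \<in> K" for v
  proof (rule hom_rels[OF _ _ h _ _ _ that])
    show "group E.F" "subgroup E.K E.F" using E.rels_subgroup by (simp_all add: F)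
  next
    fix s t n assume st: "s \<in> carrier T" "t \<in> carrier T" "n \<in> carrier N"
    show "frag_extend \<Phi> (frag_of (s \<oplus>\<^bsub>T\<^esub> t, n) - frag_of (s, n) - frag_of (t, n)) \<in> E.K"
      using st \<Phi> E.rel_add_left[of "\<phi> s" "\<phi> t" "\<psi> n"]
      by (simp add: frag_extend_diff add_hom_add[OF \<phi>])
  next
    fix t m n assume st: "t \<in> carrier T" "m \<in> carrier N" "n \<in> carrier N"
    show "frag_extend \<Phi> (frag_of (t, m \<oplus>\<^bsub>N\<^esub> n) - frag_of (t, m) - frag_of (t, n)) \<in> E.K"
      using st \<Phi> E.rel_add_right[of "\<phi> t" "\<psi> m" "\<psi> n"]
      by (simp add: frag_extend_diff add_hom_add[OF \<psi>])
  next
    fix t r n assume st: "t \<in> carrier T" "r \<in> carrier R" "n \<in> carrier N"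
    show "frag_extend \<Phi> (frag_of (t \<otimes>\<^bsub>T\<^esub> \<tau> r, n) - frag_of (t, r \<odot>\<^bsub>N\<^esub> n)) \<in> E.K"
      using st \<Phi> balanced by (simp add: frag_extend_diff N.smult_closed)
  qed
  show "coset_map E.K \<Phi> \<in> add_hom X E.X"
    unfolding hom_from_tensor hom_to_tensor F
    by (rule coset_map_hom[OF E.rels_subgroup rels_subgroup]) (use * \<Phi> in auto)
  show "coset_map E.K \<Phi> (pt t n) = E.pt (\<phi> t) (\<psi> n)" if "t \<in> carrier T" "n \<in> carrier N" for t n
    using coset_map_r_coset[OF E.rels_subgroup zero_in_rels *] \<Phi> that
    unfolding pure_tensor_def F by simp
qed

text \<open>Left multiplication by \<open>s\<close> commutes with the right action of
  \<open>R\<close> through \<open>\<tau>\<close> by associativity, hence respects the balancing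
  relations.\<close>

lemma
  assumes s: "s \<in> carrier T"
  shows smult_add_hom: "smult X s \<in> add_hom X X"
    and smult_pt: "t \<in> carrier T \<Longrightarrow> n \<in> carrier N \<Longrightarrow> s \<odot>\<^bsub>X\<^esub> pt t n = pt (s \<otimes>\<^bsub>T\<^esub> t) n"
proof -
  have eq: "smult X s = coset_map K (\<lambda>(t, n). frag_of (s \<otimes>\<^bsub>T\<^esub> t, n))"
    by (simp add: tensor_def Let_def)
  have ext: "scalar_extension R T N \<tau>" by unfold_locales
  have "frag_of (s \<otimes>\<^bsub>T\<^esub> (t \<otimes>\<^bsub>T\<^esub> \<tau> r), n) - frag_of (s \<otimes>\<^bsub>T\<^esub> t, r \<odot>\<^bsub>N\<^esub> n) \<in> K"
    if "t \<in> carrier T" "r \<in> carrier R" "n \<in> carrier N" for t r n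
    using that s rel_balanced[of "s \<otimes>\<^bsub>T\<^esub> t" r n] by (simp add: T.m_assoc)
  note * = coset_map_tensor[OF ext, where \<phi> = "\<lambda>t. s \<otimes>\<^bsub>T\<^esub> t" and \<psi> = "\<lambda>n. n", OF _ _ _ this]
  show "smult X s \<in> add_hom X X"
    unfolding eq by (rule *) (auto simp: s T.r_distr intro!: add_homI)
  show "s \<odot>\<^bsub>X\<^esub> pt t n = pt (s \<otimes>\<^bsub>T\<^esub> t) n" if "t \<in> carrier T" "n \<in> carrier N"
    unfolding eq by (rule *) (use that in \<open>auto simp: s T.r_distr intro!: add_homI\<close>)
qed

lemma smult_l_distr_tensor:
  assumes ab: "a \<in> carrier T" "b \<in> carrier T" and x: "x \<in> carrier X"
  shows "(a \<oplus>\<^bsub>T\<^esub> b) \<odot>\<^bsub>X\<^esub> x = a \<odot>\<^bsub>X\<^esub> x \<oplus>\<^bsub>X\<^esub> b \<odot>\<^bsub>X\<^esub> x"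
proof (rule tensor_hom_eqI[OF smult_add_hom _ _ x])
  note closed = add_hom_closed[OF smult_add_hom[OF ab(1)]] add_hom_closed[OF smult_add_hom[OF ab(2)]]
  note add = add_hom_add[OF smult_add_hom[OF ab(1)]] add_hom_add[OF smult_add_hom[OF ab(2)]]
  show "(\<lambda>x. a \<odot>\<^bsub>X\<^esub> x \<oplus>\<^bsub>X\<^esub> b \<odot>\<^bsub>X\<^esub> x) \<in> add_hom X X"
    by (rule add_homI) (simp_all add: closed add X.a_ac)
qed (use ab in \<open>simp_all add: smult_pt T.l_distr pt_add_left\<close>)

lemma smult_assoc_tensor:
  assumes ab: "a \<in> carrier T" "b \<in> carrier T" and x: "x \<in> carrier X"
  shows "(a \<otimes>\<^bsub>T\<^esub> b) \<odot>\<^bsub>X\<^esub> x = a \<odot>\<^bsub>X\<^esub> (b \<odot>\<^bsub>X\<^esub> x)"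
  by (rule tensor_hom_eqI[OF smult_add_hom add_hom_comp[OF smult_add_hom smult_add_hom] _ x])
    (use ab in \<open>simp_all add: smult_pt T.m_assoc\<close>)

lemma smult_one_tensor: "x \<in> carrier X \<Longrightarrow> \<one>\<^bsub>T\<^esub> \<odot>\<^bsub>X\<^esub> x = x"
  by (rule tensor_hom_eqI[OF smult_add_hom, where g = "\<lambda>x. x"])
    (simp_all add: smult_pt add_homI)

lemma tensor_left_module: "left_module T X"
  by unfold_locales
    (simp_all add: add_hom_closed[OF smult_add_hom] add_hom_add[OF smult_add_hom]
      smult_l_distr_tensor smult_assoc_tensor smult_one_tensor)

end

section \<open>Coordinates with respect to a dual basis\<close>

lemma module_hom_add_hom: "f \<in> module_hom R M N \<Longrightarrow> f \<in> add_hom M N"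
  by (auto simp: module_hom_def hom_def)

lemma module_hom_smult:
  "f \<in> module_hom R M N \<Longrightarrow> r \<in> carrier R \<Longrightarrow> x \<in> carrier M \<Longrightarrow> f (r \<odot>\<^bsub>M\<^esub> x) = r \<odot>\<^bsub>N\<^esub> f x"
  by (auto simp: module_hom_def)

lemma module_homI:
  "f \<in> add_hom M N \<Longrightarrow> (\<And>r x. r \<in> carrier R \<Longrightarrow> x \<in> carrier M \<Longrightarrow> f (r \<odot>\<^bsub>M\<^esub> x) = r \<odot>\<^bsub>N\<^esub> f x)
    \<Longrightarrow> f \<in> module_hom R M N"
  by (auto simp: module_hom_def hom_def)

text \<open>\<open>module_hom\<close> expects a module record as its target, whereas
  \<open>R\<close> is only a ring record; so linearity into \<open>R\<close> is spelled out.\<close>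

definition functional ::
  "('r, 'x) ring_scheme \<Rightarrow> ('r, 'p, 'y) module_scheme \<Rightarrow> ('p \<Rightarrow> 'r) \<Rightarrow> bool" where
  "functional R P \<mu> \<longleftrightarrow> \<mu> \<in> add_hom P R \<and> (\<forall>r\<in>carrier R. \<forall>x\<in>carrier P. \<mu> (r \<odot>\<^bsub>P\<^esub> x) = r \<otimes>\<^bsub>R\<^esub> \<mu> x)"

text \<open>The functional \<open>T \<otimes> \<mu>\<close>.\<close>

definition coefficient ::
  "('r, 'x) ring_scheme \<Rightarrow> ('t, 'y) ring_scheme \<Rightarrow> ('r \<Rightarrow> 't) \<Rightarrow> ('r, 'p, 'z) module_scheme \<Rightarrow>
   ('p \<Rightarrow> 'r) \<Rightarrow> ('t \<times> 'p \<Rightarrow>\<^sub>0 int) set \<Rightarrow> 't" where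
  "coefficient R T \<tau> P \<mu> = (SOME \<phi>. \<phi> \<in> add_hom (tensor R T \<tau> P) T \<and>
     (\<forall>t\<in>carrier T. \<forall>x\<in>carrier P. \<phi> (pure_tensor R T \<tau> P t x) = t \<otimes>\<^bsub>T\<^esub> \<tau> (\<mu> x)))"

text \<open>The witness behind the choice in \<open>coefficient\<close> comes from the balanced map
  (t, x) to t \<tau>(\<mu> x): balancedness is the linearity of \<open>\<mu>\<close> together with
  the multiplicativity of \<open>\<tau>\<close>.\<close>

lemma (in scalar_extension)
  assumes "functional R N \<mu>"
  shows coefficient_add_hom: "coefficient R T \<tau> N \<mu> \<in> add_hom X T"
    and coefficient_pt: "\<And>t x. t \<in> carrier T \<Longrightarrow> x \<in> carrier N \<Longrightarrow>
      coefficient R T \<tau> N \<mu> (pt t x) = t \<otimes>\<^bsub>T\<^esub> \<tau> (\<mu> x)"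
    and coefficient_functional: "functional T X (coefficient R T \<tau> N \<mu>)"
proof -
  have \<mu>: "\<mu> \<in> add_hom N R" "\<And>r x. r \<in> carrier R \<Longrightarrow> x \<in> carrier N \<Longrightarrow> \<mu> (r \<odot>\<^bsub>N\<^esub> x) = r \<otimes>\<^bsub>R\<^esub> \<mu> x"
    using assms by (auto simp: functional_def)
  note c = add_hom_closed[OF \<mu>(1)]
  obtain \<phi> where "\<phi> \<in> add_hom X T" "\<And>t x. t \<in> carrier T \<Longrightarrow> x \<in> carrier N \<Longrightarrow> \<phi> (pt t x) = t \<otimes>\<^bsub>T\<^esub> \<tau> (\<mu> x)"
  proof (rule ex_tensor_hom[where B = T and b = "\<lambda>t x. t \<otimes>\<^bsub>T\<^esub> \<tau> (\<mu> x)"])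
    show "t \<otimes>\<^bsub>T\<^esub> \<tau> r \<otimes>\<^bsub>T\<^esub> \<tau> (\<mu> n) = t \<otimes>\<^bsub>T\<^esub> \<tau> (\<mu> (r \<odot>\<^bsub>N\<^esub> n))"
      if "t \<in> carrier T" "r \<in> carrier R" "n \<in> carrier N" for t r n
      using that by (simp add: \<mu>(2) c ring_hom_mult[OF \<tau>_hom] T.m_assoc)
  qed (auto intro!: add_homI T.abelian_group_axioms
      simp: c T.l_distr T.r_distr add_hom_add[OF \<mu>(1)] ring_hom_add[OF \<tau>_hom])
  then have *: "coefficient R T \<tau> N \<mu> \<in> add_hom X T \<and> (\<forall>t\<in>carrier T. \<forall>x\<in>carrier N.
      coefficient R T \<tau> N \<mu> (pt t x) = t \<otimes>\<^bsub>T\<^esub> \<tau> (\<mu> x))"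
    unfolding coefficient_def by (intro someI_ex[of "\<lambda>\<phi>. \<phi> \<in> add_hom X T \<and> _ \<phi>"]) blast
  then show hom: "coefficient R T \<tau> N \<mu> \<in> add_hom X T"
    and pt: "\<And>t x. t \<in> carrier T \<Longrightarrow> x \<in> carrier N \<Longrightarrow> coefficient R T \<tau> N \<mu> (pt t x) = t \<otimes>\<^bsub>T\<^esub> \<tau> (\<mu> x)"
    by blast+
  have "coefficient R T \<tau> N \<mu> (s \<odot>\<^bsub>X\<^esub> y) = s \<otimes>\<^bsub>T\<^esub> coefficient R T \<tau> N \<mu> y"
    if s: "s \<in> carrier T" and y: "y \<in> carrier X" for s y
  proof (rule tensor_hom_eqI[OF add_hom_comp[OF smult_add_hom[OF s] hom] _ _ y])
    show "(\<lambda>y. s \<otimes>\<^bsub>T\<^esub> coefficient R T \<tau> N \<mu> y) \<in> add_hom X T"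
      using s by (auto intro!: add_homI simp: add_hom_closed[OF hom] add_hom_add[OF hom] T.r_distr)
  qed (use s in \<open>simp add: smult_pt pt c T.m_assoc\<close>)
  then show "functional T X (coefficient R T \<tau> N \<mu>)"
    using hom by (simp add: functional_def)
qed

text \<open>By the dual basis lemma these data express that P is finitely generated projective.
  Unlike a splitting of a free module, they pass without change to T \<otimes> P and to degree
  zero.\<close>

locale dual_basis = R: ring R + P: left_module R P
  for R :: "('r, 'x) ring_scheme" and P :: "('r, 'p, 'y) module_scheme" +
  fixes I :: "'i set" and p :: "'i \<Rightarrow> 'p" and \<mu> :: "'i \<Rightarrow> 'p \<Rightarrow> 'r"
  assumes finite_I: "finite I"
    and p_closed: "l \<in> I \<Longrightarrow> p l \<in> carrier P"
    and functional: "l \<in> I \<Longrightarrow> functional R P (\<mu> l)"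
    and expansion: "x \<in> carrier P \<Longrightarrow> x = (\<Oplus>\<^bsub>P\<^esub>l\<in>I. \<mu> l x \<odot>\<^bsub>P\<^esub> p l)"

text \<open>
  An \<open>R\<close>-linear map from \<open>M\<close> to \<open>T \<otimes>\<^sub>R P\<close>, given by its coordinates with respect to the dual basis:
  \<open>T \<otimes>\<^sub>R P\<close> is the image of the idempotent matrix with entries \<open>\<mu> l (p k)\<close>.
\<close>

definition coordinate_family ::
  "('r, 'x) ring_scheme \<Rightarrow> ('r, 'm, 'y) module_scheme \<Rightarrow> 'i set \<Rightarrow> ('i \<Rightarrow> 'p) \<Rightarrow> ('i \<Rightarrow> 'p \<Rightarrow> 'r) \<Rightarrow>
   ('t, 'z) ring_scheme \<Rightarrow> ('r \<Rightarrow> 't) \<Rightarrow> ('i \<Rightarrow> 'm \<Rightarrow> 't) \<Rightarrow> bool" where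
  "coordinate_family R M I p \<mu> T \<tau> G \<longleftrightarrow>
     (\<forall>l\<in>I. G l \<in> add_hom M T \<and>
        (\<forall>r\<in>carrier R. \<forall>m\<in>carrier M. G l (r \<odot>\<^bsub>M\<^esub> m) = \<tau> r \<otimes>\<^bsub>T\<^esub> G l m) \<and>
        (\<forall>m\<in>carrier M. G l m = (\<Oplus>\<^bsub>T\<^esub>k\<in>I. G k m \<otimes>\<^bsub>T\<^esub> \<tau> (\<mu> l (p k)))))"

text \<open>Evaluating at the elements 1 \<otimes> m loses nothing for a T-linear map, since they
  generate T \<otimes> M over T.\<close>

definition coordinates ::
  "('r, 'x) ring_scheme \<Rightarrow> ('r, 'm, 'y) module_scheme \<Rightarrow> ('r, 'p, 'w) module_scheme \<Rightarrow> ('i \<Rightarrow> 'p \<Rightarrow> 'r) \<Rightarrow>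
   ('t, 'z) ring_scheme \<Rightarrow> ('r \<Rightarrow> 't) \<Rightarrow> (('t \<times> 'm \<Rightarrow>\<^sub>0 int) set \<Rightarrow> ('t \<times> 'p \<Rightarrow>\<^sub>0 int) set) \<Rightarrow>
   'i \<Rightarrow> 'm \<Rightarrow> 't" where
  "coordinates R M P \<mu> T \<tau> g l m = coefficient R T \<tau> P (\<mu> l) (g (pure_tensor R T \<tau> M \<one>\<^bsub>T\<^esub> m))"

locale extended_dual_basis = dual_basis R P I p \<mu> + PT: scalar_extension R T P \<tau>
  for R :: "('r, 'x) ring_scheme" and P :: "('r, 'p, 'y) module_scheme"
    and I :: "'i set" and p \<mu> and T :: "('t, 'z) ring_scheme" and \<tau>
begin

abbreviation "coef l \<equiv> coefficient R T \<tau> P (\<mu> l)"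

lemma \<mu>_closed: "l \<in> I \<Longrightarrow> x \<in> carrier P \<Longrightarrow> \<mu> l x \<in> carrier R"
  using functional[of l] add_hom_closed[of "\<mu> l" P R x] by (simp add: functional_def)

lemma coef_add_hom: "l \<in> I \<Longrightarrow> coef l \<in> add_hom PT.X T"
  using PT.coefficient_add_hom[OF functional] .

lemma coef_smult: "l \<in> I \<Longrightarrow> t \<in> carrier T \<Longrightarrow> y \<in> carrier PT.X \<Longrightarrow> coef l (t \<odot>\<^bsub>PT.X\<^esub> y) = t \<otimes>\<^bsub>T\<^esub> coef l y"
  using PT.coefficient_functional[OF functional] by (simp add: functional_def)

lemma coef_pt: "l \<in> I \<Longrightarrow> t \<in> carrier T \<Longrightarrow> x \<in> carrier P \<Longrightarrow> coef l (PT.pt t x) = t \<otimes>\<^bsub>T\<^esub> \<tau> (\<mu> l x)"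
  using PT.coefficient_pt[OF functional] .

text \<open>The elements 1 \<otimes> p l with the functionals T \<otimes> \<mu> l are a dual basis
  of T \<otimes> P. On a pure tensor the scalar \<open>\<mu> l x\<close> just moves across the
  tensor sign.\<close>

lemma tensor_expansion:
  assumes y: "y \<in> carrier PT.X"
  shows "y = (\<Oplus>\<^bsub>PT.X\<^esub>l\<in>I. PT.pt (coef l y) (p l))"
proof (rule PT.tensor_hom_eqI[OF _ _ _ y])
  show "(\<lambda>y. y) \<in> add_hom PT.X PT.X" by (rule add_homI) auto
  have c: "PT.pt (coef l y) (p l) \<in> carrier PT.X" if "l \<in> I" "y \<in> carrier PT.X" for l y
    using that by (simp add: add_hom_closed[OF coef_add_hom] p_closed)
  show "(\<lambda>y. \<Oplus>\<^bsub>PT.X\<^esub>l\<in>I. PT.pt (coef l y) (p l)) \<in> add_hom PT.X PT.X"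
  proof (rule add_homI)
    fix x y assume xy: "x \<in> carrier PT.X" "y \<in> carrier PT.X"
    have "(\<Oplus>\<^bsub>PT.X\<^esub>l\<in>I. PT.pt (coef l (x \<oplus>\<^bsub>PT.X\<^esub> y)) (p l)) =
        (\<Oplus>\<^bsub>PT.X\<^esub>l\<in>I. PT.pt (coef l x) (p l) \<oplus>\<^bsub>PT.X\<^esub> PT.pt (coef l y) (p l))"
      using xy by (intro PT.X.finsum_cong' refl)
        (auto simp: add_hom_add[OF coef_add_hom] add_hom_closed[OF coef_add_hom] p_closed PT.pt_add_left)
    also have "\<dots> = (\<Oplus>\<^bsub>PT.X\<^esub>l\<in>I. PT.pt (coef l x) (p l)) \<oplus>\<^bsub>PT.X\<^esub> (\<Oplus>\<^bsub>PT.X\<^esub>l\<in>I. PT.pt (coef l y) (p l))"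
      using xy by (intro PT.X.finsum_addf) (auto simp: c)
    finally show "(\<Oplus>\<^bsub>PT.X\<^esub>l\<in>I. PT.pt (coef l (x \<oplus>\<^bsub>PT.X\<^esub> y)) (p l)) = \<dots>" .
  qed (auto simp: c intro!: PT.X.finsum_closed)
  fix t x assume tx: "t \<in> carrier T" "x \<in> carrier P"
  have "PT.pt t x = PT.pt t (\<Oplus>\<^bsub>P\<^esub>l\<in>I. \<mu> l x \<odot>\<^bsub>P\<^esub> p l)"
    using expansion tx by simp
  also have "\<dots> = (\<Oplus>\<^bsub>PT.X\<^esub>l\<in>I. PT.pt t (\<mu> l x \<odot>\<^bsub>P\<^esub> p l))"
    using tx by (intro add_hom_finsum[OF P.abelian_group_axioms PT.X.abelian_group_axioms PT.pt_add_hom(2)])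
      (auto simp: \<mu>_closed p_closed P.smult_closed)
  also have "\<dots> = (\<Oplus>\<^bsub>PT.X\<^esub>l\<in>I. PT.pt (coef l (PT.pt t x)) (p l))"
    using tx by (intro PT.X.finsum_cong' refl) (auto simp: \<mu>_closed p_closed coef_pt PT.pt_balanced P.smult_closed)
  finally show "PT.pt t x = \<dots>" .
qed

text \<open>Apply \<open>coef l\<close> to the expansion of y. This is the origin of the matrix
  relation in \<open>coordinate_family\<close>.\<close>

lemma coef_idem:
  assumes "l \<in> I" "y \<in> carrier PT.X"
  shows "coef l y = (\<Oplus>\<^bsub>T\<^esub>k\<in>I. coef k y \<otimes>\<^bsub>T\<^esub> \<tau> (\<mu> l (p k)))"
proof -
  have "coef l y = coef l (\<Oplus>\<^bsub>PT.X\<^esub>k\<in>I. PT.pt (coef k y) (p k))"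
    using tensor_expansion[OF assms(2)] by simp
  also have "\<dots> = (\<Oplus>\<^bsub>T\<^esub>k\<in>I. coef l (PT.pt (coef k y) (p k)))"
    using assms
    by (intro add_hom_finsum[OF PT.X.abelian_group_axioms PT.T.abelian_group_axioms coef_add_hom])
      (auto simp: add_hom_closed[OF coef_add_hom] p_closed)
  also have "\<dots> = (\<Oplus>\<^bsub>T\<^esub>k\<in>I. coef k y \<otimes>\<^bsub>T\<^esub> \<tau> (\<mu> l (p k)))"
    using assms by (intro PT.T.finsum_cong' refl)
      (auto simp: add_hom_closed[OF coef_add_hom] p_closed \<mu>_closed coef_pt)
  finally show ?thesis .
qed

lemma coordinate_family_coordinates:
  assumes M: "left_module R M" and g: "g \<in> module_hom T (tensor R T \<tau> M) PT.X"
  shows "coordinate_family R M I p \<mu> T \<tau> (coordinates R M P \<mu> T \<tau> g)"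
proof -
  interpret MT: scalar_extension R T M \<tau>
    by (intro scalar_extension.intro PT.scalar_extension_axioms M R.ring_axioms PT.T.ring_axioms
        scalar_extension_axioms.intro PT.\<tau>_hom)
  note g' = module_hom_add_hom[OF g] and gs = module_hom_smult[OF g]
  have gc: "g y \<in> carrier PT.X" if "y \<in> carrier MT.X" for y
    using add_hom_closed[OF g' that] .
  show ?thesis
    unfolding coordinate_family_def coordinates_def
  proof (intro ballI conjI)
    fix l assume l: "l \<in> I"
    show "(\<lambda>m. coef l (g (MT.pt \<one>\<^bsub>T\<^esub> m))) \<in> add_hom M T"
      using add_hom_comp[OF add_hom_comp[OF MT.pt_add_hom(2) g'] coef_add_hom[OF l]] by simp
    fix m assume m: "m \<in> carrier M"
    show "coef l (g (MT.pt \<one>\<^bsub>T\<^esub> m)) = (\<Oplus>\<^bsub>T\<^esub>k\<in>I. coef k (g (MT.pt \<one>\<^bsub>T\<^esub> m)) \<otimes>\<^bsub>T\<^esub> \<tau> (\<mu> l (p k)))"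
      using l m gc by (intro coef_idem) auto
    fix r assume r: "r \<in> carrier R"
    have "MT.pt \<one>\<^bsub>T\<^esub> (r \<odot>\<^bsub>M\<^esub> m) = \<tau> r \<odot>\<^bsub>MT.X\<^esub> MT.pt \<one>\<^bsub>T\<^esub> m"
      using r m MT.pt_balanced[of "\<one>\<^bsub>T\<^esub>" r m] by (simp add: MT.smult_pt)
    then show "coef l (g (MT.pt \<one>\<^bsub>T\<^esub> (r \<odot>\<^bsub>M\<^esub> m))) = \<tau> r \<otimes>\<^bsub>T\<^esub> coef l (g (MT.pt \<one>\<^bsub>T\<^esub> m))"
      using l r m by (simp add: gs coef_smult gc)
  qed
qed

text \<open>Converse of the previous lemma. The formula for g is balanced since each
  \<open>G l\<close> is linear along \<open>\<tau>\<close>. A priori the coordinates of g are G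
  times the idempotent matrix; the matrix relation is what returns G itself.\<close>

lemma ex_hom_with_coordinates:
  assumes M: "left_module R M" and G: "coordinate_family R M I p \<mu> T \<tau> G"
  obtains g where "g \<in> module_hom T (tensor R T \<tau> M) PT.X"
    "\<And>t m. t \<in> carrier T \<Longrightarrow> m \<in> carrier M \<Longrightarrow>
      g (pure_tensor R T \<tau> M t m) = (\<Oplus>\<^bsub>PT.X\<^esub>l\<in>I. PT.pt (t \<otimes>\<^bsub>T\<^esub> G l m) (p l))"
    "\<And>l m. l \<in> I \<Longrightarrow> m \<in> carrier M \<Longrightarrow> coordinates R M P \<mu> T \<tau> g l m = G l m"
proof -
  interpret MT: scalar_extension R T M \<tau>
    by (intro scalar_extension.intro PT.scalar_extension_axioms M R.ring_axioms PT.T.ring_axioms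
        scalar_extension_axioms.intro PT.\<tau>_hom)
  have G: "G l \<in> add_hom M T" "r \<in> carrier R \<Longrightarrow> m \<in> carrier M \<Longrightarrow> G l (r \<odot>\<^bsub>M\<^esub> m) = \<tau> r \<otimes>\<^bsub>T\<^esub> G l m"
    "m \<in> carrier M \<Longrightarrow> G l m = (\<Oplus>\<^bsub>T\<^esub>k\<in>I. G k m \<otimes>\<^bsub>T\<^esub> \<tau> (\<mu> l (p k)))"
    if "l \<in> I" for l r m
    using G that unfolding coordinate_family_def by blast+
  have Gc: "G l m \<in> carrier T" if "l \<in> I" "m \<in> carrier M" for l m
    using add_hom_closed[OF G(1)] that .
  let ?b = "\<lambda>t m. \<Oplus>\<^bsub>PT.X\<^esub>l\<in>I. PT.pt (t \<otimes>\<^bsub>T\<^esub> G l m) (p l)"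
  have bc: "?b t m \<in> carrier PT.X" if "t \<in> carrier T" "m \<in> carrier M" for t m
    using that by (auto intro!: PT.X.finsum_closed simp: Gc p_closed)
  obtain g where g: "g \<in> add_hom MT.X PT.X"
    "\<And>t m. t \<in> carrier T \<Longrightarrow> m \<in> carrier M \<Longrightarrow> g (MT.pt t m) = ?b t m"
  proof (rule MT.ex_tensor_hom[where B = PT.X and b = ?b])
    show "abelian_group PT.X" by (rule PT.X.abelian_group_axioms)
    show "(\<lambda>t. ?b t m) \<in> add_hom T PT.X" if m: "m \<in> carrier M" for m
    proof (rule add_homI)
      fix s t assume st: "s \<in> carrier T" "t \<in> carrier T"
      show "?b (s \<oplus>\<^bsub>T\<^esub> t) m = ?b s m \<oplus>\<^bsub>PT.X\<^esub> ?b t m"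
        by (rule trans[OF PT.X.finsum_cong'[OF refl] PT.X.finsum_addf])
          (use st m in \<open>auto simp: Gc p_closed PT.T.l_distr PT.pt_add_left\<close>)
    qed (use m in \<open>auto simp: bc\<close>)
    show "?b t \<in> add_hom M PT.X" if t: "t \<in> carrier T" for t
    proof (rule add_homI)
      fix m n assume mn: "m \<in> carrier M" "n \<in> carrier M"
      show "?b t (m \<oplus>\<^bsub>M\<^esub> n) = ?b t m \<oplus>\<^bsub>PT.X\<^esub> ?b t n"
        by (rule trans[OF PT.X.finsum_cong'[OF refl] PT.X.finsum_addf])
          (use mn t in \<open>auto simp: Gc p_closed PT.T.r_distr PT.pt_add_left add_hom_add[OF G(1)]\<close>)
    qed (use t in \<open>auto simp: bc\<close>)
    show "?b (t \<otimes>\<^bsub>T\<^esub> \<tau> r) m = ?b t (r \<odot>\<^bsub>M\<^esub> m)"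
      if "t \<in> carrier T" "r \<in> carrier R" "m \<in> carrier M" for t r m
      using that by (intro PT.X.finsum_cong' refl) (auto simp: G(2) Gc p_closed PT.T.m_assoc)
  qed blast
  show thesis
  proof
    show "g (MT.pt t m) = ?b t m" if "t \<in> carrier T" "m \<in> carrier M" for t m
      using g(2) that .
    show "g \<in> module_hom T MT.X PT.X"
    proof (rule module_homI[OF g(1)])
      fix s y assume s: "s \<in> carrier T" and y: "y \<in> carrier MT.X"
      show "g (s \<odot>\<^bsub>MT.X\<^esub> y) = s \<odot>\<^bsub>PT.X\<^esub> g y"
      proof (rule MT.tensor_hom_eqI[OF add_hom_comp[OF MT.smult_add_hom[OF s] g(1)]
            add_hom_comp[OF g(1) PT.smult_add_hom[OF s]] _ y])
        fix t m assume tm: "t \<in> carrier T" "m \<in> carrier M"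
        have "s \<odot>\<^bsub>PT.X\<^esub> ?b t m = (\<Oplus>\<^bsub>PT.X\<^esub>l\<in>I. s \<odot>\<^bsub>PT.X\<^esub> PT.pt (t \<otimes>\<^bsub>T\<^esub> G l m) (p l))"
          using tm by (intro add_hom_finsum[OF PT.X.abelian_group_axioms PT.X.abelian_group_axioms
                PT.smult_add_hom[OF s]]) (auto simp: Gc p_closed)
        also have "\<dots> = ?b (s \<otimes>\<^bsub>T\<^esub> t) m"
          using s tm by (intro PT.X.finsum_cong' refl) (auto simp: PT.smult_pt Gc p_closed PT.T.m_assoc)
        finally show "g (s \<odot>\<^bsub>MT.X\<^esub> MT.pt t m) = s \<odot>\<^bsub>PT.X\<^esub> g (MT.pt t m)"
          using s tm by (simp add: MT.smult_pt g(2))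
      qed
    qed
    show "coordinates R M P \<mu> T \<tau> g l m = G l m" if lm: "l \<in> I" "m \<in> carrier M" for l m
    proof -
      have "coordinates R M P \<mu> T \<tau> g l m = coef l (?b \<one>\<^bsub>T\<^esub> m)"
        using lm by (simp add: coordinates_def g(2))
      also have "\<dots> = (\<Oplus>\<^bsub>T\<^esub>k\<in>I. coef l (PT.pt (\<one>\<^bsub>T\<^esub> \<otimes>\<^bsub>T\<^esub> G k m) (p k)))"
        using lm by (intro add_hom_finsum[OF PT.X.abelian_group_axioms PT.T.abelian_group_axioms coef_add_hom])
          (auto simp: Gc p_closed)
      also have "\<dots> = (\<Oplus>\<^bsub>T\<^esub>k\<in>I. G k m \<otimes>\<^bsub>T\<^esub> \<tau> (\<mu> l (p k)))"
        using lm by (intro PT.T.finsum_cong' refl) (auto simp: Gc p_closed \<mu>_closed coef_pt)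
      also have "\<dots> = G l m" using G(3)[OF lm] by simp
      finally show ?thesis .
    qed
  qed
qed

end

text \<open>Balancedness holds because 1 \<otimes> r x = \<sigma> r (1 \<otimes> x) in S \<otimes>
  N, and \<open>h (\<sigma> r) = \<tau> r\<close> moves this scalar across the outer tensor
  sign.\<close>

lemma
  assumes S: "scalar_extension R S N \<sigma>" and T: "scalar_extension R T N \<tau>"
    and h: "h \<in> ring_hom S T" "\<And>r. r \<in> carrier R \<Longrightarrow> h (\<sigma> r) = \<tau> r"
  shows tensor_trans_add_hom:
      "tensor_trans R S \<sigma> T h N \<in> add_hom (tensor R T \<tau> N) (tensor S T h (tensor R S \<sigma> N))"
    and tensor_trans_pt: "\<And>t x. t \<in> carrier T \<Longrightarrow> x \<in> carrier N \<Longrightarrow>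
      tensor_trans R S \<sigma> T h N (pure_tensor R T \<tau> N t x) =
        pure_tensor S T h (tensor R S \<sigma> N) t (pure_tensor R S \<sigma> N \<one>\<^bsub>S\<^esub> x)"
proof -
  interpret S: scalar_extension R S N \<sigma> by fact
  interpret T: scalar_extension R T N \<tau> by fact
  have ST: "scalar_extension S T S.X h"
    by (intro scalar_extension.intro scalar_extension_axioms.intro S.T.ring_axioms T.T.ring_axioms
        h S.tensor_left_module)
  interpret ST: scalar_extension S T S.X h by (rule ST)
  have id: "(\<lambda>t. t) \<in> add_hom T T" by (rule add_homI) auto
  have *: "frag_of (t \<otimes>\<^bsub>T\<^esub> \<tau> r, S.pt \<one>\<^bsub>S\<^esub> x) - frag_of (t, S.pt \<one>\<^bsub>S\<^esub> (r \<odot>\<^bsub>N\<^esub> x)) \<in> ST.K"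
    if "t \<in> carrier T" "r \<in> carrier R" "x \<in> carrier N" for t r x
    using ST.rel_balanced[of t "\<sigma> r" "S.pt \<one>\<^bsub>S\<^esub> x"] S.pt_balanced[of "\<one>\<^bsub>S\<^esub>" r x] that
    by (simp add: h S.smult_pt)
  show "tensor_trans R S \<sigma> T h N \<in> add_hom T.X ST.X"
    unfolding tensor_trans_def
    by (rule T.coset_map_tensor[OF ST _ id S.pt_add_hom(2)]) (auto intro: *)
  show "tensor_trans R S \<sigma> T h N (T.pt t x) = ST.pt t (S.pt \<one>\<^bsub>S\<^esub> x)"
    if "t \<in> carrier T" "x \<in> carrier N" for t x
    unfolding tensor_trans_def
    by (rule T.coset_map_tensor(2)[OF ST _ id S.pt_add_hom(2)]) (use that in \<open>auto intro: *\<close>)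
qed

text \<open>The bridge from tensor products to plain functions. One direction applies coordinate
  functionals to the base change square; the other rebuilds both sides on pure tensors from the dual
  basis expansion.\<close>

lemma is_base_change_iff_coordinates:
  assumes dual: "dual_basis R P I p \<mu>" and M: "left_module R M"
    and S: "ring S" "\<sigma> \<in> ring_hom R S" and T: "ring T" "\<tau> \<in> ring_hom R T"
    and h: "h \<in> ring_hom S T" "\<And>r. r \<in> carrier R \<Longrightarrow> h (\<sigma> r) = \<tau> r"
    and f: "f \<in> module_hom S (tensor R S \<sigma> M) (tensor R S \<sigma> P)"
    and g: "g \<in> module_hom T (tensor R T \<tau> M) (tensor R T \<tau> P)"
  shows "is_base_change R M P S \<sigma> f T \<tau> g h \<longleftrightarrow>
    (\<forall>l\<in>I. \<forall>m\<in>carrier M. h (coordinates R M P \<mu> S \<sigma> f l m) = coordinates R M P \<mu> T \<tau> g l m)"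
proof -
  interpret dual_basis R P I p \<mu> by fact
  interpret M: left_module R M by fact
  interpret S: ring S by fact
  interpret T: ring T by fact
  interpret PS: scalar_extension R S P \<sigma> by unfold_locales fact
  interpret MS: scalar_extension R S M \<sigma> by unfold_locales fact
  interpret PT: scalar_extension R T P \<tau> by unfold_locales fact
  interpret MT: scalar_extension R T M \<tau> by unfold_locales fact
  interpret PS: extended_dual_basis R P I p \<mu> S \<sigma> by unfold_locales
  interpret PT: extended_dual_basis R P I p \<mu> T \<tau> by unfold_locales
  have PST: "scalar_extension S T PS.X h"
    by (intro scalar_extension.intro scalar_extension_axioms.intro S T h PS.tensor_left_module)
  interpret PST: scalar_extension S T PS.X h by (rule PST)
  have MST: "scalar_extension S T MS.X h"
    by (intro scalar_extension.intro scalar_extension_axioms.intro S T h MS.tensor_left_module)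
  interpret MST: scalar_extension S T MS.X h by (rule MST)
  have id: "(\<lambda>t. t) \<in> add_hom T T" by (rule add_homI) auto
  note f' = module_hom_add_hom[OF f] and g' = module_hom_add_hom[OF g]
  note fc = add_hom_closed[OF f'] and gc = add_hom_closed[OF g']
  have trans: "tensor_trans R S \<sigma> T h P \<in> add_hom PT.X PST.X"
    "\<And>t x. t \<in> carrier T \<Longrightarrow> x \<in> carrier P \<Longrightarrow>
      tensor_trans R S \<sigma> T h P (PT.pt t x) = PST.pt t (PS.pt \<one>\<^bsub>S\<^esub> x)"
    by (rule tensor_trans_add_hom tensor_trans_pt;
        (rule PS.scalar_extension_axioms PT.scalar_extension_axioms h | assumption)+)+
  have transM: "tensor_trans R S \<sigma> T h M \<in> add_hom MT.X MST.X"
    "\<And>t x. t \<in> carrier T \<Longrightarrow> x \<in> carrier M \<Longrightarrow>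
      tensor_trans R S \<sigma> T h M (MT.pt t x) = MST.pt t (MS.pt \<one>\<^bsub>S\<^esub> x)"
    by (rule tensor_trans_add_hom tensor_trans_pt;
        (rule MS.scalar_extension_axioms MT.scalar_extension_axioms h | assumption)+)+
  have map: "tensor_map S T h PS.X f \<in> add_hom MST.X PST.X"
    "\<And>t y. t \<in> carrier T \<Longrightarrow> y \<in> carrier MS.X \<Longrightarrow>
      tensor_map S T h PS.X f (MST.pt t y) = PST.pt t (f y)"
  proof -
    have *: "frag_of (t \<otimes>\<^bsub>T\<^esub> h s, f y) - frag_of (t, f (s \<odot>\<^bsub>MS.X\<^esub> y)) \<in> PST.K"
      if "t \<in> carrier T" "s \<in> carrier S" "y \<in> carrier MS.X" for t s y
      using PST.rel_balanced[of t s "f y"] that by (simp add: module_hom_smult[OF f] fc)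
    show "tensor_map S T h PS.X f \<in> add_hom MST.X PST.X"
      unfolding tensor_map_def
      by (rule MST.coset_map_tensor[OF PST _ id f']) (auto intro: * fc)
    show "tensor_map S T h PS.X f (MST.pt t y) = PST.pt t (f y)"
      if "t \<in> carrier T" "y \<in> carrier MS.X" for t y
      unfolding tensor_map_def
      by (rule MST.coset_map_tensor(2)[OF PST _ id f']) (use that in \<open>auto intro: * fc\<close>)
  qed
  have coordS: "coordinate_family R M I p \<mu> S \<sigma> (coordinates R M P \<mu> S \<sigma> f)"
    by (rule PS.coordinate_family_coordinates[OF M f])
  then have coordS_closed: "coordinates R M P \<mu> S \<sigma> f l m \<in> carrier S" if "l \<in> I" "m \<in> carrier M" for l m
    using that add_hom_closed by (fastforce simp: coordinate_family_def)
  note hc = ring_hom_closed[OF h(1)]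
  show ?thesis
  proof
    assume bc: "is_base_change R M P S \<sigma> f T \<tau> g h"
    show "\<forall>l\<in>I. \<forall>m\<in>carrier M. h (coordinates R M P \<mu> S \<sigma> f l m) = coordinates R M P \<mu> T \<tau> g l m"
    proof (intro ballI)
      fix l m assume l: "l \<in> I" and m: "m \<in> carrier M"
      \<comment> \<open>The coordinate functional of S \<otimes> P extended once more to T. Composed
        with the canonical isomorphism it is the l-th coordinate on T \<otimes> P.\<close>
      define \<kappa> where "\<kappa> = coefficient S T h PS.X (PS.coef l)"
      have func: "functional S PS.X (PS.coef l)"
        using PS.coefficient_functional[OF functional[OF l]] .
      have \<kappa>: "\<kappa> \<in> add_hom PST.X T" "\<And>t y. t \<in> carrier T \<Longrightarrow> y \<in> carrier PS.X \<Longrightarrow>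
          \<kappa> (PST.pt t y) = t \<otimes>\<^bsub>T\<^esub> h (PS.coef l y)"
        using PST.coefficient_add_hom[OF func] PST.coefficient_pt[OF func] by (auto simp: \<kappa>_def)
      have \<kappa>_trans: "\<kappa> (tensor_trans R S \<sigma> T h P y) = PT.coef l y" if y: "y \<in> carrier PT.X" for y
        by (rule PT.tensor_hom_eqI[OF add_hom_comp[OF trans(1) \<kappa>(1)] PT.coef_add_hom[OF l] _ y])
          (use l in \<open>simp add: trans \<kappa> PS.coef_pt PT.coef_pt PS.\<mu>_closed h\<close>)
      have mt: "MT.pt \<one>\<^bsub>T\<^esub> m \<in> carrier MT.X" using m by simp
      have "coordinates R M P \<mu> T \<tau> g l m = \<kappa> (tensor_trans R S \<sigma> T h P (g (MT.pt \<one>\<^bsub>T\<^esub> m)))"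
        using m by (simp add: coordinates_def \<kappa>_trans gc)
      also have "tensor_trans R S \<sigma> T h P (g (MT.pt \<one>\<^bsub>T\<^esub> m)) =
          tensor_map S T h PS.X f (tensor_trans R S \<sigma> T h M (MT.pt \<one>\<^bsub>T\<^esub> m))"
        using bc mt unfolding is_base_change_def by blast
      also have "\<kappa> \<dots> = h (coordinates R M P \<mu> S \<sigma> f l m)"
        using l m by (simp add: transM map \<kappa> fc coordinates_def hc add_hom_closed[OF PS.coef_add_hom])
      finally show "h (coordinates R M P \<mu> S \<sigma> f l m) = coordinates R M P \<mu> T \<tau> g l m" by simp
    qed
  next
    assume eq: "\<forall>l\<in>I. \<forall>m\<in>carrier M. h (coordinates R M P \<mu> S \<sigma> f l m) = coordinates R M P \<mu> T \<tau> g l m"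
    show "is_base_change R M P S \<sigma> f T \<tau> g h"
      unfolding is_base_change_def
    proof
      fix x assume x: "x \<in> carrier MT.X"
      show "tensor_trans R S \<sigma> T h P (g x) = tensor_map S T h PS.X f (tensor_trans R S \<sigma> T h M x)"
      proof (rule MT.tensor_hom_eqI[OF add_hom_comp[OF g' trans(1)] add_hom_comp[OF transM(1) map(1)] _ x])
        fix t m assume tm: "t \<in> carrier T" "m \<in> carrier M"
        let ?F = "coordinates R M P \<mu> S \<sigma> f" and ?G = "coordinates R M P \<mu> T \<tau> g"
        have Gc: "?G l m \<in> carrier T" if "l \<in> I" for l
          using that tm eq hc coordS_closed by metis
        have "g (MT.pt t m) = t \<odot>\<^bsub>PT.X\<^esub> g (MT.pt \<one>\<^bsub>T\<^esub> m)"
          using module_hom_smult[OF g, of t "MT.pt \<one>\<^bsub>T\<^esub> m"] tm by (simp add: MT.smult_pt)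
        then have coef: "PT.coef l (g (MT.pt t m)) = t \<otimes>\<^bsub>T\<^esub> ?G l m" if "l \<in> I" for l
          using tm that by (simp add: PT.coef_smult gc coordinates_def)
        have "tensor_trans R S \<sigma> T h P (g (MT.pt t m)) =
            tensor_trans R S \<sigma> T h P (\<Oplus>\<^bsub>PT.X\<^esub>l\<in>I. PT.pt (PT.coef l (g (MT.pt t m))) (p l))"
          using PT.tensor_expansion[of "g (MT.pt t m)"] gc tm by simp
        also have "\<dots> = (\<Oplus>\<^bsub>PST.X\<^esub>l\<in>I. tensor_trans R S \<sigma> T h P (PT.pt (PT.coef l (g (MT.pt t m))) (p l)))"
          using tm by (intro add_hom_finsum[OF PT.X.abelian_group_axioms PST.X.abelian_group_axioms trans(1)])
            (simp add: p_closed coef Gc)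
        also have "\<dots> = (\<Oplus>\<^bsub>PST.X\<^esub>l\<in>I. PST.pt (t \<otimes>\<^bsub>T\<^esub> ?G l m) (PS.pt \<one>\<^bsub>S\<^esub> (p l)))"
          using tm by (intro PST.X.finsum_cong' refl) (auto simp: p_closed coef trans Gc)
        \<comment> \<open>By hypothesis \<open>?G l m\<close> is the image under h of
          \<open>?F l m\<close>, an element of S, so it may cross the tensor sign over S and act on
          1 \<otimes> p l.\<close>
        also have "\<dots> = (\<Oplus>\<^bsub>PST.X\<^esub>l\<in>I. PST.pt t (PS.pt (?F l m) (p l)))"
        proof (intro PST.X.finsum_cong' refl)
          fix l assume l: "l \<in> I"
          have "PS.pt (?F l m) (p l) = ?F l m \<odot>\<^bsub>PS.X\<^esub> PS.pt \<one>\<^bsub>S\<^esub> (p l)"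
            using l tm by (simp add: PS.smult_pt coordS_closed p_closed)
          then show "PST.pt (t \<otimes>\<^bsub>T\<^esub> ?G l m) (PS.pt \<one>\<^bsub>S\<^esub> (p l)) = PST.pt t (PS.pt (?F l m) (p l))"
            using l tm eq by (simp add: PST.pt_balanced[symmetric] coordS_closed p_closed)
        qed (use tm in \<open>auto simp: coordS_closed p_closed\<close>)
        also have "\<dots> = PST.pt t (\<Oplus>\<^bsub>PS.X\<^esub>l\<in>I. PS.pt (?F l m) (p l))"
          using tm by (intro add_hom_finsum[symmetric, OF PS.X.abelian_group_axioms PST.X.abelian_group_axioms
                PST.pt_add_hom(2)]) (auto simp: coordS_closed p_closed)
        also have "(\<Oplus>\<^bsub>PS.X\<^esub>l\<in>I. PS.pt (?F l m) (p l)) = f (MS.pt \<one>\<^bsub>S\<^esub> m)"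
          using PS.tensor_expansion[of "f (MS.pt \<one>\<^bsub>S\<^esub> m)"] tm by (simp add: fc coordinates_def)
        finally show "tensor_trans R S \<sigma> T h P (g (MT.pt t m)) =
            tensor_map S T h PS.X f (tensor_trans R S \<sigma> T h M (MT.pt t m))"
          using tm by (simp add: transM map)
      qed
    qed
  qed
qed

section \<open>Modules over strongly graded rings\<close>

lemma (in graded_ring) graded_group: "graded_group R Rg"
  using grading abelian_group_axioms by (simp add: graded_group_def graded_group_axioms_def)

lemma graded_module_graded_group: "graded_module R Rg M Mg \<Longrightarrow> graded_group M Mg"
  by (simp add: graded_module_def graded_group_def graded_group_axioms_def left_module_def)

lemma (in left_module)
  shows smult_add_hom_left: "m \<in> carrier M \<Longrightarrow> (\<lambda>r. r \<odot>\<^bsub>M\<^esub> m) \<in> add_hom R M"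
    and smult_add_hom_right: "r \<in> carrier R \<Longrightarrow> smult M r \<in> add_hom M M"
  by (auto intro!: add_homI simp: smult_l_distr smult_r_distr smult_closed)

text \<open>Turns membership in a generated subgroup into an explicit indexed sum. Signs are
  absorbed into the left factors, and sums are concatenated.\<close>

lemma (in graded_ring) graded_ring_finsum_products:
  assumes "x \<in> generate (add_monoid R) {a \<otimes> b | a b. a \<in> Rg \<alpha> \<and> b \<in> Rg \<beta>}"
  shows "\<exists>(n::nat) a b. (\<forall>i<n. a i \<in> Rg \<alpha> \<and> b i \<in> Rg \<beta>) \<and> x = (\<Oplus>i\<in>{..<n}. a i \<otimes> b i)"
proof -
  interpret graded_group R Rg by (rule graded_group)
  have "{a \<otimes> b | a b. a \<in> Rg \<alpha> \<and> b \<in> Rg \<beta>} \<subseteq> carrier R" by auto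
  with assms show ?thesis
  proof (induction rule: generate_add_induct)
    case zero
    show ?case by (rule exI[of _ 0]) auto
  next
    case (incl h)
    then obtain a b where "h = a \<otimes> b" "a \<in> Rg \<alpha>" "b \<in> Rg \<beta>" by auto
    then show ?case
      by (intro exI[of _ "1::nat"] exI[of _ "\<lambda>_. a"] exI[of _ "\<lambda>_. b"]) (auto simp: lessThan_Suc)
  next
    case (minus h)
    then obtain a b where "h = a \<otimes> b" "a \<in> Rg \<alpha>" "b \<in> Rg \<beta>" by auto
    then show ?case
      by (intro exI[of _ "1::nat"] exI[of _ "\<lambda>_. \<ominus> a"] exI[of _ "\<lambda>_. b"])
        (auto simp: lessThan_Suc l_minus component_minus_closed)
  next
    case (add x y)
    from add(3) obtain n a b where
      1: "\<And>i. i < n \<Longrightarrow> a i \<in> Rg \<alpha> \<and> b i \<in> Rg \<beta>" "x = (\<Oplus>i\<in>{..<n::nat}. a i \<otimes> b i)" by blast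
    from add(4) obtain m c d where
      2: "\<And>i. i < m \<Longrightarrow> c i \<in> Rg \<alpha> \<and> d i \<in> Rg \<beta>" "y = (\<Oplus>i\<in>{..<m::nat}. c i \<otimes> d i)" by blast
    \<comment> \<open>Concatenation: indices from n on read the second sum, shifted by n.\<close>
    let ?a = "\<lambda>i. if i < n then a i else c (i - n)" and ?b = "\<lambda>i. if i < n then b i else d (i - n)"
    have ab: "?a i \<in> Rg \<alpha>" "?b i \<in> Rg \<beta>" if "i < n + m" for i
      using 1(1)[of i] 2(1)[of "i - n"] that by auto
    have prod: "?a i \<otimes> ?b i \<in> carrier R" if "i < n + m" for i
      by (rule m_closed[OF component_closed[OF ab(1)[OF that]] component_closed[OF ab(2)[OF that]]])
    have "{..<n + m} = {..<n} \<union> (+) n ` {..<m}"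
    proof -
      have "(+) n ` {..<m} = {n..<n + m}"
        by (simp add: lessThan_atLeast0 add.commute del: atLeast0LessThan)
      then show ?thesis by auto
    qed
    then have "(\<Oplus>i\<in>{..<n + m}. ?a i \<otimes> ?b i) =
        (\<Oplus>i\<in>{..<n}. ?a i \<otimes> ?b i) \<oplus> (\<Oplus>i\<in>(+) n ` {..<m}. ?a i \<otimes> ?b i)"
      using prod by (simp only:) (intro finsum_Un_disjoint; auto)
    also have "(\<Oplus>i\<in>{..<n}. ?a i \<otimes> ?b i) = x"
      unfolding 1(2) using m_closed[OF component_closed component_closed] 1(1)
      by (intro finsum_cong' refl Pi_I) (blast, simp)
    also have "(\<Oplus>i\<in>(+) n ` {..<m}. ?a i \<otimes> ?b i) = y"
    proof -
      have "(\<Oplus>i\<in>(+) n ` {..<m}. ?a i \<otimes> ?b i) = (\<Oplus>i\<in>{..<m}. ?a (n + i) \<otimes> ?b (n + i))"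
        by (intro finsum_reindex Pi_I prod) auto
      also have "\<dots> = y"
        unfolding 2(2) using m_closed[OF component_closed component_closed] 2(1)
        by (intro finsum_cong' refl Pi_I) (blast, simp)
      finally show ?thesis .
    qed
    finally show ?case using ab by (intro exI[of _ "n + m"] exI[of _ ?a] exI[of _ ?b]) auto
  qed
qed

text \<open>Strong grading for the degrees \<gamma> and - \<gamma>, read at the element 1.\<close>

lemma (in strongly_graded_ring) partition_of_unity:
  assumes "\<one> \<in> Rg 0"
  shows "\<exists>(n::nat) a b. (\<forall>i<n. a i \<in> Rg \<gamma> \<and> b i \<in> Rg (- \<gamma>)) \<and> \<one> = (\<Oplus>i\<in>{..<n}. a i \<otimes> b i)"
proof -
  have "\<one> \<in> Rg (\<gamma> + - \<gamma>)" using assms by simp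
  then have "\<one> \<in> generate (add_monoid R) {a \<otimes> b | a b. a \<in> Rg \<gamma> \<and> b \<in> Rg (- \<gamma>)}"
    unfolding strongly_graded .
  then show ?thesis by (rule graded_ring_finsum_products)
qed

text \<open>The partitions are fixed for all degrees at once: a map defined on M_\<gamma> through a
  partition is additive only if the partition does not vary with the element.\<close>

lemma (in strongly_graded_ring) ex_partitions_of_unity:
  assumes "\<one> \<in> Rg 0"
  shows "\<exists>(n :: _ \<Rightarrow> nat) a b. \<forall>\<gamma>. (\<forall>i<n \<gamma>. a \<gamma> i \<in> Rg \<gamma> \<and> b \<gamma> i \<in> Rg (- \<gamma>)) \<and>
    \<one> = (\<Oplus>i\<in>{..<n \<gamma>}. a \<gamma> i \<otimes> b \<gamma> i)"
proof -
  let ?Q = "\<lambda>\<gamma> x. (\<forall>i<fst x. fst (snd x) i \<in> Rg \<gamma> \<and> snd (snd x) i \<in> Rg (- \<gamma>)) \<and>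
    \<one> = (\<Oplus>i\<in>{..<fst x :: nat}. fst (snd x) i \<otimes> snd (snd x) i)"
  have "\<exists>x. ?Q \<gamma> x" for \<gamma>
  proof -
    obtain n a b where "?Q \<gamma> (n, a, b)" using partition_of_unity[OF assms, of \<gamma>] by auto
    then show ?thesis by (rule exI)
  qed
  then obtain x where "\<forall>\<gamma>. ?Q \<gamma> (x \<gamma>)" using choice[of ?Q] by blast
  then show ?thesis
    by (intro exI[of _ "\<lambda>\<gamma>. fst (x \<gamma>)"] exI[of _ "\<lambda>\<gamma>. fst (snd (x \<gamma>))"]
      exI[of _ "\<lambda>\<gamma>. snd (snd (x \<gamma>))"])
qed

text \<open>Linearity over R when T is an R-module by restriction along \<open>\<tau>\<close>. With
  the carrier of R cut down to R_0 and the same \<open>\<tau>\<close>, it also expresses linearity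
  over R_0.\<close>

definition semilinear ::
  "('r, 'x) ring_scheme \<Rightarrow> ('r, 'm, 'y) module_scheme \<Rightarrow> ('t, 'z) ring_scheme \<Rightarrow> ('r \<Rightarrow> 't) \<Rightarrow>
   ('m \<Rightarrow> 't) \<Rightarrow> bool" where
  "semilinear R M T \<tau> G \<longleftrightarrow> G \<in> add_hom M T \<and>
     (\<forall>r\<in>carrier R. \<forall>m\<in>carrier M. G (r \<odot>\<^bsub>M\<^esub> m) = \<tau> r \<otimes>\<^bsub>T\<^esub> G m)"

lemma coordinate_family_alt:
  "coordinate_family R M I p \<mu> T \<tau> G \<longleftrightarrow> (\<forall>l\<in>I. semilinear R M T \<tau> (G l) \<and>
     (\<forall>m\<in>carrier M. G l m = (\<Oplus>\<^bsub>T\<^esub>k\<in>I. G k m \<otimes>\<^bsub>T\<^esub> \<tau> (\<mu> l (p k)))))"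
  unfolding coordinate_family_def semilinear_def by blast

lemma semilinear_comp:
  assumes "semilinear R M S \<sigma> G" "h \<in> ring_hom S T" "\<And>r. r \<in> carrier R \<Longrightarrow> h (\<sigma> r) = \<tau> r"
    "\<sigma> \<in> carrier R \<rightarrow> carrier S"
  shows "semilinear R M T \<tau> (\<lambda>m. h (G m))"
proof -
  have G: "G \<in> add_hom M S" using assms(1) by (simp add: semilinear_def)
  have "h (G (r \<odot>\<^bsub>M\<^esub> m)) = \<tau> r \<otimes>\<^bsub>T\<^esub> h (G m)" if "r \<in> carrier R" "m \<in> carrier M" for r m
    using that assms ring_hom_mult[OF assms(2), of "\<sigma> r" "G m"] add_hom_closed[OF G]
    by (auto simp: semilinear_def)
  then show ?thesis
    using add_hom_comp[OF G ring_hom_add_hom[OF assms(2)]] by (simp add: semilinear_def)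
qed

locale strongly_graded_module = strongly_graded_ring R Rg + M: left_module R M
  for R :: "('r, 'x) ring_scheme" (structure) and Rg :: "'g::ab_group_add \<Rightarrow> 'r set"
    and M :: "('r, 'm, 'y) module_scheme" +
  fixes Mg :: "'g \<Rightarrow> 'm set"
  assumes graded_module: "graded_module R Rg M Mg"
    and one_degree_zero: "\<one> \<in> Rg 0"
begin

sublocale RG: graded_group R Rg by (rule graded_group)

sublocale MG: graded_group M Mg using graded_module by (rule graded_module_graded_group)

lemma smult_graded: "r \<in> Rg \<alpha> \<Longrightarrow> m \<in> Mg \<beta> \<Longrightarrow> r \<odot>\<^bsub>M\<^esub> m \<in> Mg (\<alpha> + \<beta>)"
  using graded_module by (simp add: graded_module_def)

text \<open>M_\<gamma> = R_\<gamma> M_0: multiply m by a partition of unity, whose right factors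
  lower m to degree zero.\<close>

lemma homogeneous_expansion:
  assumes m: "m \<in> Mg \<gamma>"
  shows "\<exists>(n::nat) a b. (\<forall>i<n. a i \<in> Rg \<gamma> \<and> b i \<odot>\<^bsub>M\<^esub> m \<in> Mg 0) \<and>
    m = (\<Oplus>\<^bsub>M\<^esub>i\<in>{..<n}. a i \<odot>\<^bsub>M\<^esub> (b i \<odot>\<^bsub>M\<^esub> m))"
proof -
  obtain n :: nat and a b where ab: "\<And>i. i < n \<Longrightarrow> a i \<in> Rg \<gamma>" "\<And>i. i < n \<Longrightarrow> b i \<in> Rg (- \<gamma>)"
    and one: "\<one> = (\<Oplus>i\<in>{..<n}. a i \<otimes> b i)"
    using partition_of_unity[OF one_degree_zero, of \<gamma>] by blast
  have c: "a i \<in> carrier R" "b i \<in> carrier R" if "i < n" for i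
    using RG.component_closed[OF ab(1)[OF that]] RG.component_closed[OF ab(2)[OF that]] .
  have mc: "m \<in> carrier M" using m by simp
  have "m = (\<Oplus>i\<in>{..<n}. a i \<otimes> b i) \<odot>\<^bsub>M\<^esub> m"
    using mc by (simp add: one[symmetric] M.smult_one)
  also have "\<dots> = (\<Oplus>\<^bsub>M\<^esub>i\<in>{..<n}. (a i \<otimes> b i) \<odot>\<^bsub>M\<^esub> m)"
    using c by (intro add_hom_finsum[OF abelian_group_axioms M.abelian_group_axioms M.smult_add_hom_left[OF mc]]) auto
  also have "\<dots> = (\<Oplus>\<^bsub>M\<^esub>i\<in>{..<n}. a i \<odot>\<^bsub>M\<^esub> (b i \<odot>\<^bsub>M\<^esub> m))"
    using c mc by (intro M.finsum_cong' refl) (auto simp: M.smult_assoc M.smult_closed)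
  finally have "m = (\<Oplus>\<^bsub>M\<^esub>i\<in>{..<n}. a i \<odot>\<^bsub>M\<^esub> (b i \<odot>\<^bsub>M\<^esub> m))" .
  moreover have "b i \<odot>\<^bsub>M\<^esub> m \<in> Mg 0" if "i < n" for i
    using smult_graded[OF ab(2)[OF that] m] by simp
  ultimately show ?thesis using ab(1) by blast
qed

lemma semilinear_expansion:
  assumes T: "ring T" and G: "semilinear R M T \<tau> G"
    and ab: "\<And>i. i < n \<Longrightarrow> a i \<in> carrier R" "\<And>i. i < n \<Longrightarrow> y i \<in> carrier M"
  shows "G (\<Oplus>\<^bsub>M\<^esub>i\<in>{..<n::nat}. a i \<odot>\<^bsub>M\<^esub> y i) = (\<Oplus>\<^bsub>T\<^esub>i\<in>{..<n}. \<tau> (a i) \<otimes>\<^bsub>T\<^esub> G (y i))"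
proof -
  interpret T: ring T by fact
  have G: "G \<in> add_hom M T" "\<And>r m. r \<in> carrier R \<Longrightarrow> m \<in> carrier M \<Longrightarrow> G (r \<odot>\<^bsub>M\<^esub> m) = \<tau> r \<otimes>\<^bsub>T\<^esub> G m"
    using G by (auto simp: semilinear_def)
  have "G (\<Oplus>\<^bsub>M\<^esub>i\<in>{..<n}. a i \<odot>\<^bsub>M\<^esub> y i) = (\<Oplus>\<^bsub>T\<^esub>i\<in>{..<n}. G (a i \<odot>\<^bsub>M\<^esub> y i))"
    using ab by (intro add_hom_finsum[OF M.abelian_group_axioms T.abelian_group_axioms G(1)])
      (auto simp: M.smult_closed)
  also have "\<dots> = (\<Oplus>\<^bsub>T\<^esub>i\<in>{..<n}. \<tau> (a i) \<otimes>\<^bsub>T\<^esub> G (y i))"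
  proof (intro T.finsum_cong' refl)
    show "(\<lambda>i. \<tau> (a i) \<otimes>\<^bsub>T\<^esub> G (y i)) \<in> {..<n} \<rightarrow> carrier T"
      using ab by (auto simp: G(2)[symmetric] M.smult_closed add_hom_closed[OF G(1)])
  qed (use ab in \<open>auto simp: G(2)\<close>)
  finally show ?thesis .
qed

text \<open>M_0 generates M over R, by the expansion of homogeneous elements.\<close>

lemma semilinear_unique:
  assumes T: "ring T" and G: "semilinear R M T \<tau> G" and H: "semilinear R M T \<tau> H"
    and eq: "\<And>m. m \<in> Mg 0 \<Longrightarrow> G m = H m" and m: "m \<in> carrier M"
  shows "G m = H m"
proof (rule MG.add_hom_eqI[OF _ _ _ m])
  show GH: "G \<in> add_hom M T" "H \<in> add_hom M T" using G H by (auto simp: semilinear_def)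
  interpret T: ring T by fact
  fix \<gamma> m assume m: "m \<in> Mg \<gamma>"
  obtain n :: nat and a b where ab: "\<And>i. i < n \<Longrightarrow> a i \<in> Rg \<gamma>"
    "m = (\<Oplus>\<^bsub>M\<^esub>i\<in>{..<n}. a i \<odot>\<^bsub>M\<^esub> (b i \<odot>\<^bsub>M\<^esub> m))" "\<And>i. i < n \<Longrightarrow> b i \<odot>\<^bsub>M\<^esub> m \<in> Mg 0"
    using homogeneous_expansion[OF m] by blast
  have ac: "a i \<in> carrier R" "b i \<odot>\<^bsub>M\<^esub> m \<in> carrier M" if "i < n" for i
    using RG.component_closed[OF ab(1)[OF that]] MG.component_closed[OF ab(3)[OF that]] .
  have "G m = (\<Oplus>\<^bsub>T\<^esub>i\<in>{..<n}. \<tau> (a i) \<otimes>\<^bsub>T\<^esub> G (b i \<odot>\<^bsub>M\<^esub> m))"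
    using semilinear_expansion[OF T G, of n a "\<lambda>i. b i \<odot>\<^bsub>M\<^esub> m"] ac ab(2) by simp
  also have "\<dots> = (\<Oplus>\<^bsub>T\<^esub>i\<in>{..<n}. \<tau> (a i) \<otimes>\<^bsub>T\<^esub> H (b i \<odot>\<^bsub>M\<^esub> m))"
  proof (intro T.finsum_cong' refl)
    have "\<tau> (a i) \<otimes>\<^bsub>T\<^esub> H (b i \<odot>\<^bsub>M\<^esub> m) \<in> carrier T" if "i < n" for i
      using H ac[OF that] M.smult_closed[OF ac[OF that]] add_hom_closed[OF GH(2)]
      by (metis semilinear_def)
    then show "(\<lambda>i. \<tau> (a i) \<otimes>\<^bsub>T\<^esub> H (b i \<odot>\<^bsub>M\<^esub> m)) \<in> {..<n} \<rightarrow> carrier T" by auto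
  qed (use eq ab(3) in auto)
  also have "\<dots> = H m"
    using semilinear_expansion[OF T H, of n a "\<lambda>i. b i \<odot>\<^bsub>M\<^esub> m"] ac ab(2) by simp
  finally show "G m = H m" .
qed

text \<open>On M_\<gamma> the value is a sum of products of \<tau>(a) in degree \<gamma> with values
  of degree zero.\<close>

lemma semilinear_graded:
  assumes T: "graded_ring T Tg" and \<tau>: "\<And>\<gamma>. \<tau> ` Rg \<gamma> \<subseteq> Tg \<gamma>" and G: "semilinear R M T \<tau> G"
    and 0: "\<And>m. m \<in> Mg 0 \<Longrightarrow> G m \<in> Tg 0" and m: "m \<in> Mg \<gamma>"
  shows "G m \<in> Tg \<gamma>"
proof -
  interpret T: graded_ring T Tg by fact
  interpret TG: graded_group T Tg by (rule T.graded_group)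
  obtain n :: nat and a b where ab: "\<And>i. i < n \<Longrightarrow> a i \<in> Rg \<gamma>"
    "m = (\<Oplus>\<^bsub>M\<^esub>i\<in>{..<n}. a i \<odot>\<^bsub>M\<^esub> (b i \<odot>\<^bsub>M\<^esub> m))" "\<And>i. i < n \<Longrightarrow> b i \<odot>\<^bsub>M\<^esub> m \<in> Mg 0"
    using homogeneous_expansion[OF m] by blast
  have ac: "a i \<in> carrier R" "b i \<odot>\<^bsub>M\<^esub> m \<in> carrier M" if "i < n" for i
    using RG.component_closed[OF ab(1)[OF that]] MG.component_closed[OF ab(3)[OF that]] .
  have "G m = (\<Oplus>\<^bsub>T\<^esub>i\<in>{..<n}. \<tau> (a i) \<otimes>\<^bsub>T\<^esub> G (b i \<odot>\<^bsub>M\<^esub> m))"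
    using semilinear_expansion[OF T.ring_axioms G, of n a "\<lambda>i. b i \<odot>\<^bsub>M\<^esub> m"] ac ab(2) by simp
  moreover have "\<tau> (a i) \<otimes>\<^bsub>T\<^esub> G (b i \<odot>\<^bsub>M\<^esub> m) \<in> Tg \<gamma>" if "i < n" for i
    using T.graded_mult[of "\<tau> (a i)" \<gamma> "G (b i \<odot>\<^bsub>M\<^esub> m)" 0] \<tau>[of \<gamma>] ab(1,3)[OF that] 0 by auto
  ultimately show ?thesis by (auto intro: TG.component_finsum_closed)
qed

text \<open>This is the isomorphism \<open>M \<cong> R \<otimes> M\<^sub>0\<close> of Dade's theorem in terms of universal properties.\<close>

lemma ex_semilinear_extension:
  assumes T: "ring T" and \<tau>: "\<tau> \<in> ring_hom R T"
    and H: "semilinear (R\<lparr>carrier := Rg 0\<rparr>) (M\<lparr>carrier := Mg 0\<rparr>) T \<tau> H"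
  obtains G where "semilinear R M T \<tau> G" "\<And>m. m \<in> Mg 0 \<Longrightarrow> G m = H m"
proof -
  interpret T: ring T by fact
  note \<tau>c = ring_hom_closed[OF \<tau>] and \<tau>m = ring_hom_mult[OF \<tau>]
  have H: "\<And>m. m \<in> Mg 0 \<Longrightarrow> H m \<in> carrier T"
    "\<And>m n. m \<in> Mg 0 \<Longrightarrow> n \<in> Mg 0 \<Longrightarrow> H (m \<oplus>\<^bsub>M\<^esub> n) = H m \<oplus>\<^bsub>T\<^esub> H n"
    "\<And>r m. r \<in> Rg 0 \<Longrightarrow> m \<in> Mg 0 \<Longrightarrow> H (r \<odot>\<^bsub>M\<^esub> m) = \<tau> r \<otimes>\<^bsub>T\<^esub> H m"
    using H by (auto simp: semilinear_def hom_def)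
  obtain n :: "'g \<Rightarrow> nat" and a b where
    ab: "\<And>\<gamma> i. i < n \<gamma> \<Longrightarrow> a \<gamma> i \<in> Rg \<gamma>" "\<And>\<gamma> i. i < n \<gamma> \<Longrightarrow> b \<gamma> i \<in> Rg (- \<gamma>)"
    and one: "\<And>\<gamma>. \<one> = (\<Oplus>i\<in>{..<n \<gamma>}. a \<gamma> i \<otimes> b \<gamma> i)"
    using ex_partitions_of_unity[OF one_degree_zero] by blast
  have abc: "a \<gamma> i \<in> carrier R" "b \<gamma> i \<in> carrier R" if "i < n \<gamma>" for \<gamma> i
    using RG.component_closed[OF ab(1)[OF that]] RG.component_closed[OF ab(2)[OF that]] .
  \<comment> \<open>The only possible extension to degree \<gamma>, computed with the chosen
    partition. \<open>H\<close> applies because each \<open>b \<gamma> i\<close> lowers m to degree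
    zero.\<close>
  define f where "f \<gamma> m = (\<Oplus>\<^bsub>T\<^esub>i\<in>{..<n \<gamma>}. \<tau> (a \<gamma> i) \<otimes>\<^bsub>T\<^esub> H (b \<gamma> i \<odot>\<^bsub>M\<^esub> m))" for \<gamma> m
  have bm: "b \<gamma> i \<odot>\<^bsub>M\<^esub> m \<in> Mg 0" if "i < n \<gamma>" "m \<in> Mg \<gamma>" for \<gamma> i m
    using smult_graded[OF ab(2)[OF that(1)] that(2)] by simp
  obtain G where G: "G \<in> add_hom M T" "\<And>\<gamma> m. m \<in> Mg \<gamma> \<Longrightarrow> G m = f \<gamma> m"
  proof (rule MG.ex_add_hom[of T f])
    show "f \<gamma> m \<in> carrier T" if "m \<in> Mg \<gamma>" for \<gamma> m
      unfolding f_def using that by (auto intro!: T.finsum_closed simp: H bm \<tau>c abc)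
    show "f \<gamma> (x \<oplus>\<^bsub>M\<^esub> y) = f \<gamma> x \<oplus>\<^bsub>T\<^esub> f \<gamma> y" if "x \<in> Mg \<gamma>" "y \<in> Mg \<gamma>" for \<gamma> x y
      unfolding f_def
      by (rule trans[OF T.finsum_cong'[OF refl] T.finsum_addf])
        (use that MG.component_closed in \<open>auto simp: H bm \<tau>c abc M.smult_r_distr T.r_distr\<close>)
  qed (auto intro: T.abelian_group_axioms)
  \<comment> \<open>Independence of the chosen partition. Since
    \<open>b \<delta> i \<otimes> s\<close> lies in R_0, linearity of \<open>H\<close> over R_0
    pulls it out, and the partition then sums to 1. Taking s = 1 shows below that G extends
    H.\<close>
  have key: "G (s \<odot>\<^bsub>M\<^esub> y) = \<tau> s \<otimes>\<^bsub>T\<^esub> H y" if s: "s \<in> Rg \<delta>" and y: "y \<in> Mg 0" for s y \<delta>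
  proof -
    have sc: "s \<in> carrier R" "y \<in> carrier M" using s y by auto
    have bs: "b \<delta> i \<otimes> s \<in> Rg 0" if "i < n \<delta>" for i
      using graded_mult[OF ab(2)[OF that] s] by simp
    have "G (s \<odot>\<^bsub>M\<^esub> y) = f \<delta> (s \<odot>\<^bsub>M\<^esub> y)"
      using G(2) smult_graded[OF s y] by simp
    also have "\<dots> = (\<Oplus>\<^bsub>T\<^esub>i\<in>{..<n \<delta>}. \<tau> (a \<delta> i \<otimes> b \<delta> i) \<otimes>\<^bsub>T\<^esub> (\<tau> s \<otimes>\<^bsub>T\<^esub> H y))"
      unfolding f_def
    proof (intro T.finsum_cong' refl)
      fix i assume "i \<in> {..<n \<delta>}"
      then have i: "i < n \<delta>" by simp
      have "H (b \<delta> i \<odot>\<^bsub>M\<^esub> (s \<odot>\<^bsub>M\<^esub> y)) = \<tau> (b \<delta> i \<otimes> s) \<otimes>\<^bsub>T\<^esub> H y"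
        using H(3)[OF bs[OF i] y] abc(2)[OF i] sc by (simp add: M.smult_assoc)
      then show "\<tau> (a \<delta> i) \<otimes>\<^bsub>T\<^esub> H (b \<delta> i \<odot>\<^bsub>M\<^esub> (s \<odot>\<^bsub>M\<^esub> y)) = \<tau> (a \<delta> i \<otimes> b \<delta> i) \<otimes>\<^bsub>T\<^esub> (\<tau> s \<otimes>\<^bsub>T\<^esub> H y)"
        using abc[OF i] sc y by (simp add: \<tau>m \<tau>c H T.m_assoc)
    qed (use sc y in \<open>auto simp: \<tau>c abc H\<close>)
    also have "\<dots> = (\<Oplus>\<^bsub>T\<^esub>i\<in>{..<n \<delta>}. \<tau> (a \<delta> i \<otimes> b \<delta> i)) \<otimes>\<^bsub>T\<^esub> (\<tau> s \<otimes>\<^bsub>T\<^esub> H y)"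
      by (rule T.finsum_ldistr[symmetric]) (use sc y in \<open>auto simp: \<tau>c abc H\<close>)
    also have "(\<Oplus>\<^bsub>T\<^esub>i\<in>{..<n \<delta>}. \<tau> (a \<delta> i \<otimes> b \<delta> i)) = \<tau> (\<Oplus>i\<in>{..<n \<delta>}. a \<delta> i \<otimes> b \<delta> i)"
      by (intro add_hom_finsum[symmetric, OF abelian_group_axioms T.abelian_group_axioms
            ring_hom_add_hom[OF \<tau>]]) (auto simp: abc)
    also have "\<dots> = \<one>\<^bsub>T\<^esub>"
      unfolding one[symmetric] by (rule ring_hom_one[OF \<tau>])
    finally show ?thesis using sc y by (simp add: \<tau>c H)
  qed
  have GH: "G m = H m" if "m \<in> Mg 0" for m
    using key[OF one_degree_zero that] that by (simp add: M.smult_one ring_hom_one[OF \<tau>] H)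
  \<comment> \<open>Write m as a sum of products of \<open>a i\<close> in R_\<gamma> with
    \<open>y i\<close> in M_0 and use \<open>key\<close> twice, with s = r a_i and with s =
    a_i.\<close>
  have homog: "G (r \<odot>\<^bsub>M\<^esub> m) = \<tau> r \<otimes>\<^bsub>T\<^esub> G m" if r: "r \<in> Rg \<rho>" and m: "m \<in> Mg \<gamma>" for r m \<rho> \<gamma>
  proof -
    obtain n :: nat and a b where ab: "\<And>i. i < n \<Longrightarrow> a i \<in> Rg \<gamma>"
      "m = (\<Oplus>\<^bsub>M\<^esub>i\<in>{..<n}. a i \<odot>\<^bsub>M\<^esub> (b i \<odot>\<^bsub>M\<^esub> m))" "\<And>i. i < n \<Longrightarrow> b i \<odot>\<^bsub>M\<^esub> m \<in> Mg 0"
      using homogeneous_expansion[OF m] by blast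
    define y where "y i = b i \<odot>\<^bsub>M\<^esub> m" for i
    have y: "y i \<in> Mg 0" if "i < n" for i using ab(3)[OF that] by (simp add: y_def)
    have m_eq: "m = (\<Oplus>\<^bsub>M\<^esub>i\<in>{..<n}. a i \<odot>\<^bsub>M\<^esub> y i)" using ab(2) by (simp add: y_def)
    have ac: "a i \<in> carrier R" "y i \<in> carrier M" if "i < n" for i
      using RG.component_closed[OF ab(1)[OF that]] MG.component_closed[OF y[OF that]] .
    have rc: "r \<in> carrier R" using r by auto
    have "G (r \<odot>\<^bsub>M\<^esub> m) = G (\<Oplus>\<^bsub>M\<^esub>i\<in>{..<n}. r \<odot>\<^bsub>M\<^esub> (a i \<odot>\<^bsub>M\<^esub> y i))"
      unfolding m_eq using ac
      by (subst add_hom_finsum[OF M.abelian_group_axioms M.abelian_group_axioms M.smult_add_hom_right[OF rc]])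
        (auto simp: M.smult_closed)
    also have "\<dots> = (\<Oplus>\<^bsub>T\<^esub>i\<in>{..<n}. G (r \<odot>\<^bsub>M\<^esub> (a i \<odot>\<^bsub>M\<^esub> y i)))"
      using ac rc by (intro add_hom_finsum[OF M.abelian_group_axioms T.abelian_group_axioms G(1)])
        (auto simp: M.smult_closed)
    also have "\<dots> = (\<Oplus>\<^bsub>T\<^esub>i\<in>{..<n}. \<tau> r \<otimes>\<^bsub>T\<^esub> G (a i \<odot>\<^bsub>M\<^esub> y i))"
    proof (intro T.finsum_cong' refl)
      fix i assume "i \<in> {..<n}"
      then have i: "i < n" by simp
      have "G (r \<odot>\<^bsub>M\<^esub> (a i \<odot>\<^bsub>M\<^esub> y i)) = \<tau> (r \<otimes> a i) \<otimes>\<^bsub>T\<^esub> H (y i)"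
        using key[OF graded_mult[OF r ab(1)[OF i]] y[OF i]] ac[OF i] rc by (simp add: M.smult_assoc)
      then show "G (r \<odot>\<^bsub>M\<^esub> (a i \<odot>\<^bsub>M\<^esub> y i)) = \<tau> r \<otimes>\<^bsub>T\<^esub> G (a i \<odot>\<^bsub>M\<^esub> y i)"
        using key[OF ab(1)[OF i] y[OF i]] ac[OF i] rc y[OF i] by (simp add: \<tau>m \<tau>c H T.m_assoc)
    qed (use ac rc in \<open>auto simp: \<tau>c add_hom_closed[OF G(1)] M.smult_closed\<close>)
    also have "\<dots> = \<tau> r \<otimes>\<^bsub>T\<^esub> (\<Oplus>\<^bsub>T\<^esub>i\<in>{..<n}. G (a i \<odot>\<^bsub>M\<^esub> y i))"
      by (rule T.finsum_rdistr[symmetric])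
        (use ac rc in \<open>auto simp: \<tau>c add_hom_closed[OF G(1)] M.smult_closed\<close>)
    also have "(\<Oplus>\<^bsub>T\<^esub>i\<in>{..<n}. G (a i \<odot>\<^bsub>M\<^esub> y i)) = G m"
      unfolding m_eq using ac
      by (intro add_hom_finsum[symmetric, OF M.abelian_group_axioms T.abelian_group_axioms G(1)])
        (auto simp: M.smult_closed)
    finally show ?thesis .
  qed
  \<comment> \<open>From homogeneous elements to all, by additivity first in r and then in
    m.\<close>
  have "G (r \<odot>\<^bsub>M\<^esub> m) = \<tau> r \<otimes>\<^bsub>T\<^esub> G m" if r: "r \<in> carrier R" and m: "m \<in> carrier M" for r m
  proof (rule RG.add_hom_eqI[OF add_hom_comp[OF M.smult_add_hom_left[OF m] G(1)] _ _ r])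
    show "(\<lambda>r. \<tau> r \<otimes>\<^bsub>T\<^esub> G m) \<in> add_hom R T"
      using m by (auto intro!: add_homI simp: \<tau>c add_hom_closed[OF G(1)] ring_hom_add[OF \<tau>] T.l_distr)
    fix \<rho> r assume r: "r \<in> Rg \<rho>"
    then have rc: "r \<in> carrier R" by simp
    show "G (r \<odot>\<^bsub>M\<^esub> m) = \<tau> r \<otimes>\<^bsub>T\<^esub> G m"
    proof (rule MG.add_hom_eqI[OF add_hom_comp[OF M.smult_add_hom_right[OF rc] G(1)] _ _ m])
      show "(\<lambda>m. \<tau> r \<otimes>\<^bsub>T\<^esub> G m) \<in> add_hom M T"
        using rc by (auto intro!: add_homI simp: \<tau>c add_hom_closed[OF G(1)] add_hom_add[OF G(1)] T.r_distr)
    qed (rule homog[OF r])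
  qed
  then show thesis using that[of G] G(1) GH by (simp add: semilinear_def)
qed

end

section \<open>Degree-zero rings and modules, and dual bases of degree zero\<close>

abbreviation (input) degree_zero_ring :: "('r, 'x) ring_scheme \<Rightarrow> ('g::zero \<Rightarrow> 'r set) \<Rightarrow> ('r, 'x) ring_scheme" where
  "degree_zero_ring R Rg \<equiv> R\<lparr>carrier := Rg 0\<rparr>"

text \<open>Only the carrier shrinks, so the type of elements is kept. This serves degree-zero
  components and the span of monomials in a coproduct.\<close>

lemma (in ring) ring_on_subgroup:
  assumes H: "additive_subgroup H R" and one: "\<one> \<in> H"
    and mult: "\<And>a b. a \<in> H \<Longrightarrow> b \<in> H \<Longrightarrow> a \<otimes> b \<in> H"
  shows "ring (R\<lparr>carrier := H\<rparr>)"
proof -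
  note c [simp] = additive_subgroup.a_Hcarr[OF H]
  have minus: "\<ominus> x \<in> H" if "x \<in> H" for x
    using subgroup.m_inv_closed[OF additive_subgroup.a_subgroup[OF H] that] by (simp add: a_inv_def)
  show ?thesis
  proof (rule ringI)
    show "abelian_group (R\<lparr>carrier := H\<rparr>)"
    proof (rule abelian_groupI)
      fix x assume x: "x \<in> carrier (R\<lparr>carrier := H\<rparr>)"
      then show "\<exists>y\<in>carrier (R\<lparr>carrier := H\<rparr>). y \<oplus>\<^bsub>R\<lparr>carrier := H\<rparr>\<^esub> x = \<zero>\<^bsub>R\<lparr>carrier := H\<rparr>\<^esub>"
        by (intro bexI[of _ "\<ominus> x"]) (auto simp: minus l_neg)
    qed (use additive_subgroup.a_closed[OF H] additive_subgroup.zero_closed[OF H] in \<open>auto simp: a_ac\<close>)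
    show "monoid (R\<lparr>carrier := H\<rparr>)"
      by (rule monoidI) (auto simp: one mult m_assoc)
  qed (auto simp: l_distr r_distr)
qed

lemma (in graded_ring) degree_zero_ring:
  assumes "\<one> \<in> Rg 0"
  shows "ring (degree_zero_ring R Rg)"
proof (rule ring_on_subgroup[OF _ assms])
  show "additive_subgroup (Rg 0) R" using grading by (simp add: is_grading_def)
  show "a \<otimes> b \<in> Rg 0" if "a \<in> Rg 0" "b \<in> Rg 0" for a b
    using graded_mult[OF that] by simp
qed

lemma (in strongly_graded_module) degree_zero_module:
  "left_module (degree_zero_ring R Rg) (M\<lparr>carrier := Mg 0\<rparr>)"
proof -
  interpret R0: ring "degree_zero_ring R Rg" by (rule degree_zero_ring[OF one_degree_zero])
  have M0: "abelian_group (M\<lparr>carrier := Mg 0\<rparr>)"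
  proof (rule abelian_groupI)
    fix x assume x: "x \<in> carrier (M\<lparr>carrier := Mg 0\<rparr>)"
    then show "\<exists>y\<in>carrier (M\<lparr>carrier := Mg 0\<rparr>). y \<oplus>\<^bsub>M\<lparr>carrier := Mg 0\<rparr>\<^esub> x = \<zero>\<^bsub>M\<lparr>carrier := Mg 0\<rparr>\<^esub>"
      by (intro bexI[of _ "\<ominus>\<^bsub>M\<^esub> x"]) (auto simp: MG.component_minus_closed M.l_neg)
  qed (auto simp: MG.component_add_closed M.a_ac)
  have "r \<odot>\<^bsub>M\<^esub> m \<in> Mg 0" if "r \<in> Rg 0" "m \<in> Mg 0" for r m
    using smult_graded[OF that] by simp
  then show ?thesis
    by (intro left_module.intro left_module_axioms.intro R0.ring_axioms M0)
      (auto simp: M.smult_l_distr M.smult_r_distr M.smult_assoc M.smult_one)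
qed

text \<open>The functionals preserve degrees and the basis elements have degree zero, so all terms
  of the expansion of an element of degree zero stay in degree zero.\<close>

lemma (in strongly_graded_module) degree_zero_dual_basis:
  assumes "dual_basis R M I p \<mu>" "\<And>l. l \<in> I \<Longrightarrow> p l \<in> Mg 0"
    "\<And>l \<gamma> x. l \<in> I \<Longrightarrow> x \<in> Mg \<gamma> \<Longrightarrow> \<mu> l x \<in> Rg \<gamma>"
  shows "dual_basis (degree_zero_ring R Rg) (M\<lparr>carrier := Mg 0\<rparr>) I p \<mu>"
proof -
  interpret D: dual_basis R M I p \<mu> by fact
  let ?R0 = "degree_zero_ring R Rg" and ?M0 = "M\<lparr>carrier := Mg 0\<rparr>"
  interpret M0: left_module ?R0 ?M0 by (rule degree_zero_module)
  have func: "functional ?R0 ?M0 (\<mu> l)" if l: "l \<in> I" for l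
    using D.functional[OF l] assms(3)[OF l]
    by (auto simp: functional_def hom_def)
  have incl: "(\<lambda>x. x) \<in> add_hom ?M0 M" by (rule add_homI) auto
  have sm: "\<mu> l x \<odot>\<^bsub>M\<^esub> p l \<in> Mg 0" if "l \<in> I" "x \<in> Mg 0" for l x
    using smult_graded[OF assms(3)[OF that] assms(2)[OF that(1)]] by simp
  have "x = (\<Oplus>\<^bsub>?M0\<^esub>l\<in>I. \<mu> l x \<odot>\<^bsub>?M0\<^esub> p l)" if x: "x \<in> carrier ?M0" for x
  proof -
    \<comment> \<open>\<open>finsum\<close> depends on the carrier of its record; the additive
      inclusion identifies the two sums.\<close>
    have "(\<Oplus>\<^bsub>?M0\<^esub>l\<in>I. \<mu> l x \<odot>\<^bsub>?M0\<^esub> p l) = (\<Oplus>\<^bsub>M\<^esub>l\<in>I. \<mu> l x \<odot>\<^bsub>M\<^esub> p l)"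
      using add_hom_finsum[OF M0.abelian_group_axioms M.abelian_group_axioms incl, of I "\<lambda>l. \<mu> l x \<odot>\<^bsub>M\<^esub> p l"]
        x sm by simp
    then show ?thesis using D.expansion[of x] x by simp
  qed
  then show ?thesis
    by (intro dual_basis.intro dual_basis_axioms.intro M0.left_module_axioms M0.R.ring_axioms)
      (use D.finite_I assms(2) func in auto)
qed

text \<open>A linear map is determined by its values on the unit vectors. Adding one coordinate at a
  time keeps all finite sums in \<open>P\<close>.\<close>

lemma free_module_hom_expansion:
  assumes R: "ring R" and P: "abelian_group P" and \<pi>: "\<pi> \<in> module_hom R (free_module R n) P"
    and x: "x \<in> carrier (free_module R n)"
  shows "\<pi> x = (\<Oplus>\<^bsub>P\<^esub>i\<in>{..<n}. x i \<odot>\<^bsub>P\<^esub> \<pi> (\<lambda>j\<in>{..<n}. if j = i then \<one>\<^bsub>R\<^esub> else \<zero>\<^bsub>R\<^esub>))"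
proof -
  interpret R: ring R by fact
  interpret P: abelian_group P by fact
  let ?F = "free_module R n"
  define e where "e i = (\<lambda>j\<in>{..<n}. if j = i then \<one>\<^bsub>R\<^esub> else \<zero>\<^bsub>R\<^esub>)" for i
  have F: "carrier ?F = {..<n} \<rightarrow>\<^sub>E carrier R" "y \<oplus>\<^bsub>?F\<^esub> z = (\<lambda>i\<in>{..<n}. y i \<oplus>\<^bsub>R\<^esub> z i)"
    "r \<odot>\<^bsub>?F\<^esub> y = (\<lambda>i\<in>{..<n}. r \<otimes>\<^bsub>R\<^esub> y i)" for y z r
    by (simp_all add: free_module_def)
  note \<pi>' = module_hom_add_hom[OF \<pi>]
  have xc: "x i \<in> carrier R" if "i < n" for i using x that by (auto simp: F)
  have ec: "e i \<in> carrier ?F" for i by (auto simp: F e_def)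
  \<comment> \<open>The vector that keeps the first k coordinates of x: zero for k = 0, and x itself
    for k = n.\<close>
  define tr where "tr k = (\<lambda>j\<in>{..<n}. if j < k then x j else \<zero>\<^bsub>R\<^esub>)" for k
  have trc: "tr k \<in> carrier ?F" for k using xc by (auto simp: F tr_def)
  have "\<pi> (tr k) = (\<Oplus>\<^bsub>P\<^esub>i\<in>{..<k}. x i \<odot>\<^bsub>P\<^esub> \<pi> (e i))" if "k \<le> n" for k
    using that
  proof (induction k)
    case 0
    have "tr 0 \<oplus>\<^bsub>?F\<^esub> tr 0 = tr 0" by (auto simp: F tr_def fun_eq_iff)
    then have "\<pi> (tr 0) \<oplus>\<^bsub>P\<^esub> \<pi> (tr 0) = \<pi> (tr 0)"
      using add_hom_add[OF \<pi>' trc trc, of 0 0] by simp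
    then show ?case
      using P.add.l_cancel_one[of "\<pi> (tr 0)" "\<pi> (tr 0)"] add_hom_closed[OF \<pi>' trc, of 0] by simp
  next
    case (Suc k)
    have *: "x i \<odot>\<^bsub>P\<^esub> \<pi> (e i) \<in> carrier P" if "i < n" for i
    proof -
      have "x i \<odot>\<^bsub>?F\<^esub> e i \<in> carrier ?F" using xc[OF that] by (auto simp: F e_def)
      then show ?thesis
        using module_hom_smult[OF \<pi> xc[OF that] ec, of i] add_hom_closed[OF \<pi>'] by metis
    qed
    have kF: "x k \<odot>\<^bsub>?F\<^esub> e k \<in> carrier ?F" using xc Suc.prems by (auto simp: F e_def)
    have "tr (Suc k) = x k \<odot>\<^bsub>?F\<^esub> e k \<oplus>\<^bsub>?F\<^esub> tr k"
      using xc Suc.prems by (auto simp: F tr_def e_def fun_eq_iff less_Suc_eq)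
    then have "\<pi> (tr (Suc k)) = x k \<odot>\<^bsub>P\<^esub> \<pi> (e k) \<oplus>\<^bsub>P\<^esub> \<pi> (tr k)"
      using add_hom_add[OF \<pi>' kF trc, of k] module_hom_smult[OF \<pi> xc ec, of k k] Suc.prems by simp
    then show ?case
      using Suc * by (simp add: lessThan_Suc Pi_def)
  qed
  moreover have "tr n = x" using x by (auto simp: F tr_def fun_eq_iff PiE_def extensional_def)
  ultimately show ?thesis by (auto simp: e_def)
qed

text \<open>
  Strong grading absorbs the shifts of a graded free module: a coordinate of degree \<open>d\<close> is split by
  a partition of unity \<open>1 = \<Sum> a\<^sub>s b\<^sub>s\<close> with \<open>a\<^sub>s\<close> of degree \<open>- d\<close> into coordinates of degree zero.
\<close>

lemma (in strongly_graded_module) ex_graded_dual_basis: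
  assumes P: "graded_fg_projective R Rg M Mg"
  obtains I :: "(nat \<times> nat) set" and p \<mu> where "dual_basis R M I p \<mu>"
    "\<And>l. l \<in> I \<Longrightarrow> p l \<in> Mg 0" "\<And>l \<gamma> x. l \<in> I \<Longrightarrow> x \<in> Mg \<gamma> \<Longrightarrow> \<mu> l x \<in> Rg \<gamma>"
proof -
  obtain n d \<iota> \<pi> where
    \<iota>: "\<iota> \<in> graded_module_hom R M Mg (free_module R n) (free_module_grading Rg n d)"
    and \<pi>: "\<pi> \<in> graded_module_hom R (free_module R n) (free_module_grading Rg n d) M Mg"
    and \<pi>\<iota>: "\<And>x. x \<in> carrier M \<Longrightarrow> \<pi> (\<iota> x) = x"
    using P unfolding graded_fg_projective_def by blast
  let ?F = "free_module R n"
  let ?e = "\<lambda>i. \<lambda>j\<in>{..<n}. if j = i then \<one> else \<zero>"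
  have F: "carrier ?F = {..<n} \<rightarrow>\<^sub>E carrier R" "y \<oplus>\<^bsub>?F\<^esub> z = (\<lambda>i\<in>{..<n}. y i \<oplus> z i)"
    "r \<odot>\<^bsub>?F\<^esub> y = (\<lambda>i\<in>{..<n}. r \<otimes> y i)" for y z r
    by (simp_all add: free_module_def)
  have \<iota>h: "\<iota> \<in> module_hom R M ?F" and \<pi>h: "\<pi> \<in> module_hom R ?F M"
    using \<iota> \<pi> by (auto simp: graded_module_hom_def)
  note \<iota>' = module_hom_add_hom[OF \<iota>h]
  have \<iota>c: "\<iota> x i \<in> carrier R" if "x \<in> carrier M" "i < n" for x i
    using add_hom_closed[OF \<iota>' that(1)] that(2) by (auto simp: F)
  have \<iota>g: "\<iota> x i \<in> Rg (\<gamma> + d i)" if "x \<in> Mg \<gamma>" "i < n" for x i \<gamma>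
  proof -
    have "\<iota> x \<in> free_module_grading Rg n d \<gamma>"
      using \<iota> that(1) by (auto simp: graded_module_hom_def)
    then show ?thesis using that(2) by (auto simp: free_module_grading_def)
  qed
  \<comment> \<open>The unit vector \<open>?e i\<close> has degree \<open>- d i\<close>: its nonzero
    entry 1 then has to lie in the component of degree - d i + d i = 0.\<close>
  have \<pi>g: "\<pi> (?e i) \<in> Mg (- d i)" if "i < n" for i
  proof -
    have "?e i \<in> free_module_grading Rg n d (- d i)"
      using one_degree_zero by (auto simp: free_module_grading_def)
    then show ?thesis using \<pi> by (auto simp: graded_module_hom_def)
  qed
  obtain k :: "'g \<Rightarrow> nat" and a' b' where
    ab': "\<And>\<gamma> s. s < k \<gamma> \<Longrightarrow> a' \<gamma> s \<in> Rg \<gamma>" "\<And>\<gamma> s. s < k \<gamma> \<Longrightarrow> b' \<gamma> s \<in> Rg (- \<gamma>)"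
    and one': "\<And>\<gamma>. \<one> = (\<Oplus>s\<in>{..<k \<gamma>}. a' \<gamma> s \<otimes> b' \<gamma> s)"
    using ex_partitions_of_unity[OF one_degree_zero] by blast
  \<comment> \<open>The degree \<open>- d i\<close> makes \<open>a i s\<close> cancel the shift in
    coordinate i of \<iota>(x), while \<open>b i s\<close> of degree \<open>d i\<close> lifts the
    image of the unit vector to degree zero.\<close>
  define N where "N i = k (- d i)" for i
  define a where "a i = a' (- d i)" for i
  define b where "b i = b' (- d i)" for i
  have ab: "\<And>i s. s < N i \<Longrightarrow> a i s \<in> Rg (- d i)" "\<And>i s. s < N i \<Longrightarrow> b i s \<in> Rg (d i)"
    using ab'(1)[of _ "- d _"] ab'(2)[of _ "- d _"] by (simp_all add: N_def a_def b_def)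
  have one: "\<And>i. \<one> = (\<Oplus>s\<in>{..<N i}. a i s \<otimes> b i s)"
    unfolding N_def a_def b_def by (rule one')
  have abc: "a i s \<in> carrier R" "b i s \<in> carrier R" if "s < N i" for i s
    using RG.component_closed[OF ab(1)[OF that]] RG.component_closed[OF ab(2)[OF that]] .
  define I where "I = Sigma {..<n} (\<lambda>i. {..<N i})"
  \<comment> \<open>The two factors of the partition are distributed: \<open>b i s\<close> goes to
    the basis element and \<open>a i s\<close> to the functional, on the right so that the
    functional stays left linear.\<close>
  define p where "p = (\<lambda>(i, s). b i s \<odot>\<^bsub>M\<^esub> \<pi> (?e i))"
  define \<mu> where "\<mu> = (\<lambda>(i, s) x. \<iota> x i \<otimes> a i s)"
  have I: "(i, s) \<in> I \<longleftrightarrow> i < n \<and> s < N i" for i s by (auto simp: I_def)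
  have finI: "finite I" by (simp add: I_def)
  have p0: "p l \<in> Mg 0" if "l \<in> I" for l
  proof -
    obtain i s where l: "l = (i, s)" "i < n" "s < N i" using \<open>l \<in> I\<close> by (cases l) (auto simp: I)
    show ?thesis
      using smult_graded[OF ab(2)[OF l(3)] \<pi>g[OF l(2)]] by (simp add: l(1) p_def)
  qed
  have \<mu>g: "\<mu> l x \<in> Rg \<gamma>" if "l \<in> I" "x \<in> Mg \<gamma>" for l x \<gamma>
  proof -
    obtain i s where l: "l = (i, s)" "i < n" "s < N i" using \<open>l \<in> I\<close> by (cases l) (auto simp: I)
    show ?thesis
      using graded_mult[OF \<iota>g[OF that(2) l(2)] ab(1)[OF l(3)]] by (simp add: l \<mu>_def)
  qed
  have func: "functional R M (\<mu> l)" if "l \<in> I" for l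
  proof -
    obtain i s where l: "l = (i, s)" "i < n" "s < N i" using \<open>l \<in> I\<close> by (cases l) (auto simp: I)
    show ?thesis
      unfolding functional_def
    proof (intro conjI ballI)
      show "\<mu> l \<in> add_hom M R"
        using l by (auto intro!: add_homI simp: \<mu>_def \<iota>c abc add_hom_add[OF \<iota>'] F l_distr)
      show "\<mu> l (r \<odot>\<^bsub>M\<^esub> x) = r \<otimes> \<mu> l x" if "r \<in> carrier R" "x \<in> carrier M" for r x
        using l that by (simp add: \<mu>_def \<iota>c abc module_hom_smult[OF \<iota>h] F m_assoc)
    qed
  qed
  have pc: "p l \<in> carrier M" if "l \<in> I" for l using p0[OF that] by simp
  have \<mu>c: "\<mu> l x \<in> carrier R" if "l \<in> I" "x \<in> carrier M" for l x
    using func[OF that(1)] add_hom_closed[of "\<mu> l" M R x] that by (simp add: functional_def)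
  have "x = (\<Oplus>\<^bsub>M\<^esub>l\<in>I. \<mu> l x \<odot>\<^bsub>M\<^esub> p l)" if x: "x \<in> carrier M" for x
  proof -
    have \<pi>c: "\<pi> (?e i) \<in> carrier M" if "i < n" for i using \<pi>g[OF that] by simp
    have "(\<Oplus>\<^bsub>M\<^esub>l\<in>I. \<mu> l x \<odot>\<^bsub>M\<^esub> p l) = (\<Oplus>\<^bsub>M\<^esub>i\<in>{..<n}. \<Oplus>\<^bsub>M\<^esub>s\<in>{..<N i}. \<mu> (i, s) x \<odot>\<^bsub>M\<^esub> p (i, s))"
      unfolding I_def using x
      by (intro M.finsum_Sigma) (auto intro!: M.smult_closed \<mu>c pc simp: I)
    \<comment> \<open>For fixed i the factors meet again, and the sum over s collapses by the
      partition of unity.\<close>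
    also have "\<dots> = (\<Oplus>\<^bsub>M\<^esub>i\<in>{..<n}. \<iota> x i \<odot>\<^bsub>M\<^esub> \<pi> (?e i))"
    proof (intro M.finsum_cong' refl)
      fix i assume "i \<in> {..<n}"
      then have i: "i < n" by simp
      have "(\<Oplus>\<^bsub>M\<^esub>s\<in>{..<N i}. \<mu> (i, s) x \<odot>\<^bsub>M\<^esub> p (i, s)) =
          (\<Oplus>\<^bsub>M\<^esub>s\<in>{..<N i}. \<iota> x i \<odot>\<^bsub>M\<^esub> ((a i s \<otimes> b i s) \<odot>\<^bsub>M\<^esub> \<pi> (?e i)))"
        using i x by (intro M.finsum_cong' refl)
          (auto simp: \<mu>_def p_def \<iota>c abc \<pi>c M.smult_assoc M.smult_closed)
      also have "\<dots> = \<iota> x i \<odot>\<^bsub>M\<^esub> (\<Oplus>\<^bsub>M\<^esub>s\<in>{..<N i}. (a i s \<otimes> b i s) \<odot>\<^bsub>M\<^esub> \<pi> (?e i))"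
        using i x by (intro add_hom_finsum[symmetric, OF M.abelian_group_axioms M.abelian_group_axioms
              M.smult_add_hom_right]) (auto simp: \<iota>c abc \<pi>c M.smult_closed)
      also have "(\<Oplus>\<^bsub>M\<^esub>s\<in>{..<N i}. (a i s \<otimes> b i s) \<odot>\<^bsub>M\<^esub> \<pi> (?e i)) = (\<Oplus>s\<in>{..<N i}. a i s \<otimes> b i s) \<odot>\<^bsub>M\<^esub> \<pi> (?e i)"
        using i by (intro add_hom_finsum[symmetric, OF abelian_group_axioms M.abelian_group_axioms
              M.smult_add_hom_left]) (auto simp: abc \<pi>c)
      also have "\<dots> = \<pi> (?e i)"
        using \<pi>c[OF i] by (simp only: one[symmetric] M.smult_one)
      finally show "(\<Oplus>\<^bsub>M\<^esub>s\<in>{..<N i}. \<mu> (i, s) x \<odot>\<^bsub>M\<^esub> p (i, s)) = \<iota> x i \<odot>\<^bsub>M\<^esub> \<pi> (?e i)" .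
    qed (use x in \<open>auto simp: \<iota>c \<pi>c M.smult_closed\<close>)
    also have "\<dots> = \<pi> (\<iota> x)"
      using free_module_hom_expansion[OF ring_axioms M.abelian_group_axioms \<pi>h add_hom_closed[OF \<iota>' x]] by simp
    finally show ?thesis using \<pi>\<iota>[OF x] by simp
  qed
  then have "dual_basis R M I p \<mu>"
    by (intro dual_basis.intro dual_basis_axioms.intro M.left_module_axioms ring_axioms finI pc func)
  then show thesis using that p0 \<mu>g by blast
qed

lemma additive_subgroup_generate:
  assumes "abelian_group A" "H \<subseteq> carrier A"
  shows "additive_subgroup (generate (add_monoid A) H) A"
proof -
  interpret abelian_group A by fact
  show ?thesis
    using group.generate_is_subgroup[OF a_group, of H] assms(2) by (simp add: additive_subgroup_def)
qed

section \<open>Graded homomorphisms in coordinates\<close>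

locale graded_coordinates = strongly_graded_module R Rg M Mg + P: strongly_graded_module R Rg P Pg +
  dual_basis R P I p \<mu>
  for R :: "('r, 'x) ring_scheme" (structure) and Rg :: "'g::ab_group_add \<Rightarrow> 'r set"
    and M :: "('r, 'm, 'y) module_scheme" and Mg
    and P :: "('r, 'p, 'z) module_scheme" and Pg and I :: "'i set" and p \<mu> +
  assumes p_degree_zero: "l \<in> I \<Longrightarrow> p l \<in> Pg 0"
    and \<mu>_graded: "l \<in> I \<Longrightarrow> x \<in> Pg \<gamma> \<Longrightarrow> \<mu> l x \<in> Rg \<gamma>"
begin

text \<open>1 \<otimes> m has degree \<gamma>, g preserves degrees, and so does T \<otimes> \<mu> l
  because \<open>\<mu> l\<close> does; the last point is checked on the generators of a
  component.\<close>

lemma coordinates_graded: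
  assumes T: "graded_ring T Tg" and \<tau>: "\<tau> \<in> ring_hom R T" "\<And>\<gamma>. \<tau> ` Rg \<gamma> \<subseteq> Tg \<gamma>"
    and g: "g \<in> graded_module_hom T (tensor R T \<tau> M) (tensor_grading R T Tg \<tau> M Mg)
      (tensor R T \<tau> P) (tensor_grading R T Tg \<tau> P Pg)"
    and l: "l \<in> I" and m: "m \<in> Mg \<gamma>"
  shows "coordinates R M P \<mu> T \<tau> g l m \<in> Tg \<gamma>"
proof -
  interpret T: graded_ring T Tg by fact
  interpret TG: graded_group T Tg by (rule T.graded_group)
  interpret PT: scalar_extension R T P \<tau> by unfold_locales fact
  interpret MT: scalar_extension R T M \<tau> by unfold_locales fact
  interpret PT: extended_dual_basis R P I p \<mu> T \<tau> by unfold_locales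
  have T1: "\<one>\<^bsub>T\<^esub> \<in> Tg 0" using one_degree_zero \<tau>(2)[of 0] ring_hom_one[OF \<tau>(1)] by force
  have "MT.pt \<one>\<^bsub>T\<^esub> m \<in> tensor_grading R T Tg \<tau> M Mg \<gamma>"
    unfolding tensor_grading_def by (rule generate.incl) (use T1 m in force)
  then have "g (MT.pt \<one>\<^bsub>T\<^esub> m) \<in> tensor_grading R T Tg \<tau> P Pg \<gamma>"
    using g by (auto simp: graded_module_hom_def)
  moreover
  let ?H = "{PT.pt t n | t n. \<exists>\<alpha> \<beta>. t \<in> Tg \<alpha> \<and> n \<in> Pg \<beta> \<and> \<alpha> + \<beta> = \<gamma>}"
  have H: "?H \<subseteq> carrier PT.X" by auto
  have "PT.coef l y \<in> Tg \<gamma>" if "y \<in> tensor_grading R T Tg \<tau> P Pg \<gamma>" for y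
    using that H unfolding tensor_grading_def
  proof (induction rule: PT.X.generate_add_induct)
    show "PT.coef l \<zero>\<^bsub>PT.X\<^esub> \<in> Tg \<gamma>"
      using add_hom_zero[OF PT.X.abelian_group_axioms T.abelian_group_axioms PT.coef_add_hom[OF l]] by simp
    fix h assume h: "h \<in> ?H"
    then obtain t n \<alpha> \<beta> where tn: "h = PT.pt t n" "t \<in> Tg \<alpha>" "n \<in> Pg \<beta>" "\<alpha> + \<beta> = \<gamma>" by blast
    show "PT.coef l h \<in> Tg \<gamma>"
      using T.graded_mult[OF tn(2), of "\<tau> (\<mu> l n)" \<beta>] \<tau>(2)[of \<beta>] \<mu>_graded[OF l tn(3)] tn l
      by (auto simp: PT.coef_pt)
    then show "PT.coef l (\<ominus>\<^bsub>PT.X\<^esub> h) \<in> Tg \<gamma>"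
      using add_hom_minus[OF PT.X.abelian_group_axioms T.abelian_group_axioms PT.coef_add_hom[OF l]] h H
      by (auto intro: TG.component_minus_closed)
  next
    fix x y assume "x \<in> carrier PT.X" "y \<in> carrier PT.X" "PT.coef l x \<in> Tg \<gamma>" "PT.coef l y \<in> Tg \<gamma>"
    then show "PT.coef l (x \<oplus>\<^bsub>PT.X\<^esub> y) \<in> Tg \<gamma>"
      by (simp add: add_hom_add[OF PT.coef_add_hom[OF l]] TG.component_add_closed)
  qed
  ultimately show ?thesis by (simp add: coordinates_def)
qed

text \<open>The formula for g on pure tensors ends in \<open>p l\<close> of degree zero, so the
  degree of its value is that of t times the coordinate of m.\<close>

lemma ex_graded_hom_with_coordinates:
  assumes T: "graded_ring T Tg" and \<tau>: "\<tau> \<in> ring_hom R T" "\<And>\<gamma>. \<tau> ` Rg \<gamma> \<subseteq> Tg \<gamma>"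
    and G: "coordinate_family R M I p \<mu> T \<tau> G" "\<And>l \<gamma> m. l \<in> I \<Longrightarrow> m \<in> Mg \<gamma> \<Longrightarrow> G l m \<in> Tg \<gamma>"
  obtains g where "g \<in> graded_module_hom T (tensor R T \<tau> M) (tensor_grading R T Tg \<tau> M Mg)
      (tensor R T \<tau> P) (tensor_grading R T Tg \<tau> P Pg)"
    "\<And>l m. l \<in> I \<Longrightarrow> m \<in> carrier M \<Longrightarrow> coordinates R M P \<mu> T \<tau> g l m = G l m"
proof -
  interpret T: graded_ring T Tg by fact
  interpret TG: graded_group T Tg by (rule T.graded_group)
  interpret PT: scalar_extension R T P \<tau> by unfold_locales fact
  interpret MT: scalar_extension R T M \<tau> by unfold_locales fact
  interpret PT: extended_dual_basis R P I p \<mu> T \<tau> by unfold_locales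
  obtain g where g: "g \<in> module_hom T MT.X PT.X"
    and gt: "\<And>t m. t \<in> carrier T \<Longrightarrow> m \<in> carrier M \<Longrightarrow> g (MT.pt t m) = (\<Oplus>\<^bsub>PT.X\<^esub>l\<in>I. PT.pt (t \<otimes>\<^bsub>T\<^esub> G l m) (p l))"
    and gc: "\<And>l m. l \<in> I \<Longrightarrow> m \<in> carrier M \<Longrightarrow> coordinates R M P \<mu> T \<tau> g l m = G l m"
    using PT.ex_hom_with_coordinates[OF M.left_module_axioms G(1)] by blast
  note g' = module_hom_add_hom[OF g]
  have "g y \<in> tensor_grading R T Tg \<tau> P Pg \<gamma>" if "y \<in> tensor_grading R T Tg \<tau> M Mg \<gamma>" for y \<gamma>
  proof -
    let ?H = "{MT.pt t n | t n. \<exists>\<alpha> \<beta>. t \<in> Tg \<alpha> \<and> n \<in> Mg \<beta> \<and> \<alpha> + \<beta> = \<gamma>}"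
    let ?K = "{PT.pt t n | t n. \<exists>\<alpha> \<beta>. t \<in> Tg \<alpha> \<and> n \<in> Pg \<beta> \<and> \<alpha> + \<beta> = \<gamma>}"
    let ?L = "tensor_grading R T Tg \<tau> P Pg \<gamma>"
    have H: "?H \<subseteq> carrier MT.X" and K: "?K \<subseteq> carrier PT.X" by auto
    have L: "subgroup ?L (add_monoid PT.X)"
      unfolding tensor_grading_def
      using group.generate_is_subgroup[OF PT.X.a_group, of ?K] K by simp
    note Lz = subgroup.one_closed[OF L, simplified] and La = subgroup.m_closed[OF L, simplified]
    have Lm: "\<ominus>\<^bsub>PT.X\<^esub> z \<in> ?L" if "z \<in> ?L" for z
      using subgroup.m_inv_closed[OF L that] by (simp add: a_inv_def)
    have Ls: "finsum PT.X c J \<in> ?L" if "finite J" "\<And>j. j \<in> J \<Longrightarrow> c j \<in> ?L" for c and J :: "'i set"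
      using that
    proof (induction J)
      case (insert j J)
      then have "c j \<in> carrier PT.X" "\<And>j. j \<in> J \<Longrightarrow> c j \<in> carrier PT.X"
        using subgroup.mem_carrier[OF L] by auto
      then show ?case using insert by (subst PT.X.finsum_insert) (auto intro: La)
    qed (simp add: Lz)
    show ?thesis
      using \<open>y \<in> _\<close> H unfolding tensor_grading_def[of R T Tg \<tau> M Mg \<gamma>]
    proof (induction rule: MT.X.generate_add_induct)
      case zero
      show ?case
        using add_hom_zero[OF MT.X.abelian_group_axioms PT.X.abelian_group_axioms g'] Lz by simp
    next
      case (incl h)
      then obtain t n \<alpha> \<beta> where tn: "h = MT.pt t n" "t \<in> Tg \<alpha>" "n \<in> Mg \<beta>" "\<alpha> + \<beta> = \<gamma>" by blast
      have "PT.pt (t \<otimes>\<^bsub>T\<^esub> G l n) (p l) \<in> ?L" if l: "l \<in> I" for l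
        unfolding tensor_grading_def
        using T.graded_mult[OF tn(2) G(2)[OF l tn(3)]] p_degree_zero[OF l] tn(4)
        by - (rule generate.incl, rule CollectI, rule exI, rule exI, rule conjI, rule refl,
          rule exI[of _ \<gamma>], rule exI[of _ 0], simp)
      then show ?case
        using tn by (simp add: gt) (rule Ls[OF finite_I])
    next
      case (minus h)
      then show ?case
        using add_hom_minus[OF MT.X.abelian_group_axioms PT.X.abelian_group_axioms g'] H Lm by auto
    next
      case (add x y)
      then show ?case by (simp add: add_hom_add[OF g'] La)
    qed
  qed
  then have "g \<in> graded_module_hom T MT.X (tensor_grading R T Tg \<tau> M Mg) PT.X (tensor_grading R T Tg \<tau> P Pg)"
    using g by (auto simp: graded_module_hom_def)
  then show thesis using that gc by blast
qed

end

section \<open>The group algebra\<close>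

text \<open>The monomial with coefficient \<open>c\<close> at the group element \<gamma>.\<close>

definition single :: "('a, 'x) ring_scheme \<Rightarrow> 'g \<Rightarrow> 'a \<Rightarrow> 'g \<Rightarrow> 'a" where
  "single A \<gamma> c = (\<lambda>\<delta>. if \<delta> = \<gamma> then c else \<zero>\<^bsub>A\<^esub>)"

text \<open>Finitely supported functions with convolution, where the sum runs over the support of
  the left factor only. Plain functions are used so that the ring lives in the type
  \<open>'g \<Rightarrow> 'a\<close>, available as a test type.\<close>

definition group_algebra :: "('a, 'x) ring_scheme \<Rightarrow> ('g::ab_group_add \<Rightarrow> 'a) ring" where
  "group_algebra A =
     \<lparr>carrier = {f. (\<forall>\<gamma>. f \<gamma> \<in> carrier A) \<and> finite {\<gamma>. f \<gamma> \<noteq> \<zero>\<^bsub>A\<^esub>}},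
      monoid.mult = (\<lambda>f g \<gamma>. \<Oplus>\<^bsub>A\<^esub>\<alpha>\<in>{\<alpha>. f \<alpha> \<noteq> \<zero>\<^bsub>A\<^esub>}. f \<alpha> \<otimes>\<^bsub>A\<^esub> g (\<gamma> - \<alpha>)),
      one = single A 0 \<one>\<^bsub>A\<^esub>, ring.zero = (\<lambda>_. \<zero>\<^bsub>A\<^esub>), ring.add = (\<lambda>f g \<gamma>. f \<gamma> \<oplus>\<^bsub>A\<^esub> g \<gamma>)\<rparr>"

lemma group_algebra_simps:
  "f \<in> carrier (group_algebra A) \<longleftrightarrow> (\<forall>\<gamma>. f \<gamma> \<in> carrier A) \<and> finite {\<gamma>. f \<gamma> \<noteq> \<zero>\<^bsub>A\<^esub>}"
  "\<one>\<^bsub>group_algebra A\<^esub> = single A 0 \<one>\<^bsub>A\<^esub>"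
  "\<zero>\<^bsub>group_algebra A\<^esub> = (\<lambda>_. \<zero>\<^bsub>A\<^esub>)"
  "f \<oplus>\<^bsub>group_algebra A\<^esub> g = (\<lambda>\<gamma>. f \<gamma> \<oplus>\<^bsub>A\<^esub> g \<gamma>)"
  by (simp_all add: group_algebra_def)

context ring
begin

text \<open>Frees the convolution from the exact support, so that products with different left
  factors can be compared over one index set.\<close>

lemma group_algebra_mult:
  assumes f: "f \<in> carrier (group_algebra R)" and g: "g \<in> carrier (group_algebra R)"
    and F: "finite F" "{\<alpha>. f \<alpha> \<noteq> \<zero>} \<subseteq> F"
  shows "(f \<otimes>\<^bsub>group_algebra R\<^esub> g) \<gamma> = (\<Oplus>\<alpha>\<in>F. f \<alpha> \<otimes> g (\<gamma> - \<alpha>))"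
proof -
  have "f \<alpha> \<in> carrier R" "g \<alpha> \<in> carrier R" for \<alpha> using f g by (simp_all add: group_algebra_simps)
  then show ?thesis
    using F unfolding group_algebra_def
    by simp (rule finsum_subset[symmetric], auto)
qed

lemma single_closed: "c \<in> carrier R \<Longrightarrow> single R \<gamma> c \<in> carrier (group_algebra R)"
proof -
  have "{\<delta>. single R \<gamma> c \<delta> \<noteq> \<zero>} \<subseteq> {\<gamma>}" by (auto simp: single_def)
  then show "c \<in> carrier R \<Longrightarrow> single R \<gamma> c \<in> carrier (group_algebra R)"
    using finite_subset[of _ "{\<gamma>}"] by (auto simp: group_algebra_simps single_def)
qed

lemma single_add:
  "c \<in> carrier R \<Longrightarrow> d \<in> carrier R \<Longrightarrow>
    single R \<gamma> (c \<oplus> d) = single R \<gamma> c \<oplus>\<^bsub>group_algebra R\<^esub> single R \<gamma> d"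
  by (auto simp: group_algebra_simps single_def)

lemma single_mult_left:
  assumes "c \<in> carrier R" "f \<in> carrier (group_algebra R)"
  shows "single R \<alpha> c \<otimes>\<^bsub>group_algebra R\<^esub> f = (\<lambda>\<gamma>. c \<otimes> f (\<gamma> - \<alpha>))"
proof
  fix \<gamma>
  have "(single R \<alpha> c \<otimes>\<^bsub>group_algebra R\<^esub> f) \<gamma> = (\<Oplus>\<delta>\<in>{\<alpha>}. single R \<alpha> c \<delta> \<otimes> f (\<gamma> - \<delta>))"
    by (rule group_algebra_mult) (use assms single_closed in \<open>auto simp: single_def\<close>)
  then show "(single R \<alpha> c \<otimes>\<^bsub>group_algebra R\<^esub> f) \<gamma> = c \<otimes> f (\<gamma> - \<alpha>)"
    using assms by (simp add: single_def group_algebra_simps Pi_def)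
qed

lemma single_mult:
  assumes "c \<in> carrier R" "d \<in> carrier R"
  shows "single R \<alpha> c \<otimes>\<^bsub>group_algebra R\<^esub> single R \<beta> d = single R (\<alpha> + \<beta>) (c \<otimes> d)"
  unfolding single_mult_left[OF assms(1) single_closed[OF assms(2)]]
  using assms by (auto simp: single_def fun_eq_iff algebra_simps)

text \<open>The case of degree zero on the right gives the right unit law, and later the centrality
  of the scalars.\<close>

lemma mult_single_zero:
  assumes f: "f \<in> carrier (group_algebra R)" and d: "d \<in> carrier R"
  shows "f \<otimes>\<^bsub>group_algebra R\<^esub> single R 0 d = (\<lambda>\<gamma>. f \<gamma> \<otimes> d)"
proof
  fix \<gamma>
  have c: "f \<alpha> \<in> carrier R" for \<alpha> using f by (simp add: group_algebra_simps)
  let ?F = "insert \<gamma> {\<gamma>. f \<gamma> \<noteq> \<zero>}"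
  have F: "finite ?F" using f by (simp add: group_algebra_simps)
  have "(f \<otimes>\<^bsub>group_algebra R\<^esub> single R 0 d) \<gamma> = (\<Oplus>\<alpha>\<in>?F. f \<alpha> \<otimes> single R 0 d (\<gamma> - \<alpha>))"
    by (rule group_algebra_mult[OF f single_closed[OF d] F]) auto
  also have "\<dots> = (\<Oplus>\<alpha>\<in>?F. if \<alpha> = \<gamma> then f \<gamma> \<otimes> d else \<zero>)"
    using c d by (intro finsum_cong' refl) (auto simp: single_def)
  also have "\<dots> = f \<gamma> \<otimes> d"
    using c d F by (intro finsum_single_term) auto
  finally show "(f \<otimes>\<^bsub>group_algebra R\<^esub> single R 0 d) \<gamma> = f \<gamma> \<otimes> d" .
qed

text \<open>The support of a product lies in the finite set of sums of degrees from the two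
  supports.\<close>

lemma group_algebra_mult_closed:
  assumes f: "f \<in> carrier (group_algebra R)" and g: "g \<in> carrier (group_algebra R)"
  shows "f \<otimes>\<^bsub>group_algebra R\<^esub> g \<in> carrier (group_algebra R)"
proof -
  let ?A = "{\<gamma>. f \<gamma> \<noteq> \<zero>}" and ?B = "{\<gamma>. g \<gamma> \<noteq> \<zero>}"
  have c: "f \<alpha> \<in> carrier R" "g \<alpha> \<in> carrier R" for \<alpha> using f g by (simp_all add: group_algebra_simps)
  have fin: "finite ?A" "finite ?B" using f g by (simp_all add: group_algebra_simps)
  have eq: "(f \<otimes>\<^bsub>group_algebra R\<^esub> g) \<gamma> = (\<Oplus>\<alpha>\<in>?A. f \<alpha> \<otimes> g (\<gamma> - \<alpha>))" for \<gamma>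
    by (rule group_algebra_mult[OF f g fin(1)]) simp
  have "{\<gamma>. (f \<otimes>\<^bsub>group_algebra R\<^esub> g) \<gamma> \<noteq> \<zero>} \<subseteq> (\<lambda>(\<alpha>, \<beta>). \<alpha> + \<beta>) ` (?A \<times> ?B)"
  proof (rule subsetI, rule ccontr)
    fix \<gamma> assume \<gamma>: "\<gamma> \<in> {\<gamma>. (f \<otimes>\<^bsub>group_algebra R\<^esub> g) \<gamma> \<noteq> \<zero>}" "\<gamma> \<notin> (\<lambda>(\<alpha>, \<beta>). \<alpha> + \<beta>) ` (?A \<times> ?B)"
    have "g (\<gamma> - \<alpha>) = \<zero>" if "\<alpha> \<in> ?A" for \<alpha>
    proof (rule ccontr)
      assume "g (\<gamma> - \<alpha>) \<noteq> \<zero>"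
      then have "(\<alpha>, \<gamma> - \<alpha>) \<in> ?A \<times> ?B" using that by simp
      then have "\<alpha> + (\<gamma> - \<alpha>) \<in> (\<lambda>(\<alpha>, \<beta>). \<alpha> + \<beta>) ` (?A \<times> ?B)" by (rule rev_image_eqI) simp
      then show False using \<gamma>(2) by simp
    qed
    then have "(\<Oplus>\<alpha>\<in>?A. f \<alpha> \<otimes> g (\<gamma> - \<alpha>)) = (\<Oplus>\<alpha>\<in>?A. \<zero>)"
      by (intro finsum_cong' refl) (auto simp: c)
    then show False using \<gamma>(1) eq[of \<gamma>] by simp
  qed
  then have "finite {\<gamma>. (f \<otimes>\<^bsub>group_algebra R\<^esub> g) \<gamma> \<noteq> \<zero>}"
    by (rule finite_subset) (use fin in blast)
  moreover have "(f \<otimes>\<^bsub>group_algebra R\<^esub> g) \<gamma> \<in> carrier R" for \<gamma>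
    unfolding eq by (auto intro!: finsum_closed simp: c)
  ultimately show ?thesis by (simp add: group_algebra_simps)
qed

text \<open>Both sides are double sums of f(\<alpha>) g(\<xi> - \<alpha>) h(\<gamma> - \<xi>):
  interchange the summations and substitute \<xi> = \<alpha> + \<beta>.\<close>

lemma group_algebra_assoc:
  assumes f: "f \<in> carrier (group_algebra R)" and g: "g \<in> carrier (group_algebra R)"
    and h: "h \<in> carrier (group_algebra R)"
  shows "f \<otimes>\<^bsub>group_algebra R\<^esub> g \<otimes>\<^bsub>group_algebra R\<^esub> h = f \<otimes>\<^bsub>group_algebra R\<^esub> (g \<otimes>\<^bsub>group_algebra R\<^esub> h)"
proof
  fix \<gamma>
  let ?A = "{\<gamma>. f \<gamma> \<noteq> \<zero>}" and ?B = "{\<gamma>. g \<gamma> \<noteq> \<zero>}" and ?fg = "f \<otimes>\<^bsub>group_algebra R\<^esub> g"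
  have c: "f \<alpha> \<in> carrier R" "g \<alpha> \<in> carrier R" "h \<alpha> \<in> carrier R" for \<alpha>
    using f g h by (simp_all add: group_algebra_simps)
  have fin: "finite ?A" "finite ?B" "finite {\<gamma>. ?fg \<gamma> \<noteq> \<zero>}"
    using f g group_algebra_mult_closed[OF f g] by (simp_all add: group_algebra_simps)
  \<comment> \<open>Large enough for both ends: it contains the support of the product of f and g,
    and every translate of the support of g by a degree of f, as the substitution requires.\<close>
  define X where "X = (\<lambda>(\<alpha>, \<beta>). \<alpha> + \<beta>) ` (?A \<times> ?B) \<union> {\<gamma>. ?fg \<gamma> \<noteq> \<zero>}"
  have X: "finite X" using fin by (simp add: X_def)
  have "(?fg \<otimes>\<^bsub>group_algebra R\<^esub> h) \<gamma> = (\<Oplus>\<xi>\<in>X. ?fg \<xi> \<otimes> h (\<gamma> - \<xi>))"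
    by (rule group_algebra_mult[OF group_algebra_mult_closed[OF f g] h X]) (simp add: X_def)
  also have "\<dots> = (\<Oplus>\<xi>\<in>X. \<Oplus>\<alpha>\<in>?A. f \<alpha> \<otimes> (g (\<xi> - \<alpha>) \<otimes> h (\<gamma> - \<xi>)))"
  proof (intro finsum_cong' refl)
    fix \<xi>
    have "?fg \<xi> \<otimes> h (\<gamma> - \<xi>) = (\<Oplus>\<alpha>\<in>?A. f \<alpha> \<otimes> g (\<xi> - \<alpha>) \<otimes> h (\<gamma> - \<xi>))"
      using c fin(1) by (subst group_algebra_mult[OF f g fin(1)]) (auto intro!: finsum_ldistr)
    then show "?fg \<xi> \<otimes> h (\<gamma> - \<xi>) = (\<Oplus>\<alpha>\<in>?A. f \<alpha> \<otimes> (g (\<xi> - \<alpha>) \<otimes> h (\<gamma> - \<xi>)))"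
      by (simp add: m_assoc c)
  qed (auto intro!: finsum_closed simp: c)
  also have "\<dots> = (\<Oplus>\<alpha>\<in>?A. \<Oplus>\<xi>\<in>X. f \<alpha> \<otimes> (g (\<xi> - \<alpha>) \<otimes> h (\<gamma> - \<xi>)))"
    by (rule finsum_swap[OF X fin(1)]) (simp add: c)
  also have "\<dots> = (\<Oplus>\<alpha>\<in>?A. f \<alpha> \<otimes> (g \<otimes>\<^bsub>group_algebra R\<^esub> h) (\<gamma> - \<alpha>))"
  proof (intro finsum_cong' refl)
    fix \<alpha> assume \<alpha>: "\<alpha> \<in> ?A"
    have sub: "(+) \<alpha> ` ?B \<subseteq> X" using \<alpha> by (auto simp: X_def image_iff)
    have "(\<Oplus>\<xi>\<in>X. f \<alpha> \<otimes> (g (\<xi> - \<alpha>) \<otimes> h (\<gamma> - \<xi>))) = f \<alpha> \<otimes> (\<Oplus>\<xi>\<in>X. g (\<xi> - \<alpha>) \<otimes> h (\<gamma> - \<xi>))"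
      using X by (intro finsum_rdistr[symmetric]) (auto simp: c)
    also have "(\<Oplus>\<xi>\<in>X. g (\<xi> - \<alpha>) \<otimes> h (\<gamma> - \<xi>)) = (\<Oplus>\<xi>\<in>(+) \<alpha> ` ?B. g (\<xi> - \<alpha>) \<otimes> h (\<gamma> - \<xi>))"
    proof (rule finsum_subset[OF X sub])
      fix \<xi> assume "\<xi> \<in> X - (+) \<alpha> ` ?B"
      then have "g (\<xi> - \<alpha>) = \<zero>" using rev_image_eqI[of "\<xi> - \<alpha>" ?B \<xi> "(+) \<alpha>"] by auto
      then show "g (\<xi> - \<alpha>) \<otimes> h (\<gamma> - \<xi>) = \<zero>" by (simp add: c)
    qed (simp add: c)
    also have "\<dots> = (\<Oplus>\<beta>\<in>?B. g (\<alpha> + \<beta> - \<alpha>) \<otimes> h (\<gamma> - (\<alpha> + \<beta>)))"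
      by (rule finsum_reindex) (auto simp: c)
    also have "\<dots> = (g \<otimes>\<^bsub>group_algebra R\<^esub> h) (\<gamma> - \<alpha>)"
      using group_algebra_mult[OF g h fin(2), of "\<gamma> - \<alpha>"] by (simp add: algebra_simps)
    finally show "(\<Oplus>\<xi>\<in>X. f \<alpha> \<otimes> (g (\<xi> - \<alpha>) \<otimes> h (\<gamma> - \<xi>))) = f \<alpha> \<otimes> (g \<otimes>\<^bsub>group_algebra R\<^esub> h) (\<gamma> - \<alpha>)" .
  qed (use group_algebra_mult_closed[OF g h] in \<open>auto simp: c group_algebra_simps\<close>)
  also have "\<dots> = (f \<otimes>\<^bsub>group_algebra R\<^esub> (g \<otimes>\<^bsub>group_algebra R\<^esub> h)) \<gamma>"
    by (rule group_algebra_mult[OF f group_algebra_mult_closed[OF g h] fin(1), symmetric]) simp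
  finally show "(?fg \<otimes>\<^bsub>group_algebra R\<^esub> h) \<gamma> = (f \<otimes>\<^bsub>group_algebra R\<^esub> (g \<otimes>\<^bsub>group_algebra R\<^esub> h)) \<gamma>" .
qed

lemma group_algebra_ring: "ring (group_algebra R :: ('g::ab_group_add \<Rightarrow> 'a) ring)"
proof (rule ringI)
  let ?C = "group_algebra R :: ('g \<Rightarrow> 'a) ring"
  have add: "f \<oplus>\<^bsub>?C\<^esub> g \<in> carrier ?C" if fg: "f \<in> carrier ?C" "g \<in> carrier ?C" for f g
  proof -
    have "{\<gamma>. f \<gamma> \<oplus> g \<gamma> \<noteq> \<zero>} \<subseteq> {\<gamma>. f \<gamma> \<noteq> \<zero>} \<union> {\<gamma>. g \<gamma> \<noteq> \<zero>}"
      by auto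
    then show ?thesis
      using fg by (auto simp: group_algebra_simps intro: finite_subset)
  qed
  show "abelian_group ?C"
  proof (rule abelian_groupI)
    fix f assume f: "f \<in> carrier ?C"
    have "{\<gamma>. \<ominus> f \<gamma> \<noteq> \<zero>} \<subseteq> {\<gamma>. f \<gamma> \<noteq> \<zero>}" by auto
    then have "(\<lambda>\<gamma>. \<ominus> f \<gamma>) \<in> carrier ?C"
      using f by (auto simp: group_algebra_simps intro: finite_subset)
    then show "\<exists>g\<in>carrier ?C. g \<oplus>\<^bsub>?C\<^esub> f = \<zero>\<^bsub>?C\<^esub>"
      using f by (intro bexI[of _ "\<lambda>\<gamma>. \<ominus> f \<gamma>"]) (auto simp: group_algebra_simps l_neg)
  qed (use add in \<open>auto simp: group_algebra_simps a_ac\<close>)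
  have one: "\<one>\<^bsub>?C\<^esub> = single R 0 \<one>" by (simp add: group_algebra_simps)
  have fin_supp: "finite {\<gamma>. f \<gamma> \<noteq> \<zero>}" and cl: "\<And>\<gamma>. f \<gamma> \<in> carrier R" if "f \<in> carrier ?C" for f
    using that by (simp_all add: group_algebra_simps)
  show "monoid ?C"
  proof (rule monoidI)
    fix f assume f: "f \<in> carrier ?C"
    show "\<one>\<^bsub>?C\<^esub> \<otimes>\<^bsub>?C\<^esub> f = f"
      unfolding one using f by (subst single_mult_left) (auto simp: group_algebra_simps)
    show "f \<otimes>\<^bsub>?C\<^esub> \<one>\<^bsub>?C\<^esub> = f"
      unfolding one using f by (subst mult_single_zero) (auto simp: group_algebra_simps)
  qed (auto simp: one single_closed group_algebra_mult_closed group_algebra_assoc)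
  fix f g h assume f: "f \<in> carrier ?C" and g: "g \<in> carrier ?C" and h: "h \<in> carrier ?C"
  note c = cl[OF f] cl[OF g] cl[OF h]
  \<comment> \<open>The left factors f, g and their sum have different supports; all three
    convolutions are taken over the union.\<close>
  let ?F = "{\<gamma>. f \<gamma> \<noteq> \<zero>} \<union> {\<gamma>. g \<gamma> \<noteq> \<zero>}"
  have F: "finite ?F" using fin_supp f g by auto
  show "(f \<oplus>\<^bsub>?C\<^esub> g) \<otimes>\<^bsub>?C\<^esub> h = f \<otimes>\<^bsub>?C\<^esub> h \<oplus>\<^bsub>?C\<^esub> g \<otimes>\<^bsub>?C\<^esub> h"
  proof
    fix \<gamma>
    have "((f \<oplus>\<^bsub>?C\<^esub> g) \<otimes>\<^bsub>?C\<^esub> h) \<gamma> = (\<Oplus>\<alpha>\<in>?F. (f \<oplus>\<^bsub>?C\<^esub> g) \<alpha> \<otimes> h (\<gamma> - \<alpha>))"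
      by (rule group_algebra_mult[OF add[OF f g] h F]) (auto simp: group_algebra_simps)
    also have "\<dots> = (\<Oplus>\<alpha>\<in>?F. f \<alpha> \<otimes> h (\<gamma> - \<alpha>)) \<oplus> (\<Oplus>\<alpha>\<in>?F. g \<alpha> \<otimes> h (\<gamma> - \<alpha>))"
      by (rule trans[OF finsum_cong'[OF refl] finsum_addf]) (auto simp: c group_algebra_simps l_distr)
    also have "\<dots> = (f \<otimes>\<^bsub>?C\<^esub> h \<oplus>\<^bsub>?C\<^esub> g \<otimes>\<^bsub>?C\<^esub> h) \<gamma>"
      using group_algebra_mult[OF f h F, of \<gamma>] group_algebra_mult[OF g h F, of \<gamma>]
      by (simp add: group_algebra_simps)
    finally show "((f \<oplus>\<^bsub>?C\<^esub> g) \<otimes>\<^bsub>?C\<^esub> h) \<gamma> = \<dots>" .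
  qed
  show "h \<otimes>\<^bsub>?C\<^esub> (f \<oplus>\<^bsub>?C\<^esub> g) = h \<otimes>\<^bsub>?C\<^esub> f \<oplus>\<^bsub>?C\<^esub> h \<otimes>\<^bsub>?C\<^esub> g"
  proof
    fix \<gamma>
    let ?H = "{\<gamma>. h \<gamma> \<noteq> \<zero>}"
    have "(h \<otimes>\<^bsub>?C\<^esub> (f \<oplus>\<^bsub>?C\<^esub> g)) \<gamma> = (\<Oplus>\<alpha>\<in>?H. h \<alpha> \<otimes> (f \<oplus>\<^bsub>?C\<^esub> g) (\<gamma> - \<alpha>))"
      by (rule group_algebra_mult[OF h add[OF f g] fin_supp[OF h]]) simp
    also have "\<dots> = (\<Oplus>\<alpha>\<in>?H. h \<alpha> \<otimes> f (\<gamma> - \<alpha>)) \<oplus> (\<Oplus>\<alpha>\<in>?H. h \<alpha> \<otimes> g (\<gamma> - \<alpha>))"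
      by (rule trans[OF finsum_cong'[OF refl] finsum_addf]) (auto simp: c group_algebra_simps r_distr)
    also have "\<dots> = (h \<otimes>\<^bsub>?C\<^esub> f \<oplus>\<^bsub>?C\<^esub> h \<otimes>\<^bsub>?C\<^esub> g) \<gamma>"
      using group_algebra_mult[OF h f fin_supp[OF h] subset_refl, of \<gamma>]
        group_algebra_mult[OF h g fin_supp[OF h] subset_refl, of \<gamma>]
      by (simp add: group_algebra_simps)
    finally show "(h \<otimes>\<^bsub>?C\<^esub> (f \<oplus>\<^bsub>?C\<^esub> g)) \<gamma> = \<dots>" .
  qed
qed

end

text \<open>A grading viewed as a coaction: x of degree \<gamma> goes to i(x) \<gamma>.
  Multiplicativity on homogeneous elements is exactly \<open>graded_mult\<close>, and both factors
  are extended additively.\<close>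

lemma ex_group_algebra_hom:
  fixes A :: "('a, 'x) ring_scheme" and Ag :: "'g::ab_group_add \<Rightarrow> 'a set" and C :: "('c, 'z) ring_scheme"
  assumes A: "graded_ring A Ag" "\<one>\<^bsub>A\<^esub> \<in> Ag 0" and C: "ring C" and i: "i \<in> ring_hom A C"
  obtains u where "u \<in> ring_hom A (group_algebra C)" "\<And>\<gamma> x. x \<in> Ag \<gamma> \<Longrightarrow> u x = single C \<gamma> (i x)"
proof -
  interpret A: graded_ring A Ag by fact
  interpret AG: graded_group A Ag by (rule A.graded_group)
  interpret C: ring C by fact
  interpret CG: ring "group_algebra C :: ('g \<Rightarrow> 'c) ring" by (rule C.group_algebra_ring)
  note ic = ring_hom_closed[OF i]
  obtain u where u: "u \<in> add_hom A (group_algebra C)" "\<And>\<gamma> x. x \<in> Ag \<gamma> \<Longrightarrow> u x = single C \<gamma> (i x)"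
    by (rule AG.ex_add_hom[OF CG.abelian_group_axioms, of "\<lambda>\<gamma> x. single C \<gamma> (i x)"])
      (auto simp: C.single_closed ic ring_hom_add[OF i] C.single_add)
  note uc = add_hom_closed[OF u(1)] and ua = add_hom_add[OF u(1)]
  have "u (x \<otimes>\<^bsub>A\<^esub> y) = u x \<otimes>\<^bsub>group_algebra C\<^esub> u y" if x: "x \<in> carrier A" and y: "y \<in> carrier A" for x y
    using x
  proof (induction rule: AG.graded_induct)
    case (homogeneous \<gamma> x)
    then have xc: "x \<in> carrier A" by simp
    show ?case
      using y
    proof (induction rule: AG.graded_induct)
      case (homogeneous \<delta> y)
      then show ?case
        using \<open>x \<in> Ag \<gamma>\<close> A.graded_mult[of x \<gamma> y \<delta>]
        by (simp add: u(2) C.single_mult ic ring_hom_mult[OF i])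
    next
      case (add y z)
      then show ?case using xc by (simp add: A.r_distr ua uc CG.r_distr)
    qed
  next
    case (add x z)
    then show ?case using y by (simp add: A.l_distr ua uc CG.l_distr)
  qed
  moreover have "u \<one>\<^bsub>A\<^esub> = \<one>\<^bsub>group_algebra C\<^esub>"
    using u(2)[OF A(2)] by (simp add: group_algebra_simps ring_hom_one[OF i])
  ultimately have "u \<in> ring_hom A (group_algebra C)"
    using uc ua by (auto intro!: ring_hom_memI)
  then show thesis using that u(2) by blast
qed

text \<open>Spanning gives existence of decompositions, and a map \<open>\<delta>\<close> that reads
  off components gives uniqueness. The projections need to be known only as additive maps with the
  right values on homogeneous elements.\<close>

lemma is_gradingI:
  assumes A: "abelian_group A" and sub: "\<And>\<gamma>. additive_subgroup (Ag \<gamma>) A"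
    and span: "carrier A = generate (add_monoid A) (\<Union>\<gamma>. Ag \<gamma>)"
    and \<delta>: "\<And>\<gamma>. (\<lambda>x. \<delta> x \<gamma>) \<in> add_hom A A"
    and homogeneous: "\<And>\<gamma> x. x \<in> Ag \<gamma> \<Longrightarrow> \<delta> x = single A \<gamma> x"
  shows "is_grading A Ag"
proof -
  interpret abelian_group A by fact
  have Agc: "Ag \<gamma> \<subseteq> carrier A" for \<gamma>
    using additive_subgroup.a_Hcarr[OF sub] by blast
  have Ag0: "\<zero>\<^bsub>A\<^esub> \<in> Ag \<gamma>" and Aga: "x \<in> Ag \<gamma> \<Longrightarrow> y \<in> Ag \<gamma> \<Longrightarrow> x \<oplus>\<^bsub>A\<^esub> y \<in> Ag \<gamma>" for \<gamma> x y
    using additive_subgroup.zero_closed[OF sub] additive_subgroup.a_closed[OF sub] by blast+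
  have Agm: "\<ominus>\<^bsub>A\<^esub> x \<in> Ag \<gamma>" if "x \<in> Ag \<gamma>" for \<gamma> x
    using subgroup.m_inv_closed[OF additive_subgroup.a_subgroup[OF sub] that] by (simp add: a_inv_def)
  note \<delta>c = add_hom_closed[OF \<delta>] and \<delta>a = add_hom_add[OF \<delta>]
  \<comment> \<open>States that \<open>\<delta> x\<close> itself is a decomposition of x. This holds
    for homogeneous elements and survives sums, hence holds on the whole span.\<close>
  define good where "good x \<longleftrightarrow> (\<forall>\<gamma>. \<delta> x \<gamma> \<in> Ag \<gamma>) \<and> finite {\<gamma>. \<delta> x \<gamma> \<noteq> \<zero>\<^bsub>A\<^esub>} \<and>
    x = finsum A (\<delta> x) {\<gamma>. \<delta> x \<gamma> \<noteq> \<zero>\<^bsub>A\<^esub>}" for x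
  have good_hom: "good x" if x: "x \<in> Ag \<gamma>" for x \<gamma>
  proof -
    have xc: "x \<in> carrier A" using x Agc by blast
    have supp: "{\<alpha>. \<delta> x \<alpha> \<noteq> \<zero>\<^bsub>A\<^esub>} \<subseteq> {\<gamma>}" using homogeneous[OF x] by (auto simp: single_def)
    have "finsum A (\<delta> x) {\<alpha>. \<delta> x \<alpha> \<noteq> \<zero>\<^bsub>A\<^esub>} = finsum A (\<delta> x) {\<gamma>}"
      using supp \<delta>c[OF xc] by (intro finsum_subset[symmetric]) auto
    also have "\<dots> = x" using xc homogeneous[OF x] by (simp add: single_def Pi_def)
    finally show ?thesis
      using supp x finite_subset[OF supp] Ag0 homogeneous[OF x] by (auto simp: good_def single_def)
  qed
  have "good x" if x: "x \<in> carrier A" for x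
  proof -
    have H: "(\<Union>\<gamma>. Ag \<gamma>) \<subseteq> carrier A" using Agc by blast
    have "x \<in> generate (add_monoid A) (\<Union>\<gamma>. Ag \<gamma>)" using x span by simp
    then show ?thesis
      using H
    proof (induction rule: generate_add_induct)
      case zero
      show ?case by (rule good_hom[OF Ag0])
    next
      case (incl h)
      then show ?case using good_hom by blast
    next
      case (minus h)
      then show ?case using good_hom Agm by blast
    next
      case (add x y)
      let ?F = "{\<gamma>. \<delta> x \<gamma> \<noteq> \<zero>\<^bsub>A\<^esub>} \<union> {\<gamma>. \<delta> y \<gamma> \<noteq> \<zero>\<^bsub>A\<^esub>}"
      have F: "finite ?F" using add by (simp add: good_def)
      have supp: "{\<gamma>. \<delta> (x \<oplus>\<^bsub>A\<^esub> y) \<gamma> \<noteq> \<zero>\<^bsub>A\<^esub>} \<subseteq> ?F"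
        using add by (auto simp: \<delta>a)
      have eq: "finsum A (\<delta> z) {\<gamma>. \<delta> z \<gamma> \<noteq> \<zero>\<^bsub>A\<^esub>} = finsum A (\<delta> z) ?F"
        if "z \<in> carrier A" "{\<gamma>. \<delta> z \<gamma> \<noteq> \<zero>\<^bsub>A\<^esub>} \<subseteq> ?F" for z
        using F that \<delta>c by (intro finsum_subset[symmetric]) auto
      have "finsum A (\<delta> (x \<oplus>\<^bsub>A\<^esub> y)) ?F = finsum A (\<delta> x) ?F \<oplus>\<^bsub>A\<^esub> finsum A (\<delta> y) ?F"
        by (rule trans[OF finsum_cong'[OF refl] finsum_addf]) (use add \<delta>c in \<open>auto simp: \<delta>a\<close>)
      also have "finsum A (\<delta> x) ?F = x" using add eq[of x] by (simp add: good_def)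
      also have "finsum A (\<delta> y) ?F = y" using add eq[of y] by (simp add: good_def)
      finally have "x \<oplus>\<^bsub>A\<^esub> y = finsum A (\<delta> (x \<oplus>\<^bsub>A\<^esub> y)) {\<gamma>. \<delta> (x \<oplus>\<^bsub>A\<^esub> y) \<gamma> \<noteq> \<zero>\<^bsub>A\<^esub>}"
        using eq[OF _ supp] add by simp
      moreover have "\<delta> (x \<oplus>\<^bsub>A\<^esub> y) \<gamma> \<in> Ag \<gamma>" for \<gamma>
        using add by (simp add: \<delta>a good_def Aga)
      ultimately show ?case using finite_subset[OF supp F] by (simp add: good_def)
    qed
  qed
  \<comment> \<open>Apply the projection to degree \<alpha> to the sum of the c \<gamma>: only the
    term \<gamma> = \<alpha> survives.\<close>
  moreover have "c = \<delta> x"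
    if "x \<in> carrier A" and c: "\<And>\<gamma>. c \<gamma> \<in> Ag \<gamma>" "finite {\<gamma>. c \<gamma> \<noteq> \<zero>\<^bsub>A\<^esub>}" "x = finsum A c {\<gamma>. c \<gamma> \<noteq> \<zero>\<^bsub>A\<^esub>}"
    for x c
  proof
    fix \<alpha>
    let ?F = "{\<gamma>. c \<gamma> \<noteq> \<zero>\<^bsub>A\<^esub>}"
    have cc: "c \<gamma> \<in> carrier A" for \<gamma> using c(1) Agc by blast
    have "\<delta> x \<alpha> = (\<Oplus>\<^bsub>A\<^esub>\<gamma>\<in>?F. \<delta> (c \<gamma>) \<alpha>)"
      using add_hom_finsum[OF A A \<delta>[of \<alpha>], of ?F c] c(3) cc by simp
    also have "\<dots> = (\<Oplus>\<^bsub>A\<^esub>\<gamma>\<in>?F. if \<gamma> = \<alpha> then c \<alpha> else \<zero>\<^bsub>A\<^esub>)"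
      by (intro finsum_cong' refl) (auto simp: cc homogeneous[OF c(1)] single_def)
    also have "\<dots> = (\<Oplus>\<^bsub>A\<^esub>\<gamma>\<in>insert \<alpha> ?F. if \<gamma> = \<alpha> then c \<alpha> else \<zero>\<^bsub>A\<^esub>)"
      using c(2) cc by (intro finsum_subset[symmetric]) auto
    also have "\<dots> = c \<alpha>" using c(2) cc by (intro finsum_single_term) auto
    finally show "c \<alpha> = \<delta> x \<alpha>" by simp
  qed
  ultimately have "\<exists>!c. (\<forall>\<gamma>. c \<gamma> \<in> Ag \<gamma>) \<and> finite {\<gamma>. c \<gamma> \<noteq> \<zero>\<^bsub>A\<^esub>} \<and> x = finsum A c {\<gamma>. c \<gamma> \<noteq> \<zero>\<^bsub>A\<^esub>}"
    if "x \<in> carrier A" for x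
    using that by (intro ex1I[of _ "\<delta> x"]) (auto simp: good_def)
  then show ?thesis using sub by (simp add: is_grading_def)
qed

lemma concentrated_graded_ring:
  assumes "ring A"
  shows "graded_ring A (concentrated A :: 'g::ab_group_add \<Rightarrow> _)"
proof -
  interpret ring A by fact
  let ?Ag = "concentrated A :: 'g \<Rightarrow> _"
  have sub: "additive_subgroup (?Ag \<gamma>) A" for \<gamma>
  proof (cases "\<gamma> = 0")
    case True
    then show ?thesis
      using group.subgroup_self[OF a_group] by (simp add: additive_subgroup_def concentrated_def)
  next
    case False
    then show ?thesis
      using group.triv_subgroup[OF a_group] by (simp add: additive_subgroup_def concentrated_def)
  qed
  have "is_grading A ?Ag"
  proof (rule is_gradingI[OF is_abelian_group sub])
    show "carrier A = generate (add_monoid A) (\<Union>\<gamma>. ?Ag \<gamma>)"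
    proof
      show "carrier A \<subseteq> generate (add_monoid A) (\<Union>\<gamma>. ?Ag \<gamma>)"
      proof
        fix x assume "x \<in> carrier A"
        then have "x \<in> ?Ag 0" by (simp add: concentrated_def)
        then show "x \<in> generate (add_monoid A) (\<Union>\<gamma>. ?Ag \<gamma>)" by (intro generate.incl) blast
      qed
      have "(\<Union>\<gamma>. ?Ag \<gamma>) \<subseteq> carrier A" by (auto simp: concentrated_def split: if_splits)
      then show "generate (add_monoid A) (\<Union>\<gamma>. ?Ag \<gamma>) \<subseteq> carrier A"
        using group.generate_incl[OF a_group, of "\<Union>\<gamma>. ?Ag \<gamma>"] by simp
    qed
    show "(\<lambda>x. single A 0 x \<gamma>) \<in> add_hom A A" for \<gamma> :: 'g
      by (auto intro!: add_homI simp: single_def)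
    show "single A 0 x = single A \<gamma> x" if "x \<in> ?Ag \<gamma>" for x \<gamma>
      using that by (auto simp: concentrated_def single_def split: if_splits)
  qed
  then show ?thesis
    by (intro graded_ring.intro graded_ring_axioms.intro ring_axioms)
      (auto simp: concentrated_def split: if_splits)
qed

section \<open>Graded coproducts\<close>

text \<open>Bilinearity, as two nested inductions over the spans; negatives are moved out of either
  factor.\<close>

lemma (in ring) generate_mult_closed:
  assumes H: "H1 \<subseteq> carrier R" "H2 \<subseteq> carrier R" "H3 \<subseteq> carrier R"
    and mult: "\<And>x y. x \<in> H1 \<Longrightarrow> y \<in> H2 \<Longrightarrow> x \<otimes> y \<in> generate (add_monoid R) H3"
    and x: "x \<in> generate (add_monoid R) H1" and y: "y \<in> generate (add_monoid R) H2"
  shows "x \<otimes> y \<in> generate (add_monoid R) H3"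
proof -
  let ?G = "generate (add_monoid R) H3"
  have G: "subgroup ?G (add_monoid R)"
    using group.generate_is_subgroup[OF a_group, of H3] H(3) by simp
  note G0 = subgroup.one_closed[OF G, simplified] and Ga = subgroup.m_closed[OF G, simplified]
  have Gm: "\<ominus> z \<in> ?G" if "z \<in> ?G" for z
    using subgroup.m_inv_closed[OF G that] by (simp add: a_inv_def)
  have yc: "y \<in> carrier R"
    using group.generate_incl[OF a_group, of H2] H(2) y by auto
  from x H(1) show ?thesis
  proof (induction rule: generate_add_induct)
    case (incl h)
    then have hc: "h \<in> carrier R" using H(1) by blast
    from y H(2) show ?case
    proof (induction rule: generate_add_induct)
      case (minus z)
      then have "z \<in> carrier R" using H(2) by blast
      then show ?case using minus hc Gm by (simp add: r_minus)
    qed (use hc G0 Ga incl mult in \<open>auto simp: r_distr\<close>)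
  next
    case (minus h)
    then have "h \<in> carrier R" using H(1) by blast
    then show ?case using minus yc Gm by (simp add: l_minus)
  qed (use yc G0 Ga in \<open>auto simp: l_distr\<close>)
qed

section \<open>Algebra homomorphisms and maps out of a coproduct\<close>

lemma alg_hom_ring_hom: "f \<in> alg_hom k A \<eta>A B \<eta>B \<Longrightarrow> f \<in> ring_hom A B"
  by (simp add: alg_hom_def)

lemma alg_hom_structure: "f \<in> alg_hom k A \<eta>A B \<eta>B \<Longrightarrow> c \<in> carrier k \<Longrightarrow> f (\<eta>A c) = \<eta>B c"
  by (simp add: alg_hom_def)

lemma alg_hom_comp:
  "f \<in> alg_hom k A \<eta>A B \<eta>B \<Longrightarrow> g \<in> alg_hom k B \<eta>B C \<eta>C \<Longrightarrow> (\<lambda>x. g (f x)) \<in> alg_hom k A \<eta>A C \<eta>C"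
  using ring_hom_trans[of f A B g C] by (auto simp: alg_hom_def o_def)

lemma alg_hom_id: "(\<lambda>x. x) \<in> alg_hom k A \<eta>A A \<eta>A"
  by (auto simp: alg_hom_def ring_hom_def)

text \<open>The universal properties assert uniqueness among extensional functions; restriction
  makes a given homomorphism eligible. It does not affect the structure map, whose values lie in the
  carrier.\<close>

lemma alg_hom_restrict:
  assumes "k_algebra k A \<eta>A" "f \<in> alg_hom k A \<eta>A B \<eta>B"
  shows "restrict f (carrier A) \<in> alg_hom k A \<eta>A B \<eta>B"
proof -
  interpret k_algebra k A \<eta>A by fact
  have "\<eta>A c \<in> carrier A" if "c \<in> carrier k" for c
    using ring_hom_closed[OF structure_hom that] .
  then show ?thesis
    using assms(2) by (auto simp: alg_hom_def ring_hom_def)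
qed

lemma coproduct_hom:
  fixes T :: "'t ring"
  assumes C: "is_coproduct TYPE('t) k D \<eta>D A \<eta>A a B \<eta>B b C \<eta>C i j" and T: "k_algebra k T \<eta>T"
    and uv: "u \<in> alg_hom k A \<eta>A T \<eta>T" "v \<in> alg_hom k B \<eta>B T \<eta>T"
      "\<And>d. d \<in> carrier D \<Longrightarrow> u (a d) = v (b d)"
  obtains h where "h \<in> alg_hom k C \<eta>C T \<eta>T" "\<And>x. x \<in> carrier A \<Longrightarrow> h (i x) = u x"
    "\<And>y. y \<in> carrier B \<Longrightarrow> h (j y) = v y"
proof -
  have "\<exists>!h. h \<in> extensional (carrier C) \<and> h \<in> alg_hom k C \<eta>C T \<eta>T \<and>
      (\<forall>x\<in>carrier A. h (i x) = u x) \<and> (\<forall>y\<in>carrier B. h (j y) = v y)"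
    using C T uv unfolding is_coproduct_def by blast
  then show thesis using that by (elim ex1E) blast
qed

text \<open>The composites of \<open>f\<close> with the coprojections form a compatible pair, and
  the restrictions of \<open>f\<close> and \<open>g\<close> both solve the lifting problem for
  it.\<close>

lemma coproduct_hom_unique:
  fixes T :: "'t ring"
  assumes C: "is_coproduct TYPE('t) k D \<eta>D A \<eta>A a B \<eta>B b C \<eta>C i j" and T: "k_algebra k T \<eta>T"
    and f: "f \<in> alg_hom k C \<eta>C T \<eta>T" and g: "g \<in> alg_hom k C \<eta>C T \<eta>T"
    and eq: "\<And>x. x \<in> carrier A \<Longrightarrow> f (i x) = g (i x)" "\<And>y. y \<in> carrier B \<Longrightarrow> f (j y) = g (j y)"
    and x: "x \<in> carrier C"
  shows "f x = g x"
proof -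
  have kC: "k_algebra k C \<eta>C" and i: "i \<in> alg_hom k A \<eta>A C \<eta>C" and j: "j \<in> alg_hom k B \<eta>B C \<eta>C"
    and ij: "\<And>d. d \<in> carrier D \<Longrightarrow> i (a d) = j (b d)"
    using C by (auto simp: is_coproduct_def)
  have ic: "i y \<in> carrier C" if "y \<in> carrier A" for y
    using ring_hom_closed[OF alg_hom_ring_hom[OF i] that] .
  have jc: "j y \<in> carrier C" if "y \<in> carrier B" for y
    using ring_hom_closed[OF alg_hom_ring_hom[OF j] that] .
  have "\<exists>!h. h \<in> extensional (carrier C) \<and> h \<in> alg_hom k C \<eta>C T \<eta>T \<and>
      (\<forall>x\<in>carrier A. h (i x) = f (i x)) \<and> (\<forall>y\<in>carrier B. h (j y) = f (j y))"
    (is "\<exists>!h. ?Q h")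
    using C T alg_hom_comp[OF i f] alg_hom_comp[OF j f] ij unfolding is_coproduct_def by auto
  moreover have "?Q (restrict f (carrier C))" "?Q (restrict g (carrier C))"
    using alg_hom_restrict[OF kC f] alg_hom_restrict[OF kC g] eq ic jc by auto
  ultimately have "restrict f (carrier C) = restrict g (carrier C)"
    by (elim ex1E) blast
  then show ?thesis using x restrict_apply'[of x "carrier C"] by metis
qed

text \<open>The universal property is taken in two types: \<open>'c\<close> for the spanning
  argument, \<open>'g \<Rightarrow> 'c\<close> for the group algebra. The images of D lie in degree
  zero of both factors, which makes the two coactions compatible.\<close>

locale graded_coproduct =
  fixes k :: "('k, 'x) ring_scheme" and D :: "('d, 'w) ring_scheme" and \<eta>D
    and A :: "('a, 'y) ring_scheme" and \<eta>A a and Ag :: "'g::ab_group_add \<Rightarrow> 'a set"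
    and B :: "('b, 'z) ring_scheme" and \<eta>B b and Bg :: "'g \<Rightarrow> 'b set"
    and C :: "'c ring" and \<eta>C i j
  assumes coproduct: "is_coproduct TYPE('c) k D \<eta>D A \<eta>A a B \<eta>B b C \<eta>C i j"
    and coproduct': "is_coproduct TYPE('g \<Rightarrow> 'c) k D \<eta>D A \<eta>A a B \<eta>B b C \<eta>C i j"
    and A: "graded_ring A Ag" "\<one>\<^bsub>A\<^esub> \<in> Ag 0" "\<And>c. c \<in> carrier k \<Longrightarrow> \<eta>A c \<in> Ag 0"
      "\<And>d. d \<in> carrier D \<Longrightarrow> a d \<in> Ag 0"
    and B: "graded_ring B Bg" "\<one>\<^bsub>B\<^esub> \<in> Bg 0" "\<And>c. c \<in> carrier k \<Longrightarrow> \<eta>B c \<in> Bg 0"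
      "\<And>d. d \<in> carrier D \<Longrightarrow> b d \<in> Bg 0"
begin

abbreviation "Mon \<equiv> coproduct_monomials C i Ag j Bg"
abbreviation "Cg \<equiv> coproduct_grading C i Ag j Bg"

sublocale A: graded_ring A Ag by (rule A)
sublocale AG: graded_group A Ag by (rule A.graded_group)
sublocale B: graded_ring B Bg by (rule B)
sublocale BG: graded_group B Bg by (rule B.graded_group)

lemma k_algebra_C: "k_algebra k C \<eta>C"
  and i_hom: "i \<in> alg_hom k A \<eta>A C \<eta>C" and j_hom: "j \<in> alg_hom k B \<eta>B C \<eta>C"
  and ij: "d \<in> carrier D \<Longrightarrow> i (a d) = j (b d)"
  using coproduct by (auto simp: is_coproduct_def)

sublocale C: ring C using k_algebra_C by (simp add: k_algebra_def)

lemmas i_ring_hom = alg_hom_ring_hom[OF i_hom]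
lemmas j_ring_hom = alg_hom_ring_hom[OF j_hom]

lemma i_closed: "x \<in> carrier A \<Longrightarrow> i x \<in> carrier C"
  using ring_hom_closed[OF i_ring_hom] .

lemma j_closed: "x \<in> carrier B \<Longrightarrow> j x \<in> carrier C"
  using ring_hom_closed[OF j_ring_hom] .

lemma monomial_closed: "(\<gamma>, c) \<in> Mon \<Longrightarrow> c \<in> carrier C"
proof (induction rule: coproduct_monomials.induct)
  case (left x \<alpha> \<beta> c)
  then show ?case by (intro C.m_closed i_closed) auto
next
  case (right x \<alpha> \<beta> c)
  then show ?case by (intro C.m_closed j_closed) auto
qed simp

lemma monomial_mult:
  assumes "(\<gamma>, c) \<in> Mon" "(\<delta>, d) \<in> Mon"
  shows "(\<gamma> + \<delta>, c \<otimes>\<^bsub>C\<^esub> d) \<in> Mon"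
  using assms(1)
proof (induction rule: coproduct_monomials.induct)
  case one
  then show ?case using assms(2) monomial_closed by simp
next
  case (left x \<alpha> \<beta> c)
  then have "i x \<otimes>\<^bsub>C\<^esub> c \<otimes>\<^bsub>C\<^esub> d = i x \<otimes>\<^bsub>C\<^esub> (c \<otimes>\<^bsub>C\<^esub> d)"
    using AG.component_closed[OF left(1)] monomial_closed[OF left(2)] monomial_closed[OF assms(2)]
    by (simp add: C.m_assoc i_closed)
  then show ?case
    using coproduct_monomials.left[OF left(1,3)] by (simp add: add.assoc)
next
  case (right x \<alpha> \<beta> c)
  then have "j x \<otimes>\<^bsub>C\<^esub> c \<otimes>\<^bsub>C\<^esub> d = j x \<otimes>\<^bsub>C\<^esub> (c \<otimes>\<^bsub>C\<^esub> d)"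
    using BG.component_closed[OF right(1)] monomial_closed[OF right(2)] monomial_closed[OF assms(2)]
    by (simp add: C.m_assoc j_closed)
  then show ?case
    using coproduct_monomials.right[OF right(1,3)] by (simp add: add.assoc)
qed

lemma monomials_subset: "{c. (\<gamma>, c) \<in> Mon} \<subseteq> carrier C"
  using monomial_closed by blast

lemma Cg_subgroup: "additive_subgroup (Cg \<gamma>) C"
  unfolding coproduct_grading_def
  by (rule additive_subgroup_generate[OF C.is_abelian_group monomials_subset])

lemma Cg_closed: "x \<in> Cg \<gamma> \<Longrightarrow> x \<in> carrier C"
  using additive_subgroup.a_Hcarr[OF Cg_subgroup] .

lemma Cg_monomial: "(\<gamma>, c) \<in> Mon \<Longrightarrow> c \<in> Cg \<gamma>"
  unfolding coproduct_grading_def by (rule generate.incl) simp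

lemma Cg_mult: "x \<in> Cg \<gamma> \<Longrightarrow> y \<in> Cg \<delta> \<Longrightarrow> x \<otimes>\<^bsub>C\<^esub> y \<in> Cg (\<gamma> + \<delta>)"
  unfolding coproduct_grading_def
  by (rule C.generate_mult_closed[OF monomials_subset monomials_subset monomials_subset])
    (auto intro: generate.incl monomial_mult)

lemma i_graded: "x \<in> Ag \<gamma> \<Longrightarrow> i x \<in> Cg \<gamma>"
  using Cg_monomial[OF coproduct_monomials.left[OF _ coproduct_monomials.one], of x \<gamma>]
    AG.component_closed[of x \<gamma>] i_closed[of x] by simp

lemma j_graded: "x \<in> Bg \<gamma> \<Longrightarrow> j x \<in> Cg \<gamma>"
  using Cg_monomial[OF coproduct_monomials.right[OF _ coproduct_monomials.one], of x \<gamma>]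
    BG.component_closed[of x \<gamma>] j_closed[of x] by simp

text \<open>
  The span of the monomials is a subring through which both coprojections factor; by uniqueness
  of the comparison map it is all of \<open>C\<close>.
\<close>

lemma carrier_eq_span: "carrier C = generate (add_monoid C) (\<Union>\<gamma>. Cg \<gamma>)"
proof -
  let ?H = "\<Union>\<gamma>. Cg \<gamma>"
  define S where "S = generate (add_monoid C) ?H"
  have H: "?H \<subseteq> carrier C" using Cg_closed by blast
  have S: "additive_subgroup S C"
    unfolding S_def by (rule additive_subgroup_generate[OF C.is_abelian_group H])
  have S_incl: "x \<in> S" if "x \<in> Cg \<gamma>" for x \<gamma>
    unfolding S_def by (rule generate.incl) (use that in blast)
  have mult: "x \<otimes>\<^bsub>C\<^esub> y \<in> S" if "x \<in> S" "y \<in> S" for x y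
    using that unfolding S_def
    by (rule C.generate_mult_closed[OF H H H, rotated]) (auto intro: generate.incl Cg_mult)
  have iS: "i x \<in> S" if "x \<in> carrier A" for x
    using that
  proof (induction rule: AG.graded_induct)
    case (homogeneous \<gamma> x)
    then show ?case by (intro S_incl i_graded)
  next
    case (add x y)
    then show ?case
      using additive_subgroup.a_closed[OF S] by (simp add: ring_hom_add[OF i_ring_hom])
  qed
  have jS: "j x \<in> S" if "x \<in> carrier B" for x
    using that
  proof (induction rule: BG.graded_induct)
    case (homogeneous \<gamma> x)
    then show ?case by (intro S_incl j_graded)
  next
    case (add x y)
    then show ?case
      using additive_subgroup.a_closed[OF S] by (simp add: ring_hom_add[OF j_ring_hom])
  qed
  have SC: "S \<subseteq> carrier C" using additive_subgroup.a_Hcarr[OF S] by blast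
  interpret T: ring "C\<lparr>carrier := S\<rparr>"
    by (rule C.ring_on_subgroup[OF S S_incl[OF Cg_monomial[OF coproduct_monomials.one]] mult])
  \<comment> \<open>Passing through A shows that the scalars land in the span.\<close>
  have \<eta>: "\<eta>C c = i (\<eta>A c)" if "c \<in> carrier k" for c
    using alg_hom_structure[OF i_hom that] by simp
  interpret kC: k_algebra k C \<eta>C by (rule k_algebra_C)
  have kT: "k_algebra k (C\<lparr>carrier := S\<rparr>) \<eta>C"
  proof (intro k_algebra.intro k_algebra_axioms.intro kC.k.cring_axioms T.ring_axioms)
    show "\<eta>C \<in> ring_hom k (C\<lparr>carrier := S\<rparr>)"
      using kC.structure_hom \<eta> iS[OF AG.component_closed[OF A(3)]] by (auto simp: ring_hom_def)
    show "\<eta>C c \<otimes>\<^bsub>C\<lparr>carrier := S\<rparr>\<^esub> x = x \<otimes>\<^bsub>C\<lparr>carrier := S\<rparr>\<^esub> \<eta>C c"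
      if "c \<in> carrier k" "x \<in> carrier (C\<lparr>carrier := S\<rparr>)" for c x
      using that kC.central SC by auto
  qed
  have "i \<in> alg_hom k A \<eta>A (C\<lparr>carrier := S\<rparr>) \<eta>C" "j \<in> alg_hom k B \<eta>B (C\<lparr>carrier := S\<rparr>) \<eta>C"
    using i_hom j_hom iS jS by (auto simp: alg_hom_def ring_hom_def)
  then obtain h where h: "h \<in> alg_hom k C \<eta>C (C\<lparr>carrier := S\<rparr>) \<eta>C"
    "\<And>x. x \<in> carrier A \<Longrightarrow> h (i x) = i x" "\<And>y. y \<in> carrier B \<Longrightarrow> h (j y) = j y"
    using coproduct_hom[OF coproduct kT, of i j] ij by blast
  \<comment> \<open>Regarded as an endomorphism of C, h agrees with the identity on both
    coprojections. Hence it is the identity, while its values lie in the span.\<close>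
  have "h \<in> alg_hom k C \<eta>C C \<eta>C"
    using h(1) SC by (auto simp: alg_hom_def ring_hom_def)
  then have "h x = x" if "x \<in> carrier C" for x
    using coproduct_hom_unique[OF coproduct k_algebra_C _ alg_hom_id _ _ that, of h] h(2,3) by simp
  moreover have "h x \<in> S" if "x \<in> carrier C" for x
    using ring_hom_closed[OF alg_hom_ring_hom[OF h(1)] that] by simp
  ultimately show ?thesis using SC unfolding S_def by force
qed

text \<open>
  The grading is split by the coaction \<open>C \<rightarrow> C[\<Gamma>]\<close> that sends \<open>c\<close> of degree \<open>\<gamma>\<close> to \<open>c \<gamma>\<close>.
\<close>

lemma coaction:
  obtains h where "h \<in> ring_hom C (group_algebra C)" "\<And>\<gamma> x. x \<in> Cg \<gamma> \<Longrightarrow> h x = single C \<gamma> x"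
proof -
  let ?T = "group_algebra C :: ('g \<Rightarrow> 'c) ring"
  interpret T: ring ?T by (rule C.group_algebra_ring)
  interpret kC: k_algebra k C \<eta>C by (rule k_algebra_C)
  \<comment> \<open>Scalars are placed in degree zero; they are central there because a monomial of
    degree zero multiplies coefficientwise on either side.\<close>
  let ?\<eta> = "\<lambda>c. single C (0::'g) (\<eta>C c)"
  have \<eta>c: "\<eta>C c \<in> carrier C" if "c \<in> carrier k" for c
    using ring_hom_closed[OF kC.structure_hom that] .
  have kT: "k_algebra k ?T ?\<eta>"
  proof (intro k_algebra.intro k_algebra_axioms.intro kC.k.cring_axioms T.ring_axioms)
    show "?\<eta> \<in> ring_hom k ?T"
      using ring_hom_mult[OF kC.structure_hom] ring_hom_add[OF kC.structure_hom]
        ring_hom_one[OF kC.structure_hom] \<eta>c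
      by (auto intro!: ring_hom_memI simp: C.single_closed C.single_mult C.single_add)
        (simp add: group_algebra_simps)
    show "?\<eta> c \<otimes>\<^bsub>?T\<^esub> x = x \<otimes>\<^bsub>?T\<^esub> ?\<eta> c" if "c \<in> carrier k" "x \<in> carrier ?T" for c x
      using that \<eta>c kC.central[OF that(1)]
      by (simp add: C.single_mult_left C.mult_single_zero group_algebra_simps)
  qed
  obtain u where u: "u \<in> ring_hom A ?T" "\<And>\<gamma> x. x \<in> Ag \<gamma> \<Longrightarrow> u x = single C \<gamma> (i x)"
    using ex_group_algebra_hom[OF A(1,2) C.ring_axioms i_ring_hom] by blast
  obtain v where v: "v \<in> ring_hom B ?T" "\<And>\<gamma> x. x \<in> Bg \<gamma> \<Longrightarrow> v x = single C \<gamma> (j x)"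
    using ex_group_algebra_hom[OF B(1,2) C.ring_axioms j_ring_hom] by blast
  have "u \<in> alg_hom k A \<eta>A ?T ?\<eta>" "v \<in> alg_hom k B \<eta>B ?T ?\<eta>"
    using u(1) v(1) u(2)[OF A(3)] v(2)[OF B(3)] alg_hom_structure[OF i_hom] alg_hom_structure[OF j_hom]
    by (auto simp: alg_hom_def)
  \<comment> \<open>D has degree zero in both factors, so both sides are the same monomial of degree
    zero.\<close>
  moreover have "u (a d) = v (b d)" if "d \<in> carrier D" for d
    using u(2)[OF A(4)[OF that]] v(2)[OF B(4)[OF that]] ij[OF that] by simp
  ultimately obtain h where h: "h \<in> alg_hom k C \<eta>C ?T ?\<eta>"
    "\<And>x. x \<in> carrier A \<Longrightarrow> h (i x) = u x" "\<And>y. y \<in> carrier B \<Longrightarrow> h (j y) = v y"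
    using coproduct_hom[OF coproduct' kT] by blast
  note hr = alg_hom_ring_hom[OF h(1)]
  have mon: "h c = single C \<gamma> c" if "(\<gamma>, c) \<in> Mon" for \<gamma> c
    using that
  proof (induction rule: coproduct_monomials.induct)
    case one
    show ?case using ring_hom_one[OF hr] by (simp add: group_algebra_simps)
  next
    case (left x \<alpha> \<beta> c)
    have "x \<in> carrier A" "c \<in> carrier C" using left monomial_closed by auto
    then show ?case
      using left by (simp add: ring_hom_mult[OF hr] i_closed h(2) u(2) C.single_mult)
  next
    case (right x \<alpha> \<beta> c)
    have "x \<in> carrier B" "c \<in> carrier C" using right monomial_closed by auto
    then show ?case
      using right by (simp add: ring_hom_mult[OF hr] j_closed h(3) v(2) C.single_mult)
  qed
  have "h x = single C \<gamma> x" if "x \<in> Cg \<gamma>" for x \<gamma>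
  proof -
    have sg: "single C \<gamma> \<in> add_hom C ?T"
      by (rule add_homI) (simp_all add: C.single_closed C.single_add)
    note ha = ring_hom_add_hom[OF hr]
    from that[unfolded coproduct_grading_def] monomials_subset show ?thesis
    proof (induction rule: C.generate_add_induct)
      case zero
      show ?case
        using add_hom_zero[OF C.is_abelian_group T.is_abelian_group sg]
          add_hom_zero[OF C.is_abelian_group T.is_abelian_group ha] by simp
    next
      case (minus c)
      then have "c \<in> carrier C" using monomials_subset by blast
      then show ?case
        using add_hom_minus[OF C.is_abelian_group T.is_abelian_group sg]
          add_hom_minus[OF C.is_abelian_group T.is_abelian_group ha] minus by simp
    qed (use mon in \<open>auto simp: add_hom_add[OF ha] add_hom_add[OF sg]\<close>)
  qed
  then show thesis using that hr by blast
qed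

text \<open>Evaluating the coaction at \<gamma> gives the projection onto degree \<gamma> that the
  grading criterion asks for.\<close>

lemma graded_ring_C: "graded_ring C Cg"
proof -
  obtain h where h: "h \<in> ring_hom C (group_algebra C)" "\<And>\<gamma> x. x \<in> Cg \<gamma> \<Longrightarrow> h x = single C \<gamma> x"
    using coaction by blast
  have "(\<lambda>x. h x \<gamma>) \<in> add_hom C C" for \<gamma>
    using ring_hom_closed[OF h(1)] ring_hom_add[OF h(1)]
    by (intro add_homI) (simp_all add: group_algebra_simps)
  then have "is_grading C Cg"
    by (rule is_gradingI[OF C.is_abelian_group Cg_subgroup carrier_eq_span]) (rule h(2))
  then show ?thesis
    by (intro graded_ring.intro graded_ring_axioms.intro C.ring_axioms Cg_mult)
qed

end

section \<open>Universal homomorphisms\<close>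

text \<open>The matrix relation involves the target ring only through elements \<sigma> r, which h
  sends to \<tau> r; so composition preserves it.\<close>

lemma coordinate_family_comp:
  assumes R: "ring R" "\<sigma> \<in> ring_hom R S" and S: "ring S" and T: "ring T"
    and F: "coordinate_family R M I p \<mu> S \<sigma> F"
    and h: "h \<in> ring_hom S T" "\<And>r. r \<in> carrier R \<Longrightarrow> h (\<sigma> r) = \<tau> r"
    and e: "\<And>k l. k \<in> I \<Longrightarrow> l \<in> I \<Longrightarrow> \<mu> l (p k) \<in> carrier R"
  shows "coordinate_family R M I p \<mu> T \<tau> (\<lambda>l m. h (F l m))"
  unfolding coordinate_family_alt
proof (intro ballI conjI)
  interpret S: ring S by fact
  interpret T: ring T by fact
  have F: "semilinear R M S \<sigma> (F l)"
    "\<And>m. m \<in> carrier M \<Longrightarrow> F l m = (\<Oplus>\<^bsub>S\<^esub>k\<in>I. F k m \<otimes>\<^bsub>S\<^esub> \<sigma> (\<mu> l (p k)))" if "l \<in> I" for l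
    using F that unfolding coordinate_family_alt by blast+
  have Fc: "F l m \<in> carrier S" if "l \<in> I" "m \<in> carrier M" for l m
    using F(1)[OF that(1)] that(2) add_hom_closed[of "F l" M S m] by (simp add: semilinear_def)
  have \<sigma>c: "\<sigma> r \<in> carrier S" if "r \<in> carrier R" for r using ring_hom_closed[OF R(2) that] .
  fix l assume l: "l \<in> I"
  show "semilinear R M T \<tau> (\<lambda>m. h (F l m))"
    using semilinear_comp[OF F(1)[OF l] h(1)] h(2) \<sigma>c by simp
  fix m assume m: "m \<in> carrier M"
  have "h (F l m) = h (\<Oplus>\<^bsub>S\<^esub>k\<in>I. F k m \<otimes>\<^bsub>S\<^esub> \<sigma> (\<mu> l (p k)))"
    using F(2)[OF l m] by simp
  also have "\<dots> = (\<Oplus>\<^bsub>T\<^esub>k\<in>I. h (F k m \<otimes>\<^bsub>S\<^esub> \<sigma> (\<mu> l (p k))))"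
    by (rule add_hom_finsum[OF S.is_abelian_group T.is_abelian_group ring_hom_add_hom[OF h(1)]])
      (use l m Fc \<sigma>c e in auto)
  also have "\<dots> = (\<Oplus>\<^bsub>T\<^esub>k\<in>I. h (F k m) \<otimes>\<^bsub>T\<^esub> \<tau> (\<mu> l (p k)))"
    using l m Fc \<sigma>c e ring_hom_closed[OF h(1)]
    by (intro T.finsum_cong' refl) (auto simp: ring_hom_mult[OF h(1)] h(2)[symmetric])
  finally show "h (F l m) = (\<Oplus>\<^bsub>T\<^esub>k\<in>I. h (F k m) \<otimes>\<^bsub>T\<^esub> \<tau> (\<mu> l (p k)))" .
qed

lemma coordinate_family_closed:
  "coordinate_family R M I p \<mu> T \<tau> G \<Longrightarrow> l \<in> I \<Longrightarrow> m \<in> carrier M \<Longrightarrow> G l m \<in> carrier T"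
  using add_hom_closed[of "G l" M T m] by (simp add: coordinate_family_def)

context
  fixes k :: "('k, 'x) ring_scheme" and R :: "('r, 'y) ring_scheme" and \<eta>
    and M :: "('r, 'm, 'z) module_scheme" and P :: "('r, 'p, 'w) module_scheme"
    and S :: "('s, 'v) ring_scheme" and \<eta>S \<sigma> f and I :: "'i set" and p \<mu>
    and T :: "'t ring" and \<eta>T \<tau>
  assumes univ: "is_universal_hom_ring TYPE('t) k R \<eta> M P S \<eta>S \<sigma> f"
    and dual: "dual_basis R P I p \<mu>" and M: "left_module R M"
    and T: "R_ring k R \<eta> T \<eta>T \<tau>"
begin

lemma universal_R_ring: "R_ring k R \<eta> S \<eta>S \<sigma>"
  and universal_hom: "f \<in> module_hom S (tensor R S \<sigma> M) (tensor R S \<sigma> P)"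
  using univ by (auto simp: is_universal_hom_ring_def)

lemma universal_hom_ring_facts:
  shows "ring R" "ring S" "\<sigma> \<in> ring_hom R S" "ring T" "\<tau> \<in> ring_hom R T"
  using universal_R_ring T by (auto simp: R_ring_def k_algebra_def alg_hom_def)

lemma universal_coordinates: "coordinate_family R M I p \<mu> S \<sigma> (coordinates R M P \<mu> S \<sigma> f)"
proof -
  interpret D: dual_basis R P I p \<mu> by (rule dual)
  interpret S: ring S by (rule universal_hom_ring_facts)
  interpret E: extended_dual_basis R P I p \<mu> S \<sigma>
    by unfold_locales (rule universal_hom_ring_facts)
  show ?thesis by (rule E.coordinate_family_coordinates[OF M universal_hom])
qed

text \<open>Existence half of the universal property with all tensor products removed: S carries the
  universal coordinate family.\<close>

lemma universal_hom_ring_lift: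
  assumes G: "coordinate_family R M I p \<mu> T \<tau> G"
  obtains h where "h \<in> alg_hom k S \<eta>S T \<eta>T" "\<And>r. r \<in> carrier R \<Longrightarrow> h (\<sigma> r) = \<tau> r"
    "\<And>l m. l \<in> I \<Longrightarrow> m \<in> carrier M \<Longrightarrow> h (coordinates R M P \<mu> S \<sigma> f l m) = G l m"
proof -
  interpret D: dual_basis R P I p \<mu> by (rule dual)
  interpret T: ring T by (rule universal_hom_ring_facts)
  interpret E: extended_dual_basis R P I p \<mu> T \<tau>
    by unfold_locales (rule universal_hom_ring_facts)
  obtain g where g: "g \<in> module_hom T (tensor R T \<tau> M) (tensor R T \<tau> P)"
    "\<And>l m. l \<in> I \<Longrightarrow> m \<in> carrier M \<Longrightarrow> coordinates R M P \<mu> T \<tau> g l m = G l m"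
    by (rule E.ex_hom_with_coordinates[OF M G]) (rule that)
  have "\<exists>!h. h \<in> extensional (carrier S) \<and> h \<in> alg_hom k S \<eta>S T \<eta>T \<and>
      (\<forall>r\<in>carrier R. h (\<sigma> r) = \<tau> r) \<and> is_base_change R M P S \<sigma> f T \<tau> g h"
    using univ[unfolded is_universal_hom_ring_def, THEN conjunct2, THEN conjunct2, rule_format, OF T g(1)] .
  then obtain h where h: "h \<in> alg_hom k S \<eta>S T \<eta>T" "\<And>r. r \<in> carrier R \<Longrightarrow> h (\<sigma> r) = \<tau> r"
    "is_base_change R M P S \<sigma> f T \<tau> g h"
    by (elim ex1E) blast
  moreover have "h (coordinates R M P \<mu> S \<sigma> f l m) = G l m" if "l \<in> I" "m \<in> carrier M" for l m
    using is_base_change_iff_coordinates[OF dual M universal_hom_ring_facts(2-5) alg_hom_ring_hom[OF h(1)]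
        h(2) universal_hom g(1)] h(3) g(2) that by auto
  ultimately show thesis using that by blast
qed

text \<open>Pushing the universal family forward along \<open>h\<close> gives the coordinates of
  some homomorphism g. Equality on the family makes \<open>h\<close> and \<open>h'\<close> solutions
  for this same g.\<close>

lemma universal_hom_ring_unique:
  assumes h: "h \<in> alg_hom k S \<eta>S T \<eta>T" "\<And>r. r \<in> carrier R \<Longrightarrow> h (\<sigma> r) = \<tau> r"
    and h': "h' \<in> alg_hom k S \<eta>S T \<eta>T" "\<And>r. r \<in> carrier R \<Longrightarrow> h' (\<sigma> r) = \<tau> r"
    and eq: "\<And>l m. l \<in> I \<Longrightarrow> m \<in> carrier M \<Longrightarrow>
      h (coordinates R M P \<mu> S \<sigma> f l m) = h' (coordinates R M P \<mu> S \<sigma> f l m)"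
    and x: "x \<in> carrier S"
  shows "h x = h' x"
proof -
  interpret D: dual_basis R P I p \<mu> by (rule dual)
  interpret T: ring T by (rule universal_hom_ring_facts)
  interpret E: extended_dual_basis R P I p \<mu> T \<tau>
    by unfold_locales (rule universal_hom_ring_facts)
  let ?F = "coordinates R M P \<mu> S \<sigma> f"
  have e: "\<mu> l (p k) \<in> carrier R" if "k \<in> I" "l \<in> I" for k l
    using E.\<mu>_closed[OF that(2) D.p_closed[OF that(1)]] .
  have "coordinate_family R M I p \<mu> T \<tau> (\<lambda>l m. h (?F l m))"
    by (rule coordinate_family_comp[OF universal_hom_ring_facts(1,3,2,4) universal_coordinates
          alg_hom_ring_hom[OF h(1)] h(2) e])
  then obtain g where g: "g \<in> module_hom T (tensor R T \<tau> M) (tensor R T \<tau> P)"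
    "\<And>l m. l \<in> I \<Longrightarrow> m \<in> carrier M \<Longrightarrow> coordinates R M P \<mu> T \<tau> g l m = h (?F l m)"
    by (rule E.ex_hom_with_coordinates[OF M]) (rule that)
  have kS: "k_algebra k S \<eta>S" using universal_R_ring by (simp add: R_ring_def)
  let ?Q = "\<lambda>h. h \<in> extensional (carrier S) \<and> h \<in> alg_hom k S \<eta>S T \<eta>T \<and>
      (\<forall>r\<in>carrier R. h (\<sigma> r) = \<tau> r) \<and> is_base_change R M P S \<sigma> f T \<tau> g h"
  have Q: "?Q (restrict h'' (carrier S))"
    if h'': "h'' \<in> alg_hom k S \<eta>S T \<eta>T" "\<And>r. r \<in> carrier R \<Longrightarrow> h'' (\<sigma> r) = \<tau> r"
      "\<And>l m. l \<in> I \<Longrightarrow> m \<in> carrier M \<Longrightarrow> h (?F l m) = h'' (?F l m)" for h''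
  proof -
    have r: "restrict h'' (carrier S) \<in> alg_hom k S \<eta>S T \<eta>T"
      by (rule alg_hom_restrict[OF kS h''(1)])
    have \<sigma>: "restrict h'' (carrier S) (\<sigma> r) = \<tau> r" if "r \<in> carrier R" for r
      using that h''(2) ring_hom_closed[OF universal_hom_ring_facts(3)] by simp
    have "is_base_change R M P S \<sigma> f T \<tau> g (restrict h'' (carrier S))"
      by (rule iffD2[OF is_base_change_iff_coordinates[OF dual M universal_hom_ring_facts(2-5)
              alg_hom_ring_hom[OF r] \<sigma> universal_hom g(1)]])
        (use g(2) h''(3) coordinate_family_closed[OF universal_coordinates] in simp_all)
    then show ?thesis using r \<sigma> by simp
  qed
  have "\<exists>!h. ?Q h"
    using univ[unfolded is_universal_hom_ring_def, THEN conjunct2, THEN conjunct2, rule_format, OF T g(1)] .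
  then have "restrict h (carrier S) = restrict h' (carrier S)"
    using Q[OF h] Q[OF h' eq] by (elim ex1E) blast
  then show ?thesis using x restrict_apply'[of x "carrier S"] by metis
qed

end

lemma graded_alg_hom_alg_hom: "h \<in> graded_alg_hom k A \<eta>A Ag B \<eta>B Bg \<Longrightarrow> h \<in> alg_hom k A \<eta>A B \<eta>B"
  by (simp add: graded_alg_hom_def)

section \<open>The graded universal property in coordinates, and extension of families from degree
  zero\<close>

context graded_coordinates
begin

context
  fixes k :: "('k, 'a) ring_scheme" and kg :: "'g \<Rightarrow> 'k set" and \<eta>
    and S :: "('s, 'v) ring_scheme" and \<eta>S Sg \<sigma> f and T :: "'t ring" and \<eta>T Tg \<tau>
  assumes univ: "is_universal_graded_hom_ring TYPE('t) k kg R \<eta> Rg M Mg P Pg S \<eta>S Sg \<sigma> f"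
    and T: "graded_R_ring k kg R \<eta> Rg T \<eta>T Tg \<tau>"
begin

lemma universal_graded_R_ring: "graded_R_ring k kg R \<eta> Rg S \<eta>S Sg \<sigma>"
  and universal_graded_hom: "f \<in> graded_module_hom S (tensor R S \<sigma> M) (tensor_grading R S Sg \<sigma> M Mg)
    (tensor R S \<sigma> P) (tensor_grading R S Sg \<sigma> P Pg)"
  using univ by (auto simp: is_universal_graded_hom_ring_def)

lemma universal_graded_hom_ring_facts:
  shows "ring S" "\<sigma> \<in> ring_hom R S" "ring T" "\<tau> \<in> ring_hom R T" "graded_ring S Sg" "graded_ring T Tg"
    "\<And>\<gamma>. \<sigma> ` Rg \<gamma> \<subseteq> Sg \<gamma>" "\<And>\<gamma>. \<tau> ` Rg \<gamma> \<subseteq> Tg \<gamma>" "k_algebra k S \<eta>S"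
  using universal_graded_R_ring T
  by (auto simp: graded_R_ring_def graded_algebra_def graded_alg_hom_def alg_hom_def k_algebra_def)

lemma universal_graded_module_hom: "f \<in> module_hom S (tensor R S \<sigma> M) (tensor R S \<sigma> P)"
  using universal_graded_hom by (simp add: graded_module_hom_def)

lemma universal_graded_coordinates:
  shows "coordinate_family R M I p \<mu> S \<sigma> (coordinates R M P \<mu> S \<sigma> f)"
    and "\<And>l \<gamma> m. l \<in> I \<Longrightarrow> m \<in> Mg \<gamma> \<Longrightarrow> coordinates R M P \<mu> S \<sigma> f l m \<in> Sg \<gamma>"
proof -
  interpret S: ring S by (rule universal_graded_hom_ring_facts)
  interpret E: extended_dual_basis R P I p \<mu> S \<sigma>
    by unfold_locales (rule universal_graded_hom_ring_facts)
  show "coordinate_family R M I p \<mu> S \<sigma> (coordinates R M P \<mu> S \<sigma> f)"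
    by (rule E.coordinate_family_coordinates[OF M.left_module_axioms universal_graded_module_hom])
  show "coordinates R M P \<mu> S \<sigma> f l m \<in> Sg \<gamma>" if "l \<in> I" "m \<in> Mg \<gamma>" for l \<gamma> m
    by (rule coordinates_graded[OF universal_graded_hom_ring_facts(5,2,7) universal_graded_hom that])
qed

lemma universal_graded_hom_ring_lift:
  assumes G: "coordinate_family R M I p \<mu> T \<tau> G" "\<And>l \<gamma> m. l \<in> I \<Longrightarrow> m \<in> Mg \<gamma> \<Longrightarrow> G l m \<in> Tg \<gamma>"
  obtains h where "h \<in> graded_alg_hom k S \<eta>S Sg T \<eta>T Tg" "\<And>r. r \<in> carrier R \<Longrightarrow> h (\<sigma> r) = \<tau> r"
    "\<And>l m. l \<in> I \<Longrightarrow> m \<in> carrier M \<Longrightarrow> h (coordinates R M P \<mu> S \<sigma> f l m) = G l m"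
proof -
  obtain g where g: "g \<in> graded_module_hom T (tensor R T \<tau> M) (tensor_grading R T Tg \<tau> M Mg)
      (tensor R T \<tau> P) (tensor_grading R T Tg \<tau> P Pg)"
    "\<And>l m. l \<in> I \<Longrightarrow> m \<in> carrier M \<Longrightarrow> coordinates R M P \<mu> T \<tau> g l m = G l m"
    using ex_graded_hom_with_coordinates[OF universal_graded_hom_ring_facts(6,4,8) G] by blast
  have gm: "g \<in> module_hom T (tensor R T \<tau> M) (tensor R T \<tau> P)"
    using g(1) by (simp add: graded_module_hom_def)
  have "\<exists>!h. h \<in> extensional (carrier S) \<and> h \<in> graded_alg_hom k S \<eta>S Sg T \<eta>T Tg \<and>
      (\<forall>r\<in>carrier R. h (\<sigma> r) = \<tau> r) \<and> is_base_change R M P S \<sigma> f T \<tau> g h"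
    using univ[unfolded is_universal_graded_hom_ring_def, THEN conjunct2, THEN conjunct2, rule_format, OF T g(1)] .
  then obtain h where h: "h \<in> graded_alg_hom k S \<eta>S Sg T \<eta>T Tg" "\<And>r. r \<in> carrier R \<Longrightarrow> h (\<sigma> r) = \<tau> r"
    "is_base_change R M P S \<sigma> f T \<tau> g h"
    by (elim ex1E) blast
  moreover have "h (coordinates R M P \<mu> S \<sigma> f l m) = G l m" if "l \<in> I" "m \<in> carrier M" for l m
    using is_base_change_iff_coordinates[OF dual_basis_axioms M.left_module_axioms
        universal_graded_hom_ring_facts(1-4) alg_hom_ring_hom[OF graded_alg_hom_alg_hom[OF h(1)]]
        h(2) universal_graded_module_hom gm] h(3) g(2) that by auto
  ultimately show thesis using that by blast
qed

text \<open>As in the ungraded case; the pushed-forward family is graded because both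
  \<open>h\<close> and the universal family are, so it belongs to a graded test
  homomorphism.\<close>

lemma universal_graded_hom_ring_unique:
  assumes h: "h \<in> graded_alg_hom k S \<eta>S Sg T \<eta>T Tg" "\<And>r. r \<in> carrier R \<Longrightarrow> h (\<sigma> r) = \<tau> r"
    and h': "h' \<in> graded_alg_hom k S \<eta>S Sg T \<eta>T Tg" "\<And>r. r \<in> carrier R \<Longrightarrow> h' (\<sigma> r) = \<tau> r"
    and eq: "\<And>l m. l \<in> I \<Longrightarrow> m \<in> carrier M \<Longrightarrow>
      h (coordinates R M P \<mu> S \<sigma> f l m) = h' (coordinates R M P \<mu> S \<sigma> f l m)"
    and x: "x \<in> carrier S"
  shows "h x = h' x"
proof -
  let ?F = "coordinates R M P \<mu> S \<sigma> f"
  interpret S: graded_ring S Sg by (rule universal_graded_hom_ring_facts)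
  interpret SG: graded_group S Sg by (rule S.graded_group)
  have e: "\<mu> l (p k) \<in> carrier R" if "k \<in> I" "l \<in> I" for k l
    using \<mu>_graded[OF that(2) p_degree_zero[OF that(1)]] by simp
  note ha = graded_alg_hom_alg_hom[OF h(1)]
  have "coordinate_family R M I p \<mu> T \<tau> (\<lambda>l m. h (?F l m))"
    by (rule coordinate_family_comp[OF ring_axioms universal_graded_hom_ring_facts(2,1,3)
          universal_graded_coordinates(1) alg_hom_ring_hom[OF ha] h(2) e])
  moreover have "h (?F l m) \<in> Tg \<gamma>" if "l \<in> I" "m \<in> Mg \<gamma>" for l \<gamma> m
    using universal_graded_coordinates(2)[OF that] h(1) by (auto simp: graded_alg_hom_def)
  ultimately obtain g where g: "g \<in> graded_module_hom T (tensor R T \<tau> M) (tensor_grading R T Tg \<tau> M Mg)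
      (tensor R T \<tau> P) (tensor_grading R T Tg \<tau> P Pg)"
    "\<And>l m. l \<in> I \<Longrightarrow> m \<in> carrier M \<Longrightarrow> coordinates R M P \<mu> T \<tau> g l m = h (?F l m)"
    using ex_graded_hom_with_coordinates[OF universal_graded_hom_ring_facts(6,4,8)] by blast
  have gm: "g \<in> module_hom T (tensor R T \<tau> M) (tensor R T \<tau> P)"
    using g(1) by (simp add: graded_module_hom_def)
  let ?Q = "\<lambda>h. h \<in> extensional (carrier S) \<and> h \<in> graded_alg_hom k S \<eta>S Sg T \<eta>T Tg \<and>
      (\<forall>r\<in>carrier R. h (\<sigma> r) = \<tau> r) \<and> is_base_change R M P S \<sigma> f T \<tau> g h"
  have Q: "?Q (restrict h'' (carrier S))"
    if h'': "h'' \<in> graded_alg_hom k S \<eta>S Sg T \<eta>T Tg" "\<And>r. r \<in> carrier R \<Longrightarrow> h'' (\<sigma> r) = \<tau> r"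
      "\<And>l m. l \<in> I \<Longrightarrow> m \<in> carrier M \<Longrightarrow> h (?F l m) = h'' (?F l m)" for h''
  proof -
    have r: "restrict h'' (carrier S) \<in> alg_hom k S \<eta>S T \<eta>T"
      by (rule alg_hom_restrict[OF universal_graded_hom_ring_facts(9) graded_alg_hom_alg_hom[OF h''(1)]])
    have "restrict h'' (carrier S) y = h'' y" if "y \<in> Sg \<gamma>" for y \<gamma>
      using SG.component_closed[OF that] by simp
    then have rg: "restrict h'' (carrier S) \<in> graded_alg_hom k S \<eta>S Sg T \<eta>T Tg"
      using r h''(1) by (auto simp: graded_alg_hom_def)
    have \<sigma>: "restrict h'' (carrier S) (\<sigma> r) = \<tau> r" if "r \<in> carrier R" for r
      using that h''(2) ring_hom_closed[OF universal_graded_hom_ring_facts(2)] by simp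
    have "is_base_change R M P S \<sigma> f T \<tau> g (restrict h'' (carrier S))"
      by (rule iffD2[OF is_base_change_iff_coordinates[OF dual_basis_axioms M.left_module_axioms
              universal_graded_hom_ring_facts(1-4) alg_hom_ring_hom[OF r] \<sigma>
              universal_graded_module_hom gm]])
        (use g(2) h''(3) coordinate_family_closed[OF universal_graded_coordinates(1)] in simp_all)
    then show ?thesis using rg \<sigma> by simp
  qed
  have "\<exists>!h. ?Q h"
    using univ[unfolded is_universal_graded_hom_ring_def, THEN conjunct2, THEN conjunct2, rule_format, OF T g(1)] .
  then have "restrict h (carrier S) = restrict h' (carrier S)"
    using Q[OF h] Q[OF h' eq] by (elim ex1E) blast
  then show ?thesis using x restrict_apply'[of x "carrier S"] by metis
qed

end

text \<open>The coordinates are extended one at a time; what remains is that the matrix relation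
  between them persists.\<close>

lemma ex_coordinate_family_extension:
  assumes T: "ring T" and \<tau>: "\<tau> \<in> ring_hom R T"
    and H: "coordinate_family (degree_zero_ring R Rg) (M\<lparr>carrier := Mg 0\<rparr>) I p \<mu> T \<tau> H"
  obtains G where "coordinate_family R M I p \<mu> T \<tau> G" "\<And>l m. l \<in> I \<Longrightarrow> m \<in> Mg 0 \<Longrightarrow> G l m = H l m"
proof -
  interpret T: ring T by fact
  have "\<forall>l\<in>I. \<exists>G. semilinear R M T \<tau> G \<and> (\<forall>m\<in>Mg 0. G m = H l m)"
  proof
    fix l assume l: "l \<in> I"
    have "semilinear (degree_zero_ring R Rg) (M\<lparr>carrier := Mg 0\<rparr>) T \<tau> (H l)"
      using H l by (simp add: coordinate_family_alt)
    then obtain G where "semilinear R M T \<tau> G" "\<And>m. m \<in> Mg 0 \<Longrightarrow> G m = H l m"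
      by (rule ex_semilinear_extension[OF T \<tau>]) (rule that)
    then show "\<exists>G. semilinear R M T \<tau> G \<and> (\<forall>m\<in>Mg 0. G m = H l m)" by blast
  qed
  then obtain G where G: "\<And>l. l \<in> I \<Longrightarrow> semilinear R M T \<tau> (G l)" "\<And>l m. l \<in> I \<Longrightarrow> m \<in> Mg 0 \<Longrightarrow> G l m = H l m"
    by (auto dest!: bchoice)
  have e: "\<tau> (\<mu> l (p k)) \<in> carrier T" if "k \<in> I" "l \<in> I" for k l
    using ring_hom_closed[OF \<tau> RG.component_closed[OF \<mu>_graded[OF that(2) p_degree_zero[OF that(1)]]]] .
  have Ga: "G l \<in> add_hom M T" and Gs: "\<And>r m. r \<in> carrier R \<Longrightarrow> m \<in> carrier M \<Longrightarrow> G l (r \<odot>\<^bsub>M\<^esub> m) = \<tau> r \<otimes>\<^bsub>T\<^esub> G l m"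
    if "l \<in> I" for l
    using G(1)[OF that] by (auto simp: semilinear_def)
  have Gc: "G l m \<in> carrier T" if "l \<in> I" "m \<in> carrier M" for l m
    using add_hom_closed[OF Ga] that .
  \<comment> \<open>The matrix multiplies on the right, so both sides are linear along
    \<open>\<tau>\<close> from the left. They agree on M_0, which determines such maps.\<close>
  have "G l m = (\<Oplus>\<^bsub>T\<^esub>k\<in>I. G k m \<otimes>\<^bsub>T\<^esub> \<tau> (\<mu> l (p k)))" if l: "l \<in> I" and m: "m \<in> carrier M" for l m
  proof (rule semilinear_unique[OF T G(1)[OF l] _ _ m])
    let ?s = "\<lambda>m. \<Oplus>\<^bsub>T\<^esub>k\<in>I. G k m \<otimes>\<^bsub>T\<^esub> \<tau> (\<mu> l (p k))"
    show "semilinear R M T \<tau> ?s"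
      unfolding semilinear_def
    proof (intro conjI ballI add_homI)
      show "?s m \<in> carrier T" if "m \<in> carrier M" for m
        using that l Gc e by (auto intro!: T.finsum_closed)
      show "?s (x \<oplus>\<^bsub>M\<^esub> y) = ?s x \<oplus>\<^bsub>T\<^esub> ?s y" if "x \<in> carrier M" "y \<in> carrier M" for x y
        by (rule trans[OF T.finsum_cong'[OF refl] T.finsum_addf])
          (use that l Gc e in \<open>auto simp: add_hom_add[OF Ga] T.l_distr\<close>)
      show "?s (r \<odot>\<^bsub>M\<^esub> m) = \<tau> r \<otimes>\<^bsub>T\<^esub> ?s m" if r: "r \<in> carrier R" and m: "m \<in> carrier M" for r m
      proof -
        have "?s (r \<odot>\<^bsub>M\<^esub> m) = (\<Oplus>\<^bsub>T\<^esub>k\<in>I. \<tau> r \<otimes>\<^bsub>T\<^esub> (G k m \<otimes>\<^bsub>T\<^esub> \<tau> (\<mu> l (p k))))"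
          using r m l Gc e ring_hom_closed[OF \<tau>]
          by (intro T.finsum_cong' refl) (auto simp: Gs T.m_assoc)
        also have "\<dots> = \<tau> r \<otimes>\<^bsub>T\<^esub> ?s m"
          using r m l Gc e ring_hom_closed[OF \<tau>] finite_I by (intro T.finsum_rdistr[symmetric]) auto
        finally show ?thesis .
      qed
    qed
    fix m assume m: "m \<in> Mg 0"
    have "G l m = (\<Oplus>\<^bsub>T\<^esub>k\<in>I. H k m \<otimes>\<^bsub>T\<^esub> \<tau> (\<mu> l (p k)))"
      using H l m G(2)[OF l m] unfolding coordinate_family_alt by simp
    also have "\<dots> = ?s m"
      using m l Gc e by (intro T.finsum_cong' refl) (auto simp: G(2)[symmetric])
    finally show "G l m = ?s m" .
  qed
  then have "coordinate_family R M I p \<mu> T \<tau> G"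
    using G(1) by (simp add: coordinate_family_alt)
  then show thesis using that G(2) by blast
qed

lemma coordinate_family_eq:
  assumes T: "ring T"
    and G: "coordinate_family R M I p \<mu> T \<tau> G" "coordinate_family R M I p \<mu> T \<tau> H"
    and eq: "\<And>l m. l \<in> I \<Longrightarrow> m \<in> Mg 0 \<Longrightarrow> G l m = H l m"
    and "l \<in> I" "m \<in> carrier M"
  shows "G l m = H l m"
  using semilinear_unique[OF T, of \<tau> "G l" "H l" m] assms by (auto simp: coordinate_family_alt)

end

theorem proposition5p5:
  fixes k :: "'k ring" and kg :: "'g::ab_group_add \<Rightarrow> 'k set"
    and R :: "'r ring" and \<eta> :: "'k \<Rightarrow> 'r" and Rg :: "'g \<Rightarrow> 'r set"
    and M :: "('r, 'm) module" and Mg :: "'g \<Rightarrow> 'm set"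
    and P :: "('r, 'p) module" and Pg :: "'g \<Rightarrow> 'p set"
    and S :: "'u ring" and \<eta>S :: "'k \<Rightarrow> 'u" and Sg :: "'g \<Rightarrow> 'u set" and \<sigma> :: "'r \<Rightarrow> 'u"
    and f :: "('u \<times> 'm \<Rightarrow>\<^sub>0 int) set \<Rightarrow> ('u \<times> 'p \<Rightarrow>\<^sub>0 int) set"
    and B :: "'u ring" and \<eta>B :: "'k \<Rightarrow> 'u" and \<beta> :: "'r \<Rightarrow> 'u"
    and f0 :: "('u \<times> 'm \<Rightarrow>\<^sub>0 int) set \<Rightarrow> ('u \<times> 'p \<Rightarrow>\<^sub>0 int) set"
    and C :: "'u ring" and \<eta>C :: "'k \<Rightarrow> 'u" and i :: "'r \<Rightarrow> 'u" and j :: "'u \<Rightarrow> 'u"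
  assumes k: "cring k" "graded_ring k kg" "kg = concentrated k"
    and R: "graded_algebra k kg R \<eta> Rg" "strongly_graded_ring R Rg"
    and M: "graded_module R Rg M Mg"
    and P: "graded_fg_projective R Rg P Pg"
    \<comment> \<open>\<open>S = R\<langle>f : M \<rightarrow> P\<rangle>\<close>\<close>
    and S: "is_universal_graded_hom_ring TYPE('u) k kg R \<eta> Rg M Mg P Pg S \<eta>S Sg \<sigma> f"
    \<comment> \<open>\<open>B = R\<^sub>0\<langle>f\<^sub>0 : M\<^sub>0 \<rightarrow> P\<^sub>0\<rangle>\<close>\<close>
    and B: "is_universal_hom_ring TYPE('u) k (R\<lparr>carrier := Rg 0\<rparr>) \<eta>
              (M\<lparr>carrier := Mg 0\<rparr>) (P\<lparr>carrier := Pg 0\<rparr>) B \<eta>B \<beta> f0"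
    \<comment> \<open>\<open>C = R * B\<close> over \<open>R\<^sub>0\<close>; the second test type makes room for the group algebra of \<open>\<Gamma>\<close> over \<open>C\<close>\<close>
    and C: "is_coproduct TYPE('u) k (R\<lparr>carrier := Rg 0\<rparr>) \<eta> R \<eta> (\<lambda>r. r) B \<eta>B \<beta> C \<eta>C i j"
           "is_coproduct TYPE('g \<Rightarrow> 'u) k (R\<lparr>carrier := Rg 0\<rparr>) \<eta> R \<eta> (\<lambda>r. r) B \<eta>B \<beta> C \<eta>C i j"
  shows "graded_algebras_isomorphic k kg
           C \<eta>C (coproduct_grading C i Rg j (concentrated B)) S \<eta>S Sg"
proof -

  \<comment> \<open>Degree-zero data and a common dual basis\<close>
  let ?R0 = "R\<lparr>carrier := Rg 0\<rparr>" and ?M0 = "M\<lparr>carrier := Mg 0\<rparr>" and ?P0 = "P\<lparr>carrier := Pg 0\<rparr>"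
  let ?S0 = "S\<lparr>carrier := Sg 0\<rparr>" and ?Bg = "concentrated B :: 'g \<Rightarrow> 'u set"
  have RB: "R_ring k ?R0 \<eta> B \<eta>B \<beta>" using B by (simp add: is_universal_hom_ring_def)
  then have kB: "k_algebra k B \<eta>B" and kR0: "k_algebra k ?R0 \<eta>" and \<beta>: "\<beta> \<in> alg_hom k ?R0 \<eta> B \<eta>B"
    by (simp_all add: R_ring_def)
  interpret R0: ring ?R0 using kR0 by (simp add: k_algebra_def)
  interpret B: ring B using kB by (simp add: k_algebra_def)
  \<comment> \<open>The hypothesis on B makes R_0 an algebra, and its unit is that of R.\<close>
  have one: "\<one>\<^bsub>R\<^esub> \<in> Rg 0" using R0.one_closed by simp
  have kR: "k_algebra k R \<eta>" using R(1) by (simp add: graded_algebra_def)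
  have \<eta>R0: "\<eta> c \<in> Rg 0" if "c \<in> carrier k" for c
    using R(1) that k(3) by (auto simp: graded_algebra_def concentrated_def image_subset_iff)
  interpret Rs: strongly_graded_ring R Rg by (rule R(2))
  have P': "graded_module R Rg P Pg" using P by (simp add: graded_fg_projective_def)
  then have modules: "left_module R M" "left_module R P" using M by (auto simp: graded_module_def)
  interpret Mm: strongly_graded_module R Rg M Mg
    by (intro strongly_graded_module.intro strongly_graded_module_axioms.intro R(2) M one modules)
  interpret Pm: strongly_graded_module R Rg P Pg
    by (intro strongly_graded_module.intro strongly_graded_module_axioms.intro R(2) P' one modules)
  obtain I :: "(nat \<times> nat) set" and p \<mu> where dual: "dual_basis R P I p \<mu>"
    and p0: "\<And>l. l \<in> I \<Longrightarrow> p l \<in> Pg 0" and \<mu>g: "\<And>l \<gamma> x. l \<in> I \<Longrightarrow> x \<in> Pg \<gamma> \<Longrightarrow> \<mu> l x \<in> Rg \<gamma>"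
    by (rule Pm.ex_graded_dual_basis[OF P]) (rule that)
  interpret GC: graded_coordinates R Rg M Mg P Pg I p \<mu>
    by (intro graded_coordinates.intro graded_coordinates_axioms.intro Mm.strongly_graded_module_axioms
        Pm.strongly_graded_module_axioms dual p0 \<mu>g)
  have dual0: "dual_basis ?R0 ?P0 I p \<mu>"
    by (rule Pm.degree_zero_dual_basis[OF dual p0 \<mu>g])
  have M0: "left_module ?R0 ?M0" by (rule Mm.degree_zero_module)
  have e0: "\<mu> l (p k) \<in> carrier ?R0" if "k \<in> I" "l \<in> I" for k l
    using \<mu>g[OF that(2) p0[OF that(1)]] by simp

  \<comment> \<open>The graded algebra structure of the coproduct\<close>
  interpret CP: graded_coproduct k ?R0 \<eta> R \<eta> "\<lambda>r. r" Rg B \<eta>B \<beta> ?Bg C \<eta>C i j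
  proof (intro graded_coproduct.intro C Rs.graded_ring_axioms one \<eta>R0)
    show "graded_ring B ?Bg" by (rule concentrated_graded_ring[OF B.ring_axioms])
    show "\<one>\<^bsub>B\<^esub> \<in> ?Bg 0" by (simp add: concentrated_def)
    show "\<eta>B c \<in> ?Bg 0" if "c \<in> carrier k" for c
      using ring_hom_closed[OF k_algebra.structure_hom[OF kB] that] by (simp add: concentrated_def)
    show "\<beta> d \<in> ?Bg 0" if "d \<in> carrier ?R0" for d
      using ring_hom_closed[OF alg_hom_ring_hom[OF \<beta>] that] by (simp add: concentrated_def)
  qed auto
  let ?Cg = "coproduct_grading C i Rg j ?Bg"
  have kC: "k_algebra k C \<eta>C" by (rule CP.k_algebra_C)
  have iR0: "i \<in> alg_hom k ?R0 \<eta> C \<eta>C"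
    using CP.i_hom by (auto simp: alg_hom_def ring_hom_def)
  have "\<eta>C ` kg \<gamma> \<subseteq> ?Cg \<gamma>" for \<gamma>
  proof
    fix x assume "x \<in> \<eta>C ` kg \<gamma>"
    then obtain c where c: "c \<in> kg \<gamma>" "x = \<eta>C c" by blast
    then have "c \<in> carrier k" "\<eta> c \<in> Rg \<gamma>"
      using k R(1) by (auto simp: graded_algebra_def concentrated_def cring_def ring.ring_simprules split: if_splits)
    then show "x \<in> ?Cg \<gamma>"
      using CP.i_graded[of "\<eta> c" \<gamma>] alg_hom_structure[OF CP.i_hom] c(2) by simp
  qed
  then have gaC: "graded_algebra k kg C \<eta>C ?Cg"
    using k(2) CP.graded_ring_C kC by (simp add: graded_algebra_def)
  have RC: "graded_R_ring k kg R \<eta> Rg C \<eta>C ?Cg i"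
    using R(1) gaC CP.i_hom CP.i_graded by (auto simp: graded_R_ring_def graded_alg_hom_def)
  have R0C: "R_ring k ?R0 \<eta> C \<eta>C i" using kR0 kC iR0 by (simp add: R_ring_def)

  \<comment> \<open>The graded universal ring and its degree-zero subring\<close>
  have RS: "graded_R_ring k kg R \<eta> Rg S \<eta>S Sg \<sigma>" using S by (simp add: is_universal_graded_hom_ring_def)
  then have gaS: "graded_algebra k kg S \<eta>S Sg" and \<sigma>: "\<sigma> \<in> graded_alg_hom k R \<eta> Rg S \<eta>S Sg"
    by (simp_all add: graded_R_ring_def)
  note \<sigma>a = graded_alg_hom_alg_hom[OF \<sigma>]
  note \<sigma>r = alg_hom_ring_hom[OF \<sigma>a]
  have \<sigma>g: "\<sigma> r \<in> Sg \<gamma>" if "r \<in> Rg \<gamma>" for r \<gamma> using \<sigma> that by (auto simp: graded_alg_hom_def)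
  have kS: "k_algebra k S \<eta>S" and \<eta>Sg: "\<And>\<gamma>. \<eta>S ` kg \<gamma> \<subseteq> Sg \<gamma>" and grS: "graded_ring S Sg"
    using gaS by (simp_all add: graded_algebra_def)
  interpret S: graded_ring S Sg by (rule grS)
  interpret SG: graded_group S Sg by (rule S.graded_group)
  have S1: "\<one>\<^bsub>S\<^esub> \<in> Sg 0" using \<sigma>g[OF one] ring_hom_one[OF \<sigma>r] by simp
  interpret S0: ring ?S0 by (rule S.degree_zero_ring[OF S1])

  \<comment> \<open>The map from S to the coproduct\<close>
  let ?F = "coordinates R M P \<mu> S \<sigma> f" and ?H = "coordinates ?R0 ?M0 ?P0 \<mu> B \<beta> f0"
  note F = GC.universal_graded_coordinates[OF S RS]
  have F0: "coordinate_family ?R0 ?M0 I p \<mu> B \<beta> ?H"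
    by (rule universal_coordinates[OF B dual0 M0 RB])

  \<comment> \<open>Since j and i agree on R_0, the image of the universal family over R_0 is linear
    along i, and hence ready to be extended to M.\<close>
  have jF0: "coordinate_family ?R0 ?M0 I p \<mu> C i (\<lambda>l m. j (?H l m))"
    by (rule coordinate_family_comp[OF R0.ring_axioms alg_hom_ring_hom[OF \<beta>] B.ring_axioms
          CP.C.ring_axioms F0 CP.j_ring_hom _ e0]) (use CP.ij in auto)
  obtain G where G: "coordinate_family R M I p \<mu> C i G"
    "\<And>l m. l \<in> I \<Longrightarrow> m \<in> Mg 0 \<Longrightarrow> G l m = j (?H l m)"
    by (rule GC.ex_coordinate_family_extension[OF CP.C.ring_axioms CP.i_ring_hom jF0]) (rule that)
  have G_graded: "G l m \<in> ?Cg \<gamma>" if "l \<in> I" "m \<in> Mg \<gamma>" for l m \<gamma>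
  proof (rule Mm.semilinear_graded[OF CP.graded_ring_C _ _ _ that(2)])
    show "semilinear R M C i (G l)" using G(1) that(1) by (simp add: coordinate_family_alt)
    show "G l m \<in> ?Cg 0" if "m \<in> Mg 0" for m
    proof -
      have "?H l m \<in> ?Bg 0"
        using coordinate_family_closed[OF F0 \<open>l \<in> I\<close>, of m] that by (simp add: concentrated_def)
      then show ?thesis using CP.j_graded G(2)[OF \<open>l \<in> I\<close> that] by simp
    qed
  qed (use CP.i_graded in auto)
  obtain \<phi> where \<phi>: "\<phi> \<in> graded_alg_hom k S \<eta>S Sg C \<eta>C ?Cg" "\<And>r. r \<in> carrier R \<Longrightarrow> \<phi> (\<sigma> r) = i r"
    "\<And>l m. l \<in> I \<Longrightarrow> m \<in> carrier M \<Longrightarrow> \<phi> (?F l m) = G l m"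
    by (rule GC.universal_graded_hom_ring_lift[OF S RC G(1)]) (rule G_graded, assumption, assumption, rule that)
  note \<phi>a = graded_alg_hom_alg_hom[OF \<phi>(1)]

  \<comment> \<open>The map from the coproduct to S\<close>
  have \<sigma>R0: "\<sigma> \<in> alg_hom k ?R0 \<eta> ?S0 \<eta>S"
    using \<sigma>a \<sigma>g by (auto simp: alg_hom_def ring_hom_def)
  have kS0: "k_algebra k ?S0 \<eta>S"
  proof (intro k_algebra.intro k_algebra_axioms.intro k(1) S0.ring_axioms)
    show "\<eta>S \<in> ring_hom k ?S0"
      using k_algebra.structure_hom[OF kS] \<eta>Sg[of 0] k(3)
      by (auto simp: ring_hom_def concentrated_def)
    show "\<eta>S c \<otimes>\<^bsub>?S0\<^esub> x = x \<otimes>\<^bsub>?S0\<^esub> \<eta>S c" if "c \<in> carrier k" "x \<in> carrier ?S0" for c x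
      using k_algebra.central[OF kS that(1), of x] that(2) by simp
  qed
  have R0S0: "R_ring k ?R0 \<eta> ?S0 \<eta>S \<sigma>" using kR0 kS0 \<sigma>R0 by (simp add: R_ring_def)
  \<comment> \<open>On M_0 the graded universal family takes values in S_0. The matrix relation is
    inherited because its entries come from R_0, so that the sum may be formed in S_0.\<close>
  have F_S0: "coordinate_family ?R0 ?M0 I p \<mu> ?S0 \<sigma> ?F"
    unfolding coordinate_family_def
  proof (intro ballI conjI)
    fix l assume l: "l \<in> I"
    have Fl: "?F l \<in> add_hom M S" "\<And>r m. r \<in> carrier R \<Longrightarrow> m \<in> carrier M \<Longrightarrow>
        ?F l (r \<odot>\<^bsub>M\<^esub> m) = \<sigma> r \<otimes>\<^bsub>S\<^esub> ?F l m"
      "\<And>m. m \<in> carrier M \<Longrightarrow> ?F l m = (\<Oplus>\<^bsub>S\<^esub>k\<in>I. ?F k m \<otimes>\<^bsub>S\<^esub> \<sigma> (\<mu> l (p k)))"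
      using F(1) l unfolding coordinate_family_def by blast+
    show "?F l \<in> add_hom ?M0 ?S0"
      by (rule add_homI) (simp_all add: F(2)[OF l] add_hom_add[OF Fl(1)])
    show "?F l (r \<odot>\<^bsub>?M0\<^esub> m) = \<sigma> r \<otimes>\<^bsub>?S0\<^esub> ?F l m" if "r \<in> carrier ?R0" "m \<in> carrier ?M0" for r m
      using that Fl(2) by simp
    fix m assume "m \<in> carrier ?M0"
    then have m: "m \<in> Mg 0" "m \<in> carrier M" by auto
    have "?F k m \<otimes>\<^bsub>S\<^esub> \<sigma> (\<mu> l (p k)) \<in> Sg 0" if "k \<in> I" for k
      using S.graded_mult[OF F(2)[OF that m(1)] \<sigma>g, of "\<mu> l (p k)" 0] e0[OF that l] by simp
    then have "(\<Oplus>\<^bsub>?S0\<^esub>k\<in>I. ?F k m \<otimes>\<^bsub>S\<^esub> \<sigma> (\<mu> l (p k))) = (\<Oplus>\<^bsub>S\<^esub>k\<in>I. ?F k m \<otimes>\<^bsub>S\<^esub> \<sigma> (\<mu> l (p k)))"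
      using add_hom_finsum[OF S0.is_abelian_group S.is_abelian_group, of "\<lambda>x. x" I] add_homI[of ?S0 "\<lambda>x. x" S]
      by simp
    then show "?F l m = (\<Oplus>\<^bsub>?S0\<^esub>k\<in>I. ?F k m \<otimes>\<^bsub>?S0\<^esub> \<sigma> (\<mu> l (p k)))"
      using Fl(3)[OF m(2)] by simp
  qed
  \<comment> \<open>Testing B on S_0 rather than on S guarantees that v lands in degree zero, which
    is what makes the map out of the coproduct graded.\<close>
  obtain v where v: "v \<in> alg_hom k B \<eta>B ?S0 \<eta>S" "\<And>r. r \<in> carrier ?R0 \<Longrightarrow> v (\<beta> r) = \<sigma> r"
    "\<And>l m. l \<in> I \<Longrightarrow> m \<in> carrier ?M0 \<Longrightarrow> v (?H l m) = ?F l m"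
    by (rule universal_hom_ring_lift[OF B dual0 M0 R0S0 F_S0]) (rule that)
  have vS: "v \<in> alg_hom k B \<eta>B S \<eta>S"
    using v(1) by (auto simp: alg_hom_def ring_hom_def Pi_iff intro: SG.component_closed[of _ 0])
  obtain \<psi> where \<psi>: "\<psi> \<in> alg_hom k C \<eta>C S \<eta>S" "\<And>x. x \<in> carrier R \<Longrightarrow> \<psi> (i x) = \<sigma> x"
    "\<And>y. y \<in> carrier B \<Longrightarrow> \<psi> (j y) = v y"
  proof (rule coproduct_hom[OF C(1) kS \<sigma>a vS])
    show "\<sigma> r = v (\<beta> r)" if "r \<in> carrier ?R0" for r using v(2)[OF that] by simp
  qed (rule that)
  note \<psi>r = alg_hom_ring_hom[OF \<psi>(1)]
  have v_graded: "v y \<in> Sg \<gamma>" if "y \<in> ?Bg \<gamma>" for y \<gamma>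
  proof (cases "\<gamma> = 0")
    case True
    then show ?thesis
      using that ring_hom_closed[OF alg_hom_ring_hom[OF v(1)], of y] by (simp add: concentrated_def)
  next
    case False
    then have "y = \<zero>\<^bsub>B\<^esub>" using that by (simp add: concentrated_def)
    then show ?thesis
      using add_hom_zero[OF B.is_abelian_group S.is_abelian_group ring_hom_add_hom[OF alg_hom_ring_hom[OF vS]]]
      by simp
  qed
  have \<psi>_mon: "\<psi> c \<in> Sg \<gamma>" if "(\<gamma>, c) \<in> CP.Mon" for c \<gamma>
    using that
  proof (induction rule: coproduct_monomials.induct)
    case one
    show ?case using S1 ring_hom_one[OF \<psi>r] by simp
  next
    case (left x \<alpha> \<gamma> c)
    have x: "x \<in> carrier R" using left(1) by simp
    show ?case
      using S.graded_mult[OF \<sigma>g[OF left(1)] left(3)] x CP.monomial_closed[OF left(2)]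
      by (simp add: ring_hom_mult[OF \<psi>r] CP.i_closed \<psi>(2))
  next
    case (right x \<alpha> \<gamma> c)
    have x: "x \<in> carrier B" using CP.BG.component_closed[OF right(1)] .
    show ?case
      using S.graded_mult[OF v_graded[OF right(1)] right(3)] x CP.monomial_closed[OF right(2)]
      by (simp add: ring_hom_mult[OF \<psi>r] CP.j_closed \<psi>(3))
  qed
  have \<psi>g: "\<psi> x \<in> Sg \<gamma>" if "x \<in> ?Cg \<gamma>" for x \<gamma>
    using that[unfolded coproduct_grading_def] CP.monomials_subset
  proof (induction rule: CP.C.generate_add_induct)
    case zero
    show ?case
      using add_hom_zero[OF CP.C.is_abelian_group S.is_abelian_group ring_hom_add_hom[OF \<psi>r]] by simp
  next
    case (minus c)
    then have "c \<in> carrier C" using CP.monomials_subset by blast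
    then show ?case
      using add_hom_minus[OF CP.C.is_abelian_group S.is_abelian_group ring_hom_add_hom[OF \<psi>r]] minus
      by (simp add: SG.component_minus_closed)
  qed (use \<psi>_mon in \<open>auto simp: ring_hom_add[OF \<psi>r] SG.component_add_closed\<close>)
  have \<psi>ga: "\<psi> \<in> graded_alg_hom k C \<eta>C ?Cg S \<eta>S Sg"
    using \<psi>(1) \<psi>g by (auto simp: graded_alg_hom_def)

  \<comment> \<open>The two maps are mutually inverse\<close>
  have \<phi>v: "\<phi> (v y) = j y" if "y \<in> carrier B" for y
  \<comment> \<open>Two homomorphisms B to C over R_0; on the universal family both give G
    restricted to M_0.\<close>
  proof (rule universal_hom_ring_unique[OF B dual0 M0 R0C alg_hom_comp[OF vS \<phi>a] _ CP.j_hom _ _ that])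
    show "\<phi> (v (\<beta> r)) = i r" if "r \<in> carrier ?R0" for r
      using v(2)[OF that] \<phi>(2) that by simp
    show "j (\<beta> r) = i r" if "r \<in> carrier ?R0" for r
      using CP.ij[OF that] by simp
    show "\<phi> (v (?H l m)) = j (?H l m)" if "l \<in> I" "m \<in> carrier ?M0" for l m
      using v(3)[OF that] \<phi>(3) G(2) that by simp
  qed
  \<comment> \<open>On the image of R both maps are i, and on the image of B the preceding identity
    applies.\<close>
  have \<phi>\<psi>: "\<phi> (\<psi> x) = x" if "x \<in> carrier C" for x
    by (rule coproduct_hom_unique[OF C(1) kC alg_hom_comp[OF \<psi>(1) \<phi>a] alg_hom_id _ _ that])
      (simp_all add: \<psi> \<phi> \<phi>v)
  \<comment> \<open>Two coordinate families over S that agree on M_0, hence everywhere. This is the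
    step from M_0 to M that uniqueness over S requires.\<close>
  have \<psi>G: "\<psi> (G l m) = ?F l m" if "l \<in> I" "m \<in> carrier M" for l m
  proof (rule GC.coordinate_family_eq[OF S.ring_axioms _ F(1) _ that])
    show "coordinate_family R M I p \<mu> S \<sigma> (\<lambda>l m. \<psi> (G l m))"
      by (rule coordinate_family_comp[OF Rs.ring_axioms CP.i_ring_hom CP.C.ring_axioms S.ring_axioms
            G(1) \<psi>r \<psi>(2)]) (use Mm.RG.component_closed[OF e0[simplified]] in simp_all)
    show "\<psi> (G l m) = ?F l m" if "l \<in> I" "m \<in> Mg 0" for l m
      using G(2)[OF that] \<psi>(3) v(3) coordinate_family_closed[OF F0 that(1), of m] that by simp
  qed
  have \<psi>\<phi>: "\<psi> (\<phi> x) = x" if "x \<in> carrier S" for x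
  proof (rule GC.universal_graded_hom_ring_unique[OF S RS _ _ _ _ _ that])
    show "(\<lambda>x. \<psi> (\<phi> x)) \<in> graded_alg_hom k S \<eta>S Sg S \<eta>S Sg"
      using alg_hom_comp[OF \<phi>a \<psi>(1)] \<phi>(1) \<psi>g by (fastforce simp: graded_alg_hom_def)
    show "(\<lambda>x. x) \<in> graded_alg_hom k S \<eta>S Sg S \<eta>S Sg"
      by (simp add: graded_alg_hom_def alg_hom_id)
  qed (simp_all add: \<phi> \<psi> \<psi>G)
  have \<phi>c: "\<phi> x \<in> carrier C" if "x \<in> carrier S" for x
    using ring_hom_closed[OF alg_hom_ring_hom[OF \<phi>a] that] .
  have \<psi>c: "\<psi> x \<in> carrier S" if "x \<in> carrier C" for x
    using ring_hom_closed[OF \<psi>r that] .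
  have "bij_betw \<psi> (carrier C) (carrier S)"
    by (rule bij_betw_byWitness[where f' = \<phi>]) (use \<phi>\<psi> \<psi>\<phi> \<phi>c \<psi>c in auto)
  moreover have "\<psi> ` ?Cg \<gamma> = Sg \<gamma>" for \<gamma>
  proof
    show "\<psi> ` ?Cg \<gamma> \<subseteq> Sg \<gamma>" using \<psi>g by blast
    \<comment> \<open>The inverse map preserves degrees too, so it supplies a preimage of the same
      degree.\<close>
    show "Sg \<gamma> \<subseteq> \<psi> ` ?Cg \<gamma>"
    proof
      fix x assume x: "x \<in> Sg \<gamma>"
      then have "\<phi> x \<in> ?Cg \<gamma>" using \<phi>(1) by (auto simp: graded_alg_hom_def)
      moreover have "x = \<psi> (\<phi> x)" using \<psi>\<phi>[of x] x by simp
      ultimately show "x \<in> \<psi> ` ?Cg \<gamma>" by blast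
    qed
  qed
  ultimately show ?thesis
    unfolding graded_algebras_isomorphic_def using gaC gaS \<psi>(1) by blast
qed

end
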